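(* Let $k\ge 3$ be a fixed integer, and let $\sigma(k)$ be a real number with $\frac12\le\sigma(k)<1$ such that for every $\varepsilon>0$ one has $\int_0^T|\zeta(\sigma(k)+it)|^{2k}\,dt\ll_\varepsilon T^{1+\varepsilon}$. (i) If $\sigma(k)=\frac12$, then for every $\varepsilon>0$ and for $X^{\varepsilon}\le h=h(X)\le X^{1-\varepsilon}$, $$\int_X^{2X}\bigl(\Delta_k(x+h)-\Delta_k(x)\bigr)^2\,dx\ \ll_\varepsilon\ X^{1+\varepsilon}h^{4/3}.$$ (ii) If $\frac12<\sigma(k)<1$ and $\theta(k)$ is any constant satisfying $2\sigma(k)-1<\theta(k)<1$, then there exists $\varepsilon_1=\varepsilon_1(k)>0$ such that, for every $\varepsilon>0$ and for $X^{\theta(k)}\le h=h(X)\le X^{1-\varepsilon}$, $$\int_X^{2X}\bigl(\Delta_k(x+h)-\Delta_k(x)\bigr)^2\,dx\ \ll_{\varepsilon_1}\ X^{1-\varepsilon_1}h^{2}.$$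
   Context: $\zeta(s)$ is the Riemann zeta-function. For an integer $k\ge2$, $d_k(n)$ is the number of ways of writing $n$ as an ordered product of $k$ positive integer factors, so that $\zeta^k(s)=\sum_{n\ge1}d_k(n)n^{-s}$ for $\Re s>1$. The error term $\Delta_k(x)$ is defined by $$\sum_{n\le x}d_k(n)=\operatorname{Res}_{s=1}\frac{x^s\zeta^k(s)}{s}+\Delta_k(x)=xP_{k-1}(\log x)+\Delta_k(x),$$ where $P_{k-1}$ is a polynomial of degree $k-1$. The notation $a\ll_\varepsilon b$ means $|a|\le C b$ with a constant $C$ that may depend on $\varepsilon$ (and on the fixed quantities $k,\sigma(k),\theta(k)$) but is uniform in $X$ and $h$ in the stated range; the bounds are understood for all sufficiently large $X$ (respectively $T$). In (ii), $k$, $\sigma(k)$ and $\theta(k)$ are fixed constants and $\varepsilon_1$ is chosen after them. *)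

theory Defs
  imports "HOL-Complex_Analysis.Complex_Analysis" "HOL-Library.Landau_Symbols"
begin

(* The Riemann zeta-function by analytic continuation from Re w > 1.  The continuation is taken
   to punctured half-planes {Re w > a} - {1} with a < Re s; these are connected and any two of
   them are nested, so the value does not depend on a or f for s \<noteq> 1.  Letting a tend to
   -infinity gives zeta on the whole plane minus 1.  The value at the pole s = 1 is unspecified. *)
definition zeta :: "complex \<Rightarrow> complex" where
  "zeta s = (THE z. \<exists>a f. a < Re s
     \<and> f holomorphic_on ({w. Re w > a} - {1})
     \<and> (\<forall>w. Re w > 1 \<longrightarrow> (\<lambda>n. 1 / of_nat (Suc n) powr w) sums f w)
     \<and> z = f s)"

definition divisor_fun :: "nat \<Rightarrow> nat \<Rightarrow> nat" where
  "divisor_fun k n = card {xs :: nat list. length xs = k \<and> (\<forall>m\<in>set xs. 0 < m) \<and> prod_list xs = n}"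

(* For x > 0 the residue is real, being x times a real polynomial in ln x;
   Re only moves it to type real. *)
definition Delta :: "nat \<Rightarrow> real \<Rightarrow> real" where
  "Delta k x = (\<Sum>n | 1 \<le> n \<and> real n \<le> x. real (divisor_fun k n))
     - Re (residue (\<lambda>s. of_real x powr s * zeta s ^ k / s) 1)"

end

theory Submission
  imports Defs "HOL-Probability.Probability"
begin

text \<open>
  Damp \<open>zeta s ^ k * x powr s / s\<close> by \<open>exp (\<tau>\<^sup>2 s\<^sup>2 / 2)\<close>. On \<open>Re s = 2\<close> the integral is the divisor
  sum smoothed by a normal distribution; moving to \<open>Re s = \<sigma>\<close> picks up the residue at 1, so
  the integrals over \<open>Re s = \<sigma>\<close> tend to \<open>Delta k x\<close> as \<open>\<tau>\<close> tends to 0. By Fatou's lemma it is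
  enough to bound the mean square of their differences uniformly in \<open>\<tau>\<close>.

  Cut the integral at \<open>\<bar>t\<bar> = T = X / h\<close>. Below the cut the difference is the integral over
  \<open>{x..x + h}\<close> of the derivative, which has lost the factor \<open>1 / s\<close>; above it the two terms are
  estimated separately. A Gaussian-weighted mean value theorem in \<open>ln x\<close> bounds the two parts by
  \<open>h\<^sup>2 X powr (2 * \<sigma> - 1)\<close> times the moment of order 2k over \<open>\<bar>t\<bar> \<le> T\<close> and by \<open>X powr (2 * \<sigma> + 1)\<close>
  times its tail weighted by \<open>1 / t\<^sup>2\<close>. Both are \<open>O(h X powr (2 * \<sigma> + \<eta>))\<close> for every \<open>\<eta> > 0\<close>, which
  gives both claims; for (i) it is even stronger, since \<open>h \<le> h powr (4/3)\<close>.
\<close>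

section \<open>The zeta-function on the half-plane Re s > 0\<close>

text \<open>The integral over \<open>Re s = \<sigma>\<close> need not converge absolutely, and the
  moment hypothesis gives no pointwise information on zeta. With the Gaussian factor, a crude bound
  for zeta that is linear in \<open>norm s\<close> justifies every contour step. Constants at that
  stage may blow up as \<tau> tends to 0; they only serve convergence and the shift. The final
  estimates use nothing of the factor but that its norm on the line is at most
  \<open>exp (1/2)\<close> for \<tau> \<le> 1, hence their uniformity.

  The height \<open>X / h\<close> is where the two bounds for the difference of
  \<open>x powr s / s\<close> agree: the derivative gives \<open>h * X powr (\<sigma> - 1)\<close>,
  the triangle inequality \<open>X powr \<sigma> / \<bar>t\<bar>\<close>, up to constants. Each
  range then contributes at most a constant times
  \<open>h * X powr (2 * \<sigma>) * T powr \<eta>\<close>. The condition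
  \<open>h \<le> X powr (1 - \<epsilon>)\<close> makes T large, so that the asymptotic moment
  hypothesis can be applied from T on. In (ii) the excess
  \<open>X powr (2 * \<sigma> - 1 + \<eta>)\<close> is absorbed by one factor
  \<open>h \<ge> X powr \<theta>\<close>, which is where \<open>2 * \<sigma> - 1 < \<theta>\<close>
  enters.\<close>

definition zeta_term :: "nat \<Rightarrow> complex \<Rightarrow> complex" where
  "zeta_term n s = 1 / of_nat (Suc n) powr s
     - (of_nat (n + 2) powr (1 - s) - of_nat (Suc n) powr (1 - s)) / (1 - s)"

text \<open>With \<open>N = Suc n\<close>, the term is the integral of
  \<open>N powr (- s) - y powr (- s)\<close> over y in \<open>{N..N + 1}\<close>. Since
  \<open>y powr (- s)\<close> has derivative of norm at most
  \<open>norm s * N powr (- Re s - 1)\<close> there, one more power of N is gained, and the series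
  converges for \<open>Re s > 0\<close> instead of \<open>Re s > 1\<close>.\<close>

lemma norm_zeta_term_le:
  assumes "Re s > 0" "s \<noteq> 1"
  shows "norm (zeta_term n s) \<le> norm s * real (Suc n) powr (- Re s - 1)"
proof -
  define N where "N = real (Suc n)"
  have N: "N > 0" by (simp add: N_def)
  define S where "S = closed_segment (complex_of_real N) (complex_of_real (N + 1))"
  have S: "\<exists>r. z = of_real r \<and> N \<le> r \<and> r \<le> N + 1" if "z \<in> S" for z
    using that unfolding S_def closed_segment_of_real by (auto simp: closed_segment_eq_real_ivl)
  have nonpos: "z \<notin> \<real>\<^sub>\<le>\<^sub>0" if "z \<in> S" for z
    using S[OF that] N by (auto simp: complex_nonpos_Reals_iff)
  have ends: "complex_of_real N \<in> S" "complex_of_real (N + 1) \<in> S" "convex S"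
    by (auto simp: S_def)
  define B where "B = norm s * N powr (- Re s - 1)"
  have B: "norm (of_real N powr (- s) - z powr (- s)) \<le> B" if "z \<in> S" for z
  proof -
    from S[OF that] obtain r where r: "z = of_real r" "N \<le> r" "r \<le> N + 1" by blast
    have "norm (of_real N powr (- s) - z powr (- s)) \<le> B * norm (of_real N - z)"
    proof (rule field_differentiable_bound[OF ends(3) _ _ ends(1) that])
      fix w assume w: "w \<in> S"
      show "((\<lambda>z. z powr (- s)) has_field_derivative (- s) * w powr (- s - 1)) (at w within S)"
        by (rule has_field_derivative_at_within[OF has_field_derivative_powr[OF nonpos[OF w]]])
      from S[OF w] obtain q where q: "w = of_real q" "N \<le> q" "q \<le> N + 1" by blast
      have "norm (w powr (- s - 1)) = q powr (- Re s - 1)"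
        using q N by (simp add: norm_powr_real_powr)
      also have "\<dots> \<le> N powr (- Re s - 1)"
        using q N assms by (intro powr_mono2') auto
      finally show "norm (- s * w powr (- s - 1)) \<le> B"
        by (simp add: norm_mult B_def mult_left_mono)
    qed
    also have "norm (of_real N - z) = \<bar>N - r\<bar>"
      by (metis norm_of_real of_real_diff r(1))
    also have "B * \<bar>N - r\<bar> \<le> B * 1"
      using r by (intro mult_left_mono) (auto simp: B_def)
    finally show ?thesis by simp
  qed
  \<comment> \<open>The derivative of \<phi> is the integrand
    \<open>N powr (- s) - z powr (- s)\<close>, and its increment over the segment is
    \<open>zeta_term n s\<close>. The mean value inequality for \<phi> thus takes the place of
    estimating the integral.\<close>
  define \<phi> where "\<phi> z = of_real N powr (- s) * z - z powr (1 - s) / (1 - s)" for z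
  have "norm (\<phi> (of_real (N + 1)) - \<phi> (of_real N)) \<le> B * norm (complex_of_real (N + 1) - of_real N)"
  proof (rule field_differentiable_bound[OF ends(3) _ _ ends(2,1)])
    fix w assume w: "w \<in> S"
    have "(\<phi> has_field_derivative of_real N powr (- s) - ((1 - s) * w powr (1 - s - 1)) / (1 - s)) (at w within S)"
      unfolding \<phi>_def
      by (intro derivative_eq_intros DERIV_cdivide has_field_derivative_at_within[OF has_field_derivative_powr[OF nonpos[OF w]]])
         (use assms nonpos[OF w] in auto)
    also have "((1 - s) * w powr (1 - s - 1)) / (1 - s) = w powr (- s)"
      using assms by simp
    finally show "(\<phi> has_field_derivative of_real N powr (- s) - w powr (- s)) (at w within S)" .
    show "norm (of_real N powr (- s) - w powr (- s)) \<le> B" by (rule B[OF w])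
  qed
  also have "norm (complex_of_real (N + 1) - of_real N) = 1" by simp
  also have "\<phi> (of_real (N + 1)) - \<phi> (of_real N) = zeta_term n s"
  proof -
    have e: "complex_of_real N = of_nat (Suc n)" "complex_of_real (N + 1) = of_nat (n + 2)"
      by (simp_all add: N_def)
    have e': "complex_of_nat (n + 2) = of_nat (Suc n) + 1" by simp
    have "p * (m + 1) - b / d - (p * m - a / d) = p - (b - a) / d" for p m a b d :: complex
      by (simp add: algebra_simps diff_divide_distrib)
    from this[of "of_nat (Suc n) powr (- s)" "of_nat (Suc n)" "of_nat (n + 2) powr (1 - s)" "1 - s"
        "of_nat (Suc n) powr (1 - s)"]
    show ?thesis
      unfolding \<phi>_def zeta_term_def e powr_minus_divide by (simp only: e')
  qed
  finally show ?thesis by (simp add: B_def N_def)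
qed

text \<open>For \<open>Re s > 1\<close> the integrals subtracted in \<open>zeta_term\<close> add up
  to the integral of \<open>y powr (- s)\<close> over y \<ge> 1, which is
  \<open>1 / (s - 1)\<close>; this pole term is put back here.\<close>

definition zeta_ext :: "complex \<Rightarrow> complex" where
  "zeta_ext s = 1 / (s - 1) + (\<Sum>n. zeta_term n s)"

lemma summable_Suc_powr:
  assumes "a < -1" shows "summable (\<lambda>n. real (Suc n) powr a)"
  using assms summable_real_powr_iff[of a] summable_Suc_iff[of "\<lambda>n. real n powr a"] by simp

lemma summable_zeta_term:
  assumes "Re s > 0" "s \<noteq> 1"
  shows "summable (\<lambda>n. zeta_term n s)"
proof (rule summable_comparison_test')
  show "summable (\<lambda>n. norm s * real (Suc n) powr (- Re s - 1))"
    using assms by (intro summable_mult summable_Suc_powr) auto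
  show "norm (zeta_term n s) \<le> norm s * real (Suc n) powr (- Re s - 1)" if "n \<ge> 0" for n
    using norm_zeta_term_le[OF assms] .
qed

lemma norm_zeta_ext_le:
  assumes "Re s \<ge> a" "a > 0" "s \<noteq> 1"
  shows "norm (zeta_ext s) \<le> 1 / norm (s - 1) + norm s * (\<Sum>n. real (Suc n) powr (- a - 1))"
proof -
  have sm: "summable (\<lambda>n. norm s * real (Suc n) powr (- a - 1))"
    using assms by (intro summable_mult summable_Suc_powr) auto
  have le: "norm (zeta_term n s) \<le> norm s * real (Suc n) powr (- a - 1)" for n
  proof -
    have "norm (zeta_term n s) \<le> norm s * real (Suc n) powr (- Re s - 1)"
      using assms by (intro norm_zeta_term_le) auto
    also have "\<dots> \<le> norm s * real (Suc n) powr (- a - 1)"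
      using assms by (intro mult_left_mono powr_mono) auto
    finally show ?thesis .
  qed
  have "norm (\<Sum>n. zeta_term n s) \<le> (\<Sum>n. norm s * real (Suc n) powr (- a - 1))"
    by (rule norm_suminf_le[OF le sm])
  also have "\<dots> = norm s * (\<Sum>n. real (Suc n) powr (- a - 1))"
    using assms by (intro suminf_mult summable_Suc_powr) auto
  finally show ?thesis
    unfolding zeta_ext_def
    using norm_triangle_ineq[of "1 / (s - 1)" "\<Sum>n. zeta_term n s"] by (simp add: norm_divide)
qed

abbreviation punctured_halfplane :: "real \<Rightarrow> complex set" where
  "punctured_halfplane a \<equiv> {w. Re w > a} - {1}"

lemma open_punctured_halfplane: "open (punctured_halfplane a)"
  by (intro open_Diff open_halfspace_Re_gt) auto

lemma holomorphic_zeta_ext: "zeta_ext holomorphic_on punctured_halfplane 0"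
proof -
  let ?S = "punctured_halfplane 0"
  obtain g where g: "\<forall>s\<in>?S. (\<lambda>n. zeta_term n s) sums g s \<and> g field_differentiable (at s)"
  proof (rule series_differentiable_comparison_complex[OF open_punctured_halfplane[of 0], of zeta_term])
    fix n s assume s: "s \<in> ?S"
    have nz: "1 - s \<noteq> 0" using s by auto
    show "zeta_term n field_differentiable (at s)"
      unfolding zeta_term_def
      by (rule holomorphic_on_imp_differentiable_at[OF _ open_punctured_halfplane[of 0] s])
         (auto intro!: holomorphic_intros)
  next
    fix s assume s: "s \<in> ?S"
    \<comment> \<open>A ball of radius half the distance to the imaginary axis stays in
      \<open>Re y \<ge> a\<close>, with a > 0, so one summable majorant serves all its
      points.\<close>
    define a where "a = Re s / 2"
    define h where "h n = complex_of_real ((norm s + a) * real (Suc n) powr (- a - 1))" for n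
    have a: "a > 0" using s by (simp add: a_def)
    show "\<exists>d h::nat \<Rightarrow> complex. 0 < d \<and> summable h \<and> range h \<subseteq> \<real>\<^sub>\<ge>\<^sub>0 \<and>
       (\<forall>\<^sub>F n in sequentially. \<forall>y\<in>ball s d \<inter> ?S. norm (zeta_term n y) \<le> norm (h n))"
    proof (rule exI[of _ a], rule exI[of _ h], intro conjI always_eventually allI ballI)
      show "a > 0" by fact
      show "summable h" unfolding h_def
        by (intro summable_of_real summable_mult summable_Suc_powr) (use a in auto)
      show "range h \<subseteq> \<real>\<^sub>\<ge>\<^sub>0" using a by (auto simp: h_def simp del: of_real_mult of_real_add)
      fix n y assume y: "y \<in> ball s a \<inter> ?S"
      have d: "norm (s - y) < a" using y by (simp add: dist_norm)
      have "\<bar>Re (s - y)\<bar> < a" using abs_Re_le_cmod[of "s - y"] d by linarith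
      hence Re: "Re y \<ge> a" by (simp add: a_def abs_if split: if_splits)
      have nm: "norm y \<le> norm s + a" using d norm_triangle_ineq2[of y s] by (simp add: norm_minus_commute)
      have "norm (zeta_term n y) \<le> norm y * real (Suc n) powr (- Re y - 1)"
        using y by (intro norm_zeta_term_le) auto
      also have "\<dots> \<le> (norm s + a) * real (Suc n) powr (- a - 1)"
        using nm Re a by (intro mult_mono powr_mono) auto
      also have "\<dots> \<le> norm (h n)" unfolding h_def norm_of_real by linarith
      finally show "norm (zeta_term n y) \<le> norm (h n)" .
    qed
  qed blast
  have "(\<lambda>s. 1 / (s - 1) + g s) holomorphic_on ?S"
  proof (intro holomorphic_intros)
    show "g holomorphic_on ?S"
      using g by (auto simp: holomorphic_on_def intro: field_differentiable_at_within)
  qed auto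
  thus ?thesis
    by (rule holomorphic_transform) (use g in \<open>auto simp: zeta_ext_def sums_unique\<close>)
qed

text \<open>The subtracted terms telescope, so the partial sums of the two series differ by the
  boundary term \<open>(Suc N powr (1 - s) - 1) / (1 - s)\<close>, which tends to
  \<open>1 / (s - 1)\<close>.\<close>

lemma zeta_ext_sums:
  assumes "Re s > 1"
  shows "(\<lambda>n. 1 / of_nat (Suc n) powr s) sums zeta_ext s"
proof -
  have s: "Re s > 0" "s \<noteq> 1" using assms by auto
  have eq: "(\<Sum>n<N. 1 / of_nat (Suc n) powr s)
     = (\<Sum>n<N. zeta_term n s) + (of_nat (Suc N) powr (1 - s) - 1) / (1 - s)" for N
  proof (induction N)
    case (Suc N)
    have "x + (a - b) / d = y + (b' - b) / d + z" if "x = y + z - (a - b') / d" for x y z a b b' d :: complex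
      unfolding that by (simp add: diff_divide_distrib)
    moreover have "Suc (Suc N) = N + 2" by simp
    ultimately show ?case
      unfolding sum.lessThan_Suc Suc.IH zeta_term_def by (simp add: diff_divide_distrib)
  qed simp
  have "(\<lambda>N. of_nat (Suc N) powr (1 - s)) \<longlonglongrightarrow> 0"
  proof (rule tendsto_norm_zero_cancel)
    have "(\<lambda>N. real (Suc N) powr (1 - Re s)) \<longlonglongrightarrow> 0"
      by (intro tendsto_neg_powr filterlim_compose[OF filterlim_real_sequentially filterlim_Suc])
         (use assms in auto)
    also have "(\<lambda>N. real (Suc N) powr (1 - Re s)) = (\<lambda>N. norm (of_nat (Suc N) powr (1 - s)))"
      by (rule ext, subst norm_powr_real_powr) auto
    finally show "(\<lambda>N. norm (of_nat (Suc N) powr (1 - s))) \<longlonglongrightarrow> 0" .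
  qed
  hence "(\<lambda>N. (\<Sum>n<N. zeta_term n s) + (of_nat (Suc N) powr (1 - s) - 1) / (1 - s))
     \<longlonglongrightarrow> (\<Sum>n. zeta_term n s) + (0 - 1) / (1 - s)"
    using s by (intro tendsto_intros summable_LIMSEQ summable_zeta_term) auto
  also have "(\<Sum>n. zeta_term n s) + (0 - 1) / (1 - s) = zeta_ext s"
    using minus_divide_divide[of 1 "s - 1"] by (simp add: zeta_ext_def)
  finally show ?thesis
    unfolding sums_def eq .
qed

text \<open>Evaluates the definite description: \<open>zeta_ext\<close> on the half-plane with a = 0
  is a witness, and any other candidate agrees with it by analytic continuation from the region
  where both are the Dirichlet series.\<close>

lemma zeta_eq_zeta_ext:
  assumes "Re s > 0" "s \<noteq> 1"
  shows "zeta s = zeta_ext s"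
  unfolding zeta_def
proof (rule the_equality)
  show "\<exists>a f. a < Re s \<and> f holomorphic_on punctured_halfplane a \<and>
      (\<forall>w. 1 < Re w \<longrightarrow> (\<lambda>n. 1 / of_nat (Suc n) powr w) sums f w) \<and> zeta_ext s = f s"
    using assms holomorphic_zeta_ext zeta_ext_sums by blast
next
  fix z assume "\<exists>a f. a < Re s \<and> f holomorphic_on punctured_halfplane a \<and>
      (\<forall>w. 1 < Re w \<longrightarrow> (\<lambda>n. 1 / of_nat (Suc n) powr w) sums f w) \<and> z = f s"
  then obtain a f where f: "a < Re s" "f holomorphic_on punctured_halfplane a"
      "\<And>w. 1 < Re w \<Longrightarrow> (\<lambda>n. 1 / of_nat (Suc n) powr w) sums f w" "z = f s" by blast
  \<comment> \<open>The half-plane of the candidate f may begin on either side of 0, and even to the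
    right of 1. Both functions live on \<open>Re w > b\<close>, and the Dirichlet series is
    available on the part \<open>Re w > max b 1\<close>.\<close>
  define b where "b = max a 0"
  have "f s = zeta_ext s"
  proof (rule analytic_continuation_open[of "{w. Re w > max b 1}" "punctured_halfplane b" f zeta_ext])
    show "{w. Re w > max b 1} \<noteq> {}"
      by (auto intro!: exI[of _ "complex_of_real (max b 1 + 1)"])
    show "open {w. Re w > max b 1}" by (rule open_halfspace_Re_gt)
    show "open (punctured_halfplane b)" by (rule open_punctured_halfplane)
    show "connected (punctured_halfplane b)"
      by (intro connected_open_delete open_halfspace_Re_gt convex_connected convex_halfspace_Re_gt) auto
    show "f holomorphic_on punctured_halfplane b"
      by (rule holomorphic_on_subset[OF f(2)]) (auto simp: b_def)
    show "zeta_ext holomorphic_on punctured_halfplane b"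
      by (rule holomorphic_on_subset[OF holomorphic_zeta_ext]) (auto simp: b_def)
    show "f w = zeta_ext w" if "w \<in> {w. Re w > max b 1}" for w
      using f(3)[of w] zeta_ext_sums[of w] that by (auto simp: sums_iff)
  qed (use assms f in \<open>auto simp: b_def\<close>)
  thus "z = zeta_ext s" using f by simp
qed

lemma holomorphic_zeta: "zeta holomorphic_on punctured_halfplane 0"
  by (rule holomorphic_transform[OF holomorphic_zeta_ext]) (auto simp: zeta_eq_zeta_ext)

text \<open>Makes the moment integrand even in t, so that a hypothesis on \<open>{0..T}\<close> also
  controls negative t.\<close>

lemma zeta_cnj:
  assumes "Re s > 0" "s \<noteq> 1"
  shows "zeta (cnj s) = cnj (zeta s)"
proof -
  have cnj_term: "zeta_term n (cnj s) = cnj (zeta_term n s)" for n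
    by (simp add: zeta_term_def cnj_powr)
  have "(\<lambda>n. cnj (zeta_term n s)) sums cnj (\<Sum>n. zeta_term n s)"
    using summable_sums[OF summable_zeta_term[OF assms]] by (subst sums_cnj)
  hence "(\<Sum>n. zeta_term n (cnj s)) = cnj (\<Sum>n. zeta_term n s)"
    by (simp add: cnj_term sums_iff)
  moreover have "cnj s \<noteq> 1" using assms by (metis complex_cnj_cnj complex_cnj_one)
  ultimately show ?thesis using assms by (simp add: zeta_eq_zeta_ext zeta_ext_def)
qed

lemma norm_zeta_bound:
  assumes "r > 0"
  shows "\<exists>C\<ge>0. \<forall>s. 1/2 \<le> Re s \<longrightarrow> r \<le> norm (s - 1) \<longrightarrow> norm (zeta s) \<le> C * norm s"
proof (intro exI conjI allI impI)
  let ?A = "\<Sum>n. real (Suc n) powr (- (1/2) - 1)"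
  \<comment> \<open>The summand \<open>2 / r\<close> pays for the pole term:
    \<open>1 / norm (s - 1)\<close> is at most \<open>1 / r\<close>, and \<open>norm s\<close> is at
    least 1/2.\<close>
  show "2 / r + ?A \<ge> 0"
    using assms by (intro add_nonneg_nonneg suminf_nonneg summable_Suc_powr) auto
  fix s assume s: "1/2 \<le> Re s" "r \<le> norm (s - 1)"
  have n: "norm s \<ge> 1/2" using s complex_Re_le_cmod[of s] by linarith
  have ne: "s \<noteq> 1" using s assms by auto
  have "norm (zeta s) = norm (zeta_ext s)"
    using s ne by (subst zeta_eq_zeta_ext) auto
  also have "\<dots> \<le> 1 / norm (s - 1) + norm s * ?A"
    using s ne by (intro norm_zeta_ext_le) auto
  also have "1 / norm (s - 1) \<le> 1 / r" using s ne assms by (intro divide_left_mono) auto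
  also have "1 / r \<le> 2 / r * norm s" using n assms by (simp add: field_simps)
  also have "2 / r * norm s + norm s * ?A = (2 / r + ?A) * norm s" by (simp add: algebra_simps)
  finally show "norm (zeta s) \<le> (2 / r + ?A) * norm s" by simp
qed

section \<open>The Dirichlet series of the k-th power of zeta\<close>

definition positive_lists :: "nat \<Rightarrow> nat list set" where
  "positive_lists k = {xs. length xs = k \<and> (\<forall>m\<in>set xs. 0 < m)}"

lemma positive_lists_0: "positive_lists 0 = {[]}"
  by (auto simp: positive_lists_def)

lemma positive_lists_Suc:
  "positive_lists (Suc k) = (\<lambda>(m, xs). m # xs) ` ({0<..} \<times> positive_lists k)"
  by (auto simp: positive_lists_def length_Suc_conv image_def)

lemma prod_list_positive: "xs \<in> positive_lists k \<Longrightarrow> prod_list xs > 0"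
  by (induction xs arbitrary: k) (auto simp: positive_lists_def)

lemma finite_factorizations:
  assumes "n > 0" shows "finite {xs \<in> positive_lists k. prod_list xs = n}"
proof (rule finite_subset)
  show "{xs \<in> positive_lists k. prod_list xs = n} \<subseteq> {xs. set xs \<subseteq> {..n} \<and> length xs = k}"
  proof safe
    fix xs m assume "xs \<in> positive_lists k" "m \<in> set xs" "n = prod_list xs"
    thus "m \<le> prod_list xs"
      using dvd_imp_le[OF prod_list_dvd[of m xs]] prod_list_positive[of xs k] by auto
  qed (auto simp: positive_lists_def)
  show "finite {xs. set xs \<subseteq> {..n} \<and> length xs = k}" by (rule finite_lists_length_eq) simp
qed

lemma divisor_fun_eq: "divisor_fun k n = card {xs \<in> positive_lists k. prod_list xs = n}"
  by (simp add: divisor_fun_def positive_lists_def conj_assoc)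

context
  fixes c :: "nat \<Rightarrow> complex" and Z :: complex
  assumes c_mult: "\<And>m n. m > 0 \<Longrightarrow> n > 0 \<Longrightarrow> c (m * n) = c m * c n"
    and c_1: "c 1 = 1"
    and c_abs: "(\<lambda>n. norm (c n)) summable_on {0<..}"
    and c_sum: "(c has_sum Z) {0<..}"
begin

text \<open>Induction on k, splitting off the head of the list: \<open>Z ^ Suc k\<close> is a sum
  over pairs of a head and a tail. Absolute summability is carried along because it licenses the
  iterated summation over these pairs.\<close>

lemma has_sum_positive_lists:
  "(\<lambda>xs. norm (c (prod_list xs))) summable_on positive_lists k
    \<and> ((\<lambda>xs. c (prod_list xs)) has_sum Z ^ k) (positive_lists k)"
proof (induction k)
  case 0
  show ?case using has_sum_finite[of "{[]}" "\<lambda>xs. c (prod_list xs)"] c_1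
    by (simp add: positive_lists_0)
next
  case (Suc k)
  let ?g = "\<lambda>(m, xs). c m * c (prod_list xs)"
  have inj: "inj_on (\<lambda>(m, xs). m # xs) ({0<..} \<times> positive_lists k)" by (auto simp: inj_on_def)
  have eq: "c (prod_list ((\<lambda>(m, xs). m # xs) p)) = ?g p" if "p \<in> {0<..} \<times> positive_lists k" for p
    using that by (cases p) (auto intro!: c_mult prod_list_positive)
  have abs: "(\<lambda>p. norm (?g p)) summable_on ({0<..} \<times> positive_lists k)"
    unfolding Infinite_Sum.abs_summable_on_Sigma_iff
  proof (intro conjI ballI)
    show "(\<lambda>xs. norm (case (m, xs) of (m, xs) \<Rightarrow> c m * c (prod_list xs))) summable_on positive_lists k" for m
      using Suc.IH by (simp add: norm_mult summable_on_cmult_right)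
    have "(\<lambda>m. norm (c m) * (\<Sum>\<^sub>\<infinity>xs\<in>positive_lists k. norm (c (prod_list xs)))) summable_on {0<..}"
      using c_abs by (intro summable_on_cmult_left)
    thus "(\<lambda>m. norm (\<Sum>\<^sub>\<infinity>xs\<in>positive_lists k. norm (case (m, xs) of (m, xs) \<Rightarrow> c m * c (prod_list xs))))
        summable_on {0<..}"
      by (simp add: norm_mult infsum_cmult_right' abs_mult infsum_nonneg)
  qed
  have "(?g has_sum Z ^ Suc k) ({0<..} \<times> positive_lists k)"
  proof (rule has_sum_SigmaI)
    show "((\<lambda>xs. case (m, xs) of (m, xs) \<Rightarrow> c m * c (prod_list xs)) has_sum c m * Z ^ k) (positive_lists k)" for m
      using Suc.IH by (simp add: has_sum_cmult_right)
    show "((\<lambda>m. c m * Z ^ k) has_sum Z ^ Suc k) {0<..}"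
      using has_sum_cmult_left[OF c_sum, of "Z ^ k"] by simp
    show "?g summable_on ({0<..} \<times> positive_lists k)" by (rule abs_summable_summable[OF abs])
  qed
  moreover have "((\<lambda>xs. c (prod_list xs)) has_sum Z ^ Suc k) (positive_lists (Suc k))
      \<longleftrightarrow> (?g has_sum Z ^ Suc k) ({0<..} \<times> positive_lists k)"
    unfolding positive_lists_Suc has_sum_reindex[OF inj] o_def using eq by (intro has_sum_cong) auto
  moreover have "(\<lambda>xs. norm (c (prod_list xs))) summable_on positive_lists (Suc k)
      \<longleftrightarrow> (\<lambda>p. norm (?g p)) summable_on ({0<..} \<times> positive_lists k)"
    unfolding positive_lists_Suc summable_on_reindex[OF inj] o_def using eq by (intro summable_on_cong) auto
  ultimately show ?case using abs by simp
qed

text \<open>Groups the lists by their product. The fibre over n > 0 is finite with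
  \<open>divisor_fun k n\<close> elements, and c is constant on it.\<close>

lemma has_sum_divisor_fun:
  "(\<lambda>n. norm (of_nat (divisor_fun k n) * c n)) summable_on {0<..}
    \<and> ((\<lambda>n. of_nat (divisor_fun k n) * c n) has_sum Z ^ k) {0<..}"
proof -
  define B where "B n = {xs \<in> positive_lists k. prod_list xs = n}" for n
  let ?g = "\<lambda>(n::nat, xs). c (prod_list xs)"
  have inj: "inj_on snd (Sigma {0<..} B)" by (auto simp: inj_on_def B_def)
  have im: "snd ` Sigma {0<..} B = positive_lists k"
    by (force simp: B_def image_def dest: prod_list_positive)
  have eq: "(\<lambda>xs. c (prod_list xs)) \<circ> snd = ?g" "(\<lambda>xs. norm (c (prod_list xs))) \<circ> snd = (\<lambda>p. norm (?g p))"
    by auto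
  have sum: "(?g has_sum Z ^ k) (Sigma {0<..} B)"
    using has_sum_positive_lists[of k] has_sum_reindex[OF inj, of "\<lambda>xs. c (prod_list xs)"]
    by (simp only: im eq)
  have abs: "(\<lambda>p. norm (?g p)) summable_on (Sigma {0<..} B)"
    using has_sum_positive_lists[of k] summable_on_reindex[OF inj, of "\<lambda>xs. norm (c (prod_list xs))"]
    by (simp only: im eq)
  have fin: "finite (B n)" if "n \<in> {0<..}" for n
    using finite_factorizations[of n k] that by (simp add: B_def)
  have card: "(\<Sum>xs\<in>B n. f (c (prod_list xs))) = of_nat (divisor_fun k n) * f (c n)"
    for n and f :: "complex \<Rightarrow> 'b :: comm_semiring_1"
  proof -
    have "(\<Sum>xs\<in>B n. f (c (prod_list xs))) = (\<Sum>xs\<in>B n. f (c n))"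
      by (rule sum.cong) (auto simp: B_def)
    thus ?thesis by (simp add: divisor_fun_eq B_def)
  qed
  have "((\<lambda>n. of_nat (divisor_fun k n) * c n) has_sum Z ^ k) {0<..}"
  proof (rule has_sum_SigmaD[OF sum])
    fix n :: nat assume "n \<in> {0<..}"
    from has_sum_finite[OF fin[OF this], of "\<lambda>xs. c (prod_list xs)"]
    show "((\<lambda>xs. case (n, xs) of (n, xs) \<Rightarrow> c (prod_list xs)) has_sum of_nat (divisor_fun k n) * c n) (B n)"
      using card[of "\<lambda>x. x" n] by simp
  qed
  moreover have "(\<lambda>n. norm (of_nat (divisor_fun k n) * c n)) summable_on {0<..}"
  proof -
    have "(\<lambda>n. norm (\<Sum>\<^sub>\<infinity>xs\<in>B n. norm (?g (n, xs)))) summable_on {0<..}"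
      using abs unfolding Infinite_Sum.abs_summable_on_Sigma_iff by blast
    also have "?this \<longleftrightarrow> ?thesis"
      using fin card[of norm] by (intro summable_on_cong) (simp add: norm_mult)
    finally show ?thesis .
  qed
  ultimately show ?thesis by blast
qed

end

lemma bij_betw_Suc_greaterThan_0: "bij_betw Suc UNIV {0<..}"
  by (auto simp: bij_betw_def image_def gr0_conv_Suc)

lemma norm_zeta_coeff:
  "norm (1 / complex_of_nat (Suc n) powr s) = real (Suc n) powr (- Re s)"
  by (simp add: norm_divide norm_powr_real_powr powr_minus_divide)

text \<open>The first claim is the Dirichlet series of the k-th power. The second, at s = 2, is the
  summable majorant behind the later exchanges of the divisor series with an integral or a
  limit.\<close>

lemma zeta_power_sums:
  assumes "Re s > 1"
  shows "(\<lambda>n. of_nat (divisor_fun k (Suc n)) * (1 / of_nat (Suc n) powr s)) sums zeta s ^ k"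
    and "summable (\<lambda>n. real (divisor_fun k (Suc n)) * real (Suc n) powr (- Re s))"
proof -
  define c where "c n = 1 / complex_of_nat n powr s" for n
  have abs: "summable (\<lambda>n. norm (c (Suc n)))"
    using assms by (simp only: c_def norm_zeta_coeff summable_Suc_powr)
  have "(\<lambda>n. c (Suc n)) sums zeta s"
    using zeta_ext_sums[OF assms] zeta_eq_zeta_ext[of s] assms unfolding c_def by force
  hence sum: "((\<lambda>n. c (Suc n)) has_sum zeta s) UNIV"
    by (rule norm_summable_imp_has_sum[OF abs])
  have "(\<lambda>n. norm (c n)) summable_on {0<..}"
    using norm_summable_imp_summable_on[of "\<lambda>n. norm (c (Suc n))"] abs
      summable_on_reindex_bij_betw[OF bij_betw_Suc_greaterThan_0, of "\<lambda>n. norm (c n)"] by simp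
  moreover have "(c has_sum zeta s) {0<..}"
    using sum has_sum_reindex_bij_betw[OF bij_betw_Suc_greaterThan_0, of c] by simp
  moreover have "c (m * n) = c m * c n" if "m > 0" "n > 0" for m n
  proof -
    have "complex_of_nat (m * n) powr s = of_nat m powr s * of_nat n powr s"
      by (simp add: powr_times_real)
    thus ?thesis by (simp add: c_def)
  qed
  moreover have "c 1 = 1" by (simp add: c_def)
  ultimately have *: "(\<lambda>n. norm (of_nat (divisor_fun k n) * c n)) summable_on {0<..}"
    "((\<lambda>n. of_nat (divisor_fun k n) * c n) has_sum zeta s ^ k) {0<..}"
    using has_sum_divisor_fun[of c "zeta s" k] by blast+
  show "(\<lambda>n. of_nat (divisor_fun k (Suc n)) * (1 / of_nat (Suc n) powr s)) sums zeta s ^ k"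
    using has_sum_reindex_bij_betw[OF bij_betw_Suc_greaterThan_0, of "\<lambda>n. of_nat (divisor_fun k n) * c n"] *(2)
    by (auto intro: has_sum_imp_sums simp: c_def)
  have "(\<lambda>n. norm (of_nat (divisor_fun k (Suc n)) * c (Suc n))) summable_on UNIV"
    using summable_on_reindex_bij_betw[OF bij_betw_Suc_greaterThan_0,
        of "\<lambda>n. norm (of_nat (divisor_fun k n) * c n)"] *(1) by simp
  from summable_on_imp_summable[OF this]
  show "summable (\<lambda>n. real (divisor_fun k (Suc n)) * real (Suc n) powr (- Re s))"
    by (simp only: norm_mult c_def norm_zeta_coeff norm_of_nat)
qed

section \<open>The Gaussian-smoothed Perron kernel\<close>

lemma borel_measurable_Complex [measurable (raw)]:
  assumes "f \<in> borel_measurable M" "g \<in> borel_measurable M"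
  shows "(\<lambda>x. Complex (f x) (g x)) \<in> borel_measurable M"
  using assms by (simp add: borel_measurable_complex_iff)

text \<open>Supplies the hypothesis of Fubini's theorem below: the integrands involved are dominated
  by a product of one-variable functions, the remaining factors being unimodular or bounded.\<close>

lemma (in pair_sigma_finite) integrable_product_bound:
  fixes f :: "'a \<times> 'b \<Rightarrow> complex"
  assumes [measurable]: "f \<in> borel_measurable (M1 \<Otimes>\<^sub>M M2)"
    and u: "integrable M1 u" and v: "integrable M2 v"
    and bound: "\<And>x y. norm (f (x, y)) \<le> u x * (v y :: real)"
  shows "integrable (M1 \<Otimes>\<^sub>M M2) f"
proof (rule Bochner_Integration.integrable_bound)
  have [measurable]: "u \<in> borel_measurable M1" "v \<in> borel_measurable M2"
    using u v by auto
  show "integrable (M1 \<Otimes>\<^sub>M M2) (\<lambda>(x, y). u x * v y)"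
  proof (rule Fubini_integrable)
    show "integrable M1 (\<lambda>x. \<integral>y. norm (case (x, y) of (x, y) \<Rightarrow> u x * v y) \<partial>M2)"
      using u v by (simp add: abs_mult)
    show "AE x in M1. integrable M2 (\<lambda>y. case (x, y) of (x, y) \<Rightarrow> u x * v y)"
      using v by simp
  qed measurable
  show "AE p in M1 \<Otimes>\<^sub>M M2. norm (f p) \<le> norm (case p of (x, y) \<Rightarrow> u x * v y)"
    using bound by (auto intro!: AE_I2 order_trans[OF _ abs_ge_self])
qed fact

lemma gaussian_fourier:
  fixes y :: real
  shows "integrable lborel (\<lambda>t. of_real (std_normal_density t) * iexp (y * t))"
    and "(LINT t|lborel. of_real (std_normal_density t) * iexp (y * t)) = exp (- (y\<^sup>2) / 2)"
proof -
  show "integrable lborel (\<lambda>t. of_real (std_normal_density t) * iexp (y * t))"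
  proof (rule Bochner_Integration.integrable_bound)
    show "integrable lborel std_normal_density" by simp
  qed (auto simp: norm_mult)
  have "char std_normal_distribution y
      = (LINT t|lborel. std_normal_density t *\<^sub>R iexp (y * t))"
    unfolding char_def by (subst integral_density) auto
  thus "(LINT t|lborel. of_real (std_normal_density t) * iexp (y * t)) = exp (- (y\<^sup>2) / 2)"
    by (simp add: char_std_normal_distribution scaleR_conv_of_real exp_of_real)
qed

text \<open>Separates decay from oscillation on a vertical line: the real part carries the Gaussian
  in t, and the frequency w is shifted by \<open>\<tau>\<^sup>2 * c\<close>.\<close>

lemma vertical_exponent:
  fixes \<tau> :: real
  shows "of_real w * Complex c t + of_real (\<tau>\<^sup>2 / 2) * (Complex c t)\<^sup>2
     = of_real (w * c + \<tau>\<^sup>2 * c\<^sup>2 / 2 - \<tau>\<^sup>2 * t\<^sup>2 / 2) + \<i> * of_real ((w + \<tau>\<^sup>2 * c) * t)"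
  by (simp add: complex_eq_iff power2_eq_square field_simps)

text \<open>The scaling t = z / \<tau> turns this into the Fourier transform of the standard normal
  density at \<open>y = (w + \<tau>\<^sup>2 * c) / \<tau>\<close>. Completing the square then
  cancels c, as it should for the integral of an entire function over a vertical line.\<close>

lemma gaussian_vertical_integral:
  fixes \<tau> c w :: real
  assumes "\<tau> > 0"
  shows "(LINT t|lborel. exp (of_real w * Complex c t + of_real (\<tau>\<^sup>2 / 2) * (Complex c t)\<^sup>2))
     = of_real (2 * pi * normal_density w \<tau> 0)"
proof -
  define g where "g t = exp (of_real w * Complex c t + of_real (\<tau>\<^sup>2 / 2) * (Complex c t)\<^sup>2)" for t
  define K where "K = exp (w * c + \<tau>\<^sup>2 * c\<^sup>2 / 2) * sqrt (2 * pi)"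
  define y where "y = (w + \<tau>\<^sup>2 * c) / \<tau>"
  have "g (0 + (1/\<tau>) * z) = of_real K * (of_real (std_normal_density z) * iexp (y * z))" for z
  proof -
    have "g (0 + (1/\<tau>) * z)
        = of_real (exp (w * c + \<tau>\<^sup>2 * c\<^sup>2 / 2 - z\<^sup>2 / 2)) * iexp (y * z)"
      unfolding g_def vertical_exponent exp_add exp_of_real using assms by (simp add: y_def power_divide)
    also have "exp (w * c + \<tau>\<^sup>2 * c\<^sup>2 / 2 - z\<^sup>2 / 2) = K * std_normal_density z"
    proof -
      have "exp (w * c + \<tau>\<^sup>2 * c\<^sup>2 / 2 - z\<^sup>2 / 2) = exp (w * c + \<tau>\<^sup>2 * c\<^sup>2 / 2) * exp (- z\<^sup>2 / 2)"
        by (subst exp_add[symmetric], rule arg_cong[of _ _ exp]) simp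
      thus ?thesis by (simp add: K_def std_normal_density_def)
    qed
    finally show ?thesis by (simp only: of_real_mult mult.assoc)
  qed
  hence "(LINT t|lborel. g t)
      = (1/\<tau>) *\<^sub>R (LINT z|lborel. of_real K * (of_real (std_normal_density z) * iexp (y * z)))"
    using lborel_integral_real_affine[of "1/\<tau>" g 0] assms by simp
  also have "\<dots> = (1/\<tau>) *\<^sub>R (of_real K * of_real (exp (- (y\<^sup>2) / 2)))"
    by (subst integral_mult_right_zero) (simp only: gaussian_fourier(2))
  also have "\<dots> = of_real ((1/\<tau>) * (K * exp (- (y\<^sup>2) / 2)))"
    by (simp add: scaleR_conv_of_real)
  also have "(1/\<tau>) * (K * exp (- (y\<^sup>2) / 2)) = 2 * pi * normal_density w \<tau> 0"
  proof -
    have "w * c + \<tau>\<^sup>2 * c\<^sup>2 / 2 + - (y\<^sup>2) / 2 = - (w\<^sup>2) / (2 * \<tau>\<^sup>2)"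
      using assms by (simp add: y_def field_simps power2_eq_square)
    hence "K * exp (- (y\<^sup>2) / 2) = exp (- (w\<^sup>2) / (2 * \<tau>\<^sup>2)) * sqrt (2 * pi)"
      by (simp add: K_def mult.assoc mult.left_commute exp_add[symmetric])
    moreover have "sqrt (2 * pi * \<tau>\<^sup>2) = sqrt (2 * pi) * \<tau>" using assms by (simp add: real_sqrt_mult)
    moreover have "2 * pi = sqrt (2 * pi) * sqrt (2 * pi)" by simp
    ultimately show ?thesis unfolding normal_density_def using assms
      by (simp add: field_simps)
  qed
  finally show ?thesis by (simp only: g_def)
qed

text \<open>The factor \<open>1 / s\<close> of Perron's formula as a Laplace transform; it is traded
  for an integral over r of the purely Gaussian kernel.\<close>

lemma exp_halfline:
  fixes s :: complex
  assumes "Re s > 0"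
  shows "integrable lborel (\<lambda>r. indicator {0<..} r *\<^sub>R exp (- (of_real r * s)))"
    and "(LINT r|lborel. indicator {0<..} r *\<^sub>R exp (- (of_real r * s))) = 1 / s"
proof -
  have nz: "s \<noteq> 0" using assms by auto
  have ei: "einterval 0 \<infinity> = {0<..}"
    by (auto simp: einterval_def)
  have lim: "((\<lambda>r. exp (- (r * Re s)) :: real) \<longlongrightarrow> 0) at_top"
    using assms by real_asymp
  have "(\<integral>\<^sup>+r. ennreal (exp (- (r * Re s))) * indicator {0..} r \<partial>lborel) = 0 - (- (exp (- (0 * Re s)) / Re s))"
  proof (rule nn_integral_FTC_atLeast)
    show "((\<lambda>r. - (exp (- (r * Re s)) / Re s)) has_real_derivative exp (- (r * Re s))) (at r)" for r
      using assms by (auto intro!: derivative_eq_intros)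
    show "((\<lambda>r. - (exp (- (r * Re s)) / Re s)) \<longlongrightarrow> 0) at_top"
      using tendsto_minus[OF tendsto_divide[OF lim tendsto_const[of "Re s"]]] assms by simp
  qed auto
  moreover have "(\<integral>\<^sup>+r. norm (indicator {0<..} r *\<^sub>R exp (- (of_real r * s))) \<partial>lborel)
      \<le> (\<integral>\<^sup>+r. ennreal (exp (- (r * Re s))) * indicator {0..} r \<partial>lborel)"
    by (intro nn_integral_mono) (auto split: split_indicator)
  ultimately show int: "integrable lborel (\<lambda>r. indicator {0<..} r *\<^sub>R exp (- (of_real r * s)))"
    by (intro integrableI_bounded) (auto simp: le_less_trans)
  have "(LBINT r=0..\<infinity>. exp (- (of_real r * s))) = 0 - (- 1 / s)"
  proof (rule interval_integral_FTC_integrable)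
    show "((\<lambda>r. - exp (- (of_real r * s)) / s) has_vector_derivative exp (- (of_real r * s))) (at r)" for r
    proof -
      have "((\<lambda>z. - exp (- (z * s)) / s) has_field_derivative exp (- (of_real r * s))) (at (of_real r))"
        using nz by (auto intro!: derivative_eq_intros)
      from has_vector_derivative_real_field[OF this] show ?thesis .
    qed
    show "set_integrable lborel (einterval 0 \<infinity>) (\<lambda>r. exp (- (of_real r * s)))"
      using int unfolding set_integrable_def ei .
    have "((\<lambda>r. - exp (- (of_real r * s)) / s) \<longlongrightarrow> - 1 / s) (at_right (0::real))"
      using nz by (auto intro!: tendsto_eq_intros)
    thus "(((\<lambda>r. - exp (- (of_real r * s)) / s) \<circ> real_of_ereal) \<longlongrightarrow> - 1 / s) (at_right 0)"
      unfolding zero_ereal_def ereal_tendsto_simps .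
    have "((\<lambda>r. exp (- (of_real r * s))) \<longlongrightarrow> 0) (at_top :: real filter)"
      by (rule tendsto_norm_zero_cancel) (use lim in simp)
    from tendsto_minus[OF tendsto_divide[OF this tendsto_const[of s]]]
    have "((\<lambda>r. - exp (- (of_real r * s)) / s) \<longlongrightarrow> 0) (at_top :: real filter)"
      using nz by simp
    thus "(((\<lambda>r. - exp (- (of_real r * s)) / s) \<circ> real_of_ereal) \<longlongrightarrow> 0) (at_left \<infinity>)"
      unfolding ereal_tendsto_simps .
  qed auto
  thus "(LINT r|lborel. indicator {0<..} r *\<^sub>R exp (- (of_real r * s))) = 1 / s"
    unfolding interval_lebesgue_integral_def set_lebesgue_integral_def ei by simp
qed

text \<open>For \<tau> > 0, the probability that a normal variable with mean v and standard
  deviation \<tau> is positive: the unit step at v = 0, smoothed at scale \<tau>.\<close>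

definition smooth_step :: "real \<Rightarrow> real \<Rightarrow> real" where
  "smooth_step \<tau> v = (LINT r|lborel. indicator {0<..} r * normal_density v \<tau> r)"

lemma integrable_gaussian:
  assumes "\<tau> \<noteq> 0"
  shows "integrable lborel (\<lambda>t. exp (- (\<tau>\<^sup>2 * t\<^sup>2 / 2)) :: real)"
proof -
  have "integrable lborel (\<lambda>t. sqrt (2 * pi / \<tau>\<^sup>2) * normal_density 0 (1 / \<bar>\<tau>\<bar>) t)"
    by (intro integrable_mult_right integrable_normal_density) (use assms in auto)
  also have "(\<lambda>t. sqrt (2 * pi / \<tau>\<^sup>2) * normal_density 0 (1 / \<bar>\<tau>\<bar>) t) = (\<lambda>t. exp (- (\<tau>\<^sup>2 * t\<^sup>2 / 2)))"
    using assms by (auto simp: normal_density_def power_divide real_sqrt_divide)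
  finally show ?thesis .
qed

lemma norm_exp_vertical:
  "norm (exp (of_real w * Complex c t + of_real (\<tau>\<^sup>2 / 2) * (Complex c t)\<^sup>2))
     = exp (w * c + \<tau>\<^sup>2 * c\<^sup>2 / 2) * exp (- (\<tau>\<^sup>2 * t\<^sup>2 / 2))"
  unfolding vertical_exponent norm_exp_eq_Re
  by (subst exp_add[symmetric], rule arg_cong[of _ _ exp]) simp

text \<open>Writing \<open>1 / s\<close> as the integral of \<open>exp (- r * s)\<close> over r > 0
  replaces v by v - r in the exponent. For each r the integral over t is a normal density, and
  integrating this over r > 0 gives the smoothed step.\<close>

lemma perron_smooth_step:
  assumes "c > 0" "\<tau> > 0"
  shows "(LINT t|lborel. exp (of_real v * Complex c t + of_real (\<tau>\<^sup>2 / 2) * (Complex c t)\<^sup>2) / Complex c t)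
     = of_real (2 * pi * smooth_step \<tau> v)"
proof -
  define f where "f t r = indicator {0<..} r *\<^sub>R
      exp (of_real (v - r) * Complex c t + of_real (\<tau>\<^sup>2 / 2) * (Complex c t)\<^sup>2)" for t r :: real
  have int: "integrable (lborel \<Otimes>\<^sub>M lborel) (\<lambda>(t, r). f t r)"
  proof (rule lborel_pair.integrable_product_bound)
    show "(\<lambda>(t, r). f t r) \<in> borel_measurable (lborel \<Otimes>\<^sub>M lborel)"
      unfolding f_def by measurable
    show "integrable lborel (\<lambda>t. exp (v * c + \<tau>\<^sup>2 * c\<^sup>2 / 2) * exp (- (\<tau>\<^sup>2 * t\<^sup>2 / 2)))"
      using assms by (intro integrable_mult_right integrable_gaussian) auto
    show "integrable lborel (\<lambda>r. norm (indicator {0<..} r *\<^sub>R exp (- (of_real r * complex_of_real c))))"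
      using assms by (intro integrable_norm exp_halfline) auto
    show "norm (case (t, r) of (t, r) \<Rightarrow> f t r)
        \<le> exp (v * c + \<tau>\<^sup>2 * c\<^sup>2 / 2) * exp (- (\<tau>\<^sup>2 * t\<^sup>2 / 2))
          * norm (indicator {0<..} r *\<^sub>R exp (- (of_real r * complex_of_real c)))" for t r
    proof -
      have "exp ((v - r) * c + \<tau>\<^sup>2 * c\<^sup>2 / 2) = exp (v * c + \<tau>\<^sup>2 * c\<^sup>2 / 2) * exp (- (r * c))"
        by (subst exp_add[symmetric], rule arg_cong[of _ _ exp]) (simp add: algebra_simps)
      moreover have "norm (exp (- (of_real r * complex_of_real c))) = exp (- (r * c))" by simp
      ultimately show ?thesis
        unfolding f_def prod.case norm_scaleR norm_exp_vertical by simp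
    qed
  qed
  have 1: "(LINT r|lborel. f t r)
      = exp (of_real v * Complex c t + of_real (\<tau>\<^sup>2 / 2) * (Complex c t)\<^sup>2) / Complex c t" for t
  proof -
    have "f t r = exp (of_real v * Complex c t + of_real (\<tau>\<^sup>2 / 2) * (Complex c t)\<^sup>2)
        * (indicator {0<..} r *\<^sub>R exp (- (of_real r * Complex c t)))" for r
    proof -
      have "of_real (v - r) * Complex c t + of_real (\<tau>\<^sup>2 / 2) * (Complex c t)\<^sup>2
          = (of_real v * Complex c t + of_real (\<tau>\<^sup>2 / 2) * (Complex c t)\<^sup>2) + - (of_real r * Complex c t)"
        by (simp add: algebra_simps del: Complex_eq)
      thus ?thesis unfolding f_def by (simp only: exp_add) simp
    qed
    thus ?thesis using exp_halfline(2)[of "Complex c t"] assms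
      by (simp only: integral_mult_right_zero complex.sel) simp
  qed
  have 2: "(LINT t|lborel. f t r) = of_real (2 * pi * (indicator {0<..} r * normal_density v \<tau> r))" for r
  proof -
    have "normal_density (v - r) \<tau> 0 = normal_density v \<tau> r"
      by (simp add: normal_density_def power2_commute)
    thus ?thesis unfolding f_def integral_scaleR_right gaussian_vertical_integral[OF assms(2)]
      by (simp split: split_indicator)
  qed
  have "(LINT t|lborel. LINT r|lborel. f t r) = (LINT r|lborel. LINT t|lborel. f t r)"
    using lborel_pair.Fubini_integral[OF int] by simp
  thus ?thesis unfolding 1 2 smooth_step_def
    by (simp only: integral_complex_of_real integral_mult_right_zero)
qed

lemma smooth_step_nonneg: "smooth_step \<tau> v \<ge> 0"
  unfolding smooth_step_def by (intro Bochner_Integration.integral_nonneg) auto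

text \<open>The exponential Chebyshev inequality: the indicator of r > 0 is at most
  \<open>exp (2 * r)\<close>, and the normal expectation of the latter is computed by shifting the
  mean by \<open>2 * \<tau>\<^sup>2\<close>. With \<open>v = ln x - ln n\<close> the exponent 2
  produces the factor \<open>n powr (-2)\<close>, which makes the divisor series converge.\<close>

lemma smooth_step_le:
  assumes "\<tau> > 0"
  shows "smooth_step \<tau> v \<le> exp (2 * v + 2 * \<tau>\<^sup>2)"
proof -
  have "smooth_step \<tau> v \<le> (LINT r|lborel. exp (2 * v + 2 * \<tau>\<^sup>2) * normal_density (v + 2 * \<tau>\<^sup>2) \<tau> r)"
    unfolding smooth_step_def
  proof (rule integral_mono')
    show "integrable lborel (\<lambda>r. exp (2 * v + 2 * \<tau>\<^sup>2) * normal_density (v + 2 * \<tau>\<^sup>2) \<tau> r)"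
      using assms by (intro integrable_mult_right integrable_normal_density)
    fix r
    have "exp (2 * v + 2 * \<tau>\<^sup>2) * normal_density (v + 2 * \<tau>\<^sup>2) \<tau> r = exp (2 * r) * normal_density v \<tau> r"
    proof -
      have "2 * v + 2 * \<tau>\<^sup>2 + - (r - (v + 2 * \<tau>\<^sup>2))\<^sup>2 / (2 * \<tau>\<^sup>2) = 2 * r + - (r - v)\<^sup>2 / (2 * \<tau>\<^sup>2)"
        using assms by (simp add: field_simps power2_eq_square)
      thus ?thesis
        by (simp add: normal_density_def exp_add[symmetric])
    qed
    moreover have "indicator {0<..} r * normal_density v \<tau> r \<le> exp (2 * r) * normal_density v \<tau> r"
      by (intro mult_right_mono) (auto split: split_indicator)
    ultimately show "indicator {0<..} r * normal_density v \<tau> r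
        \<le> exp (2 * v + 2 * \<tau>\<^sup>2) * normal_density (v + 2 * \<tau>\<^sup>2) \<tau> r" by simp
  qed auto
  also have "\<dots> = exp (2 * v + 2 * \<tau>\<^sup>2)"
    using assms by simp
  finally show ?thesis .
qed

text \<open>The substitution r = v + \<tau> z moves \<tau> from the density into the indicator,
  where dominated convergence applies. The case v = 0 is excluded because the smoothed step stays at
  1/2 there.\<close>

lemma smooth_step_tendsto:
  assumes \<tau>: "\<And>j. \<tau> j > 0" "\<tau> \<longlonglongrightarrow> 0" and "v \<noteq> 0"
  shows "(\<lambda>j. smooth_step (\<tau> j) v) \<longlonglongrightarrow> (if v > 0 then 1 else 0)"
proof -
  have eq: "smooth_step (\<tau> j) v
      = (LINT z|lborel. indicator {0<..} (v + \<tau> j * z) * std_normal_density z)" for j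
  proof -
    have "\<tau> j * normal_density v (\<tau> j) (v + \<tau> j * z) = std_normal_density z" for z
      using \<tau>(1)[of j] by (simp add: normal_density_def power_mult_distrib real_sqrt_mult)
    hence "\<tau> j * (indicator {0<..} (v + \<tau> j * z) * normal_density v (\<tau> j) (v + \<tau> j * z))
        = indicator {0<..} (v + \<tau> j * z) * std_normal_density z" for z
      by (metis mult.left_commute)
    moreover have "smooth_step (\<tau> j) v
        = (LINT z|lborel. \<tau> j * (indicator {0<..} (v + \<tau> j * z) * normal_density v (\<tau> j) (v + \<tau> j * z)))"
    proof -
      have nz: "\<tau> j \<noteq> 0" and abs: "\<bar>\<tau> j\<bar> = \<tau> j" using \<tau>(1)[of j] by auto
      show ?thesis
        using lborel_integral_real_affine[OF nz, of "\<lambda>r. indicator {0<..} r * normal_density v (\<tau> j) r" v]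
        unfolding smooth_step_def abs by (simp only: integral_mult_right_zero real_scaleR_def)
    qed
    ultimately show ?thesis by (simp only:)
  qed
  have "(\<lambda>j. LINT z|lborel. indicator {0<..} (v + \<tau> j * z) * std_normal_density z)
      \<longlonglongrightarrow> (LINT z|lborel. (if v > 0 then 1 else 0) * std_normal_density z)"
  proof (rule integral_dominated_convergence[where w = std_normal_density])
    show "AE z in lborel. (\<lambda>j. indicator {0<..} (v + \<tau> j * z) * std_normal_density z)
        \<longlonglongrightarrow> (if v > 0 then 1 else 0) * std_normal_density z"
    proof (intro AE_I2 tendsto_mult tendsto_const)
      fix z
      have lim: "(\<lambda>j. v + \<tau> j * z) \<longlonglongrightarrow> v"
        using tendsto_add[OF tendsto_const tendsto_mult[OF \<tau>(2) tendsto_const], of v z] by simp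
      show "(\<lambda>j. indicator {0<..} (v + \<tau> j * z)) \<longlonglongrightarrow> (if v > 0 then 1 else 0 :: real)"
      proof (cases "v > 0")
        case True
        from order_tendstoD(1)[OF lim this] show ?thesis
          by (intro tendsto_eventually) (use True in \<open>auto elim: eventually_mono\<close>)
      next
        case False
        hence "v < 0" using assms by auto
        from order_tendstoD(2)[OF lim this] show ?thesis
          by (intro tendsto_eventually) (use False in \<open>auto elim: eventually_mono\<close>)
      qed
    qed
  qed (auto split: split_indicator)
  also have "(LINT z|lborel. (if v > 0 then 1 else 0) * std_normal_density z) = (if v > 0 then 1 else 0)"
    by auto
  finally show ?thesis by (simp only: eq)
qed

section \<open>Shifting the line of integration\<close>

definition smoothed_integrand :: "nat \<Rightarrow> real \<Rightarrow> real \<Rightarrow> complex \<Rightarrow> complex" where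
  "smoothed_integrand k \<tau> x s
     = of_real x powr s * zeta s ^ k / s * exp (of_real (\<tau>\<^sup>2 / 2) * s\<^sup>2)"

lemma holomorphic_smoothed_integrand:
  assumes "x > 0"
  shows "smoothed_integrand k \<tau> x holomorphic_on punctured_halfplane 0"
  unfolding smoothed_integrand_def
  by (intro holomorphic_intros holomorphic_zeta) (use assms in auto)

section \<open>Growth of the damped integrand in vertical strips\<close>

lemma power_le_fact_exp:
  fixes y :: real assumes "y \<ge> 0"
  shows "y ^ k \<le> fact k * exp y"
proof -
  have "(\<Sum>n\<in>{k}. y ^ n /\<^sub>R fact n) \<le> exp y"
    unfolding exp_def using assms by (intro sum_le_suminf summable_exp_generic) auto
  thus ?thesis by (simp add: field_simps)
qed

text \<open>The power of zeta grows at most polynomially, hence at most exponentially in t, and half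
  of the Gaussian exponent absorbs that; what remains is a Gaussian with \<tau> / sqrt 2 in place of
  \<tau>. The constant depends on \<tau> and x.\<close>

lemma norm_smoothed_integrand_le:
  assumes "x > 0" "\<tau> > 0" "r > 0"
  shows "\<exists>M\<ge>0. \<forall>s. 1/2 \<le> Re s \<longrightarrow> Re s \<le> 2 \<longrightarrow> r \<le> norm (s - 1) \<longrightarrow>
     norm (smoothed_integrand k \<tau> x s) \<le> M * exp (- ((\<tau> / sqrt 2)\<^sup>2 * (Im s)\<^sup>2 / 2))"
proof -
  obtain C where C: "C \<ge> 0"
    "\<And>s. 1/2 \<le> Re s \<Longrightarrow> r \<le> norm (s - 1) \<Longrightarrow> norm (zeta s) \<le> C * norm s"
    using norm_zeta_bound[OF assms(3)] by blast
  define M where "M = (1 + x)\<^sup>2 * C ^ k * (fact k * exp (2 + 1 / \<tau>\<^sup>2)) * 2 * exp (2 * \<tau>\<^sup>2)"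
  have "norm (smoothed_integrand k \<tau> x s) \<le> M * exp (- ((\<tau> / sqrt 2)\<^sup>2 * (Im s)\<^sup>2 / 2))"
    if s: "1/2 \<le> Re s" "Re s \<le> 2" "r \<le> norm (s - 1)" for s
  proof -
    define t where "t = \<bar>Im s\<bar>"
    have t: "t \<ge> 0" by (simp add: t_def)
    \<comment> \<open>The base is enlarged to exceed 1, so that the exponent can be raised to 2 also
      when x < 1.\<close>
    have "x powr Re s \<le> (1 + x) powr Re s" using assms s by (intro powr_mono2) auto
    also have "\<dots> \<le> (1 + x) powr 2" using assms s by (intro powr_mono) auto
    also have "\<dots> = (1 + x)\<^sup>2" using assms by (simp add: powr_numeral)
    finally have 1: "x powr Re s \<le> (1 + x)\<^sup>2" .
    have "norm s \<le> \<bar>Re s\<bar> + \<bar>Im s\<bar>" by (rule cmod_le)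
    hence ns: "norm s \<le> 2 + t" using s by (simp add: t_def)
    have "norm (zeta s) ^ k \<le> (C * norm s) ^ k"
      using s C by (intro power_mono) auto
    also have "\<dots> \<le> C ^ k * (2 + t) ^ k"
      unfolding power_mult_distrib using ns C(1) by (intro mult_left_mono power_mono) auto
    also have "(2 + t) ^ k \<le> fact k * exp (2 + t)"
      using t by (intro power_le_fact_exp) auto
    also have "exp (2 + t) \<le> exp (2 + 1 / \<tau>\<^sup>2) * exp (\<tau>\<^sup>2 * t\<^sup>2 / 4)"
    proof -
      \<comment> \<open>This square yields
        \<open>t \<le> \<tau>\<^sup>2 * t\<^sup>2 / 4 + 1 / \<tau>\<^sup>2\<close>, the source of
        \<open>1 / \<tau>\<^sup>2\<close> in M and of the lost half of the Gaussian
        exponent.\<close>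
      have "0 \<le> (\<tau> * t / 2 - 1 / \<tau>)\<^sup>2" by simp
      also have "(\<tau> * t / 2 - 1 / \<tau>)\<^sup>2 = \<tau>\<^sup>2 * t\<^sup>2 / 4 + 1 / \<tau>\<^sup>2 - t"
        using assms by (simp add: power2_eq_square field_simps)
      finally show ?thesis by (subst exp_add[symmetric]) simp
    qed
    finally have 2: "norm (zeta s) ^ k
        \<le> C ^ k * (fact k * (exp (2 + 1 / \<tau>\<^sup>2) * exp (\<tau>\<^sup>2 * t\<^sup>2 / 4)))"
      using C(1) by (simp add: mult_left_mono)
    have "norm s \<ge> 1/2" using s complex_Re_le_cmod[of s] by linarith
    hence 3: "1 / norm s \<le> 2" by (simp add: divide_simps)
    have "norm (exp (of_real (\<tau>\<^sup>2 / 2) * s\<^sup>2)) = exp (\<tau>\<^sup>2 * (Re s)\<^sup>2 / 2) * exp (- (\<tau>\<^sup>2 * t\<^sup>2 / 2))"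
      using norm_exp_vertical[of 0 "Re s" "Im s" \<tau>] by (simp add: t_def del: of_real_divide of_real_power)
    also have "\<dots> \<le> exp (2 * \<tau>\<^sup>2) * exp (- (\<tau>\<^sup>2 * t\<^sup>2 / 2))"
    proof -
      have "(Re s)\<^sup>2 \<le> 2\<^sup>2" using s by (intro power_mono) auto
      hence "\<tau>\<^sup>2 * (Re s)\<^sup>2 \<le> \<tau>\<^sup>2 * 4" by (intro mult_left_mono) auto
      thus ?thesis by simp
    qed
    finally have 4: "norm (exp (of_real (\<tau>\<^sup>2 / 2) * s\<^sup>2)) \<le> exp (2 * \<tau>\<^sup>2) * exp (- (\<tau>\<^sup>2 * t\<^sup>2 / 2))" .
    have "norm (smoothed_integrand k \<tau> x s)
        = x powr Re s * norm (zeta s) ^ k * (1 / norm s) * norm (exp (of_real (\<tau>\<^sup>2 / 2) * s\<^sup>2))"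
      using assms unfolding smoothed_integrand_def
      by (simp add: norm_mult norm_divide norm_power norm_powr_real_powr del: of_real_divide of_real_power)
    also have "\<dots> \<le> (1 + x)\<^sup>2 * (C ^ k * (fact k * (exp (2 + 1 / \<tau>\<^sup>2) * exp (\<tau>\<^sup>2 * t\<^sup>2 / 4)))) * 2
        * (exp (2 * \<tau>\<^sup>2) * exp (- (\<tau>\<^sup>2 * t\<^sup>2 / 2)))"
      using C(1) by (intro mult_mono 1 2 3 4) auto
    also have "\<dots> = M * (exp (\<tau>\<^sup>2 * t\<^sup>2 / 4) * exp (- (\<tau>\<^sup>2 * t\<^sup>2 / 2)))"
      by (simp only: M_def mult_ac)
    also have "exp (\<tau>\<^sup>2 * t\<^sup>2 / 4) * exp (- (\<tau>\<^sup>2 * t\<^sup>2 / 2)) = exp (- ((\<tau> / sqrt 2)\<^sup>2 * (Im s)\<^sup>2 / 2))"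
      by (subst exp_add[symmetric], rule arg_cong[of _ _ exp]) (simp add: t_def power_divide)
    finally show ?thesis .
  qed
  moreover have "M \<ge> 0" using C(1) by (simp add: M_def)
  ultimately show ?thesis by blast
qed

lemma continuous_on_Complex: "continuous_on A (Complex c)"
  unfolding Complex_eq by (intro continuous_intros)

lemma integrable_vertical_integrand:
  assumes "x > 0" "\<tau> > 0" "1/2 \<le> c" "c \<le> 2" "c \<noteq> 1"
  shows "integrable lborel (\<lambda>t. smoothed_integrand k \<tau> x (Complex c t))"
proof -
  have ne: "Complex c t \<in> punctured_halfplane 0" for t
    using assms by (auto simp: complex_eq_iff)
  have cont: "continuous_on UNIV (\<lambda>t. smoothed_integrand k \<tau> x (Complex c t))"
    by (rule continuous_on_compose2[OF holomorphic_on_imp_continuous_on[OF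
          holomorphic_smoothed_integrand[OF assms(1)]] continuous_on_Complex])
       (use ne in auto)
  obtain M where M: "\<And>s. 1/2 \<le> Re s \<Longrightarrow> Re s \<le> 2 \<Longrightarrow> \<bar>c - 1\<bar> \<le> norm (s - 1) \<Longrightarrow>
      norm (smoothed_integrand k \<tau> x s) \<le> M * exp (- ((\<tau> / sqrt 2)\<^sup>2 * (Im s)\<^sup>2 / 2))"
    using norm_smoothed_integrand_le[OF assms(1,2), of "\<bar>c - 1\<bar>" k] assms by auto
  show "integrable lborel (\<lambda>t. smoothed_integrand k \<tau> x (Complex c t))"
  proof (rule Bochner_Integration.integrable_bound)
    show "integrable lborel (\<lambda>t. M * exp (- ((\<tau> / sqrt 2)\<^sup>2 * t\<^sup>2 / 2)))"
      using assms by (intro integrable_mult_right integrable_gaussian) auto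
    show "(\<lambda>t. smoothed_integrand k \<tau> x (Complex c t)) \<in> borel_measurable lborel"
      using borel_measurable_continuous_onI[OF cont] by simp
    have "norm (smoothed_integrand k \<tau> x (Complex c t)) \<le> M * exp (- ((\<tau> / sqrt 2)\<^sup>2 * t\<^sup>2 / 2))" for t
      using M[of "Complex c t"] abs_Re_le_cmod[of "Complex c t - 1"] assms by simp
    thus "AE t in lborel. norm (smoothed_integrand k \<tau> x (Complex c t))
        \<le> norm (M * exp (- ((\<tau> / sqrt 2)\<^sup>2 * t\<^sup>2 / 2)))"
      by (auto intro!: AE_I2 order_trans[OF _ abs_ge_self])
  qed
qed

lemma integral_symmetric_tendsto:
  fixes f :: "real \<Rightarrow> complex"
  assumes "integrable lborel f"
  shows "(\<lambda>n. integral {- real n..real n} f) \<longlonglongrightarrow> (LINT t|lborel. f t)"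
proof -
  have [measurable]: "f \<in> borel_measurable lborel" using assms by simp
  have "integral {- real n..real n} f = (LINT t|lborel. indicator {- real n..real n} t *\<^sub>R f t)" for n
  proof -
    have "set_integrable lborel {- real n..real n} f"
      unfolding set_integrable_def using assms by (intro integrable_mult_indicator) auto
    from set_borel_integral_eq_integral(2)[OF this] show ?thesis
      by (simp add: set_lebesgue_integral_def)
  qed
  moreover have "(\<lambda>n. LINT t|lborel. indicator {- real n..real n} t *\<^sub>R f t) \<longlonglongrightarrow> (LINT t|lborel. f t)"
  proof (rule integral_dominated_convergence[where w = "\<lambda>t. norm (f t)"])
    show "AE t in lborel. (\<lambda>n. indicator {- real n..real n} t *\<^sub>R f t) \<longlonglongrightarrow> f t"
    proof (intro AE_I2 tendsto_eventually)
      fix t :: real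
      have "eventually (\<lambda>n. real n \<ge> \<bar>t\<bar>) sequentially"
        using filterlim_real_sequentially by (auto simp: filterlim_at_top)
      thus "eventually (\<lambda>n. indicator {- real n..real n} t *\<^sub>R f t = f t) sequentially"
        by eventually_elim (auto simp: indicator_def)
    qed
  qed (use assms in \<open>auto split: split_indicator\<close>)
  ultimately show ?thesis by simp
qed

text \<open>The residue theorem on the rectangle with corners at real parts c and 2 and imaginary
  parts -R and R. The horizontal sides vanish in the limit by the Gaussian decay, and the vertical
  sides tend to the two full integrals.\<close>

lemma vertical_integral_shift:
  assumes "x > 0" "\<tau> > 0" "1/2 \<le> c" "c < 1"
  shows "(LINT t|lborel. smoothed_integrand k \<tau> x (Complex 2 t))
      - (LINT t|lborel. smoothed_integrand k \<tau> x (Complex c t))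
     = 2 * pi * residue (smoothed_integrand k \<tau> x) 1"
proof -
  define f where "f = smoothed_integrand k \<tau> x"
  let ?H = "punctured_halfplane 0"
  have hol: "f holomorphic_on ?H" unfolding f_def by (rule holomorphic_smoothed_integrand[OF assms(1)])
  hence cont: "continuous_on ?H f" by (rule holomorphic_on_imp_continuous_on)
  obtain M where M: "M \<ge> 0" "\<And>s. 1/2 \<le> Re s \<Longrightarrow> Re s \<le> 2 \<Longrightarrow> 1 \<le> norm (s - 1) \<Longrightarrow>
      norm (f s) \<le> M * exp (- ((\<tau> / sqrt 2)\<^sup>2 * (Im s)\<^sup>2 / 2))"
    using norm_smoothed_integrand_le[OF assms(1,2), of 1 k] unfolding f_def by auto
  \<comment> \<open>The leading 2 is an upper bound for the length of a horizontal side, which lies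
    in \<open>1/2 \<le> Re s \<le> 2\<close>.\<close>
  define B where "B R = 2 * (M * exp (- ((\<tau> / sqrt 2)\<^sup>2 * R\<^sup>2 / 2)))" for R :: real
  define J where "J R = integral {-R..R} (\<lambda>t. f (Complex 2 t)) - integral {-R..R} (\<lambda>t. f (Complex c t))"
    for R :: real
  \<comment> \<open>The condition R \<ge> 1 keeps the horizontal sides at distance at least 1 from
    the pole, where the bound with M holds.\<close>
  have key: "norm (J R - 2 * pi * residue f 1) \<le> 2 * B R" if R: "R \<ge> 1" for R
  proof -
    define a1 a2 a3 a4 where "a1 = Complex c (-R)" "a2 = Complex 2 (-R)" "a3 = Complex 2 R" "a4 = Complex c R"
    note a_defs = this
    have seg: "closed_segment (Complex p u) (Complex q v) \<subseteq> cbox a1 a3"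
      if "Complex p u \<in> cbox a1 a3" "Complex q v \<in> cbox a1 a3" for p q u v
      using that by (intro closed_segment_subset convex_box)
    have img: "path_image (rectpath a1 a3) = cbox a1 a3 - box a1 a3"
      using assms R by (intro path_image_rectpath_cbox_minus_box) (auto simp: a_defs)
    have one: "1 \<in> box a1 a3" using assms R by (auto simp: a_defs in_box_complex_iff)
    have img_H: "path_image (rectpath a1 a3) \<subseteq> ?H"
      unfolding img using one assms by (auto simp: a_defs in_cbox_complex_iff)
    have paths: "path_image (rectpath a1 a3) = closed_segment a1 a2 \<union> closed_segment a2 a3
        \<union> closed_segment a3 a4 \<union> closed_segment a4 a1"
      unfolding rectpath_def Let_def by (simp add: path_image_join a_defs Un_assoc)
    have cnt: "continuous_on (closed_segment a1 a2) f" "continuous_on (closed_segment a2 a3) f"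
      "continuous_on (closed_segment a3 a4) f" "continuous_on (closed_segment a4 a1) f"
      using img_H unfolding paths by (auto intro!: continuous_on_subset[OF cont])
    note intg = cnt[THEN contour_integrable_continuous_linepath]
    have "contour_integral (rectpath a1 a3) f = 2 * pi * \<i> * (\<Sum>p\<in>{1}. winding_number (rectpath a1 a3) p * residue f p)"
    proof (rule Residue_theorem)
      show "open {s. Re s > 0}" by (rule open_halfspace_Re_gt)
      show "connected {s. Re s > 0}" by (intro convex_connected convex_halfspace_Re_gt)
      show "\<forall>z. z \<notin> {s. Re s > 0} \<longrightarrow> winding_number (rectpath a1 a3) z = 0"
        using assms R by (auto intro!: winding_number_rectpath_outside simp: a_defs in_cbox_complex_iff)
    qed (use hol img_H in auto)
    also have "\<dots> = 2 * pi * \<i> * residue f 1"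
      using winding_number_rectpath[OF one] by simp
    finally have "2 * pi * \<i> * residue f 1 = contour_integral (rectpath a1 a3) f" ..
    also have "rectpath a1 a3 = linepath a1 a2 +++ linepath a2 a3 +++ linepath a3 a4 +++ linepath a4 a1"
      by (simp add: rectpath_def Let_def a_defs)
    also have "contour_integral \<dots> f = contour_integral (linepath a1 a2) f + contour_integral (linepath a2 a3) f
        + contour_integral (linepath a3 a4) f + contour_integral (linepath a4 a1) f"
      using intg by (simp add: contour_integrable_joinI valid_path_join)
    also have "contour_integral (linepath a2 a3) f = \<i> * integral {-R..R} (\<lambda>t. f (Complex 2 t))"
      using R by (intro contour_integral_linepath_same_Re) (auto simp: a_defs)
    also have "contour_integral (linepath a4 a1) f = - contour_integral (linepath a1 a4) f"
      using cnt by (intro contour_integral_reverse_linepath) auto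
    also have "contour_integral (linepath a1 a4) f = \<i> * integral {-R..R} (\<lambda>t. f (Complex c t))"
      using R by (intro contour_integral_linepath_same_Re) (auto simp: a_defs)
    finally have eq: "\<i> * (J R - 2 * pi * residue f 1)
        = - (contour_integral (linepath a1 a2) f + contour_integral (linepath a3 a4) f)"
      by (simp add: J_def algebra_simps)
    have nf: "norm (f s) \<le> M * exp (- ((\<tau> / sqrt 2)\<^sup>2 * R\<^sup>2 / 2))"
      if "1/2 \<le> Re s" "Re s \<le> 2" "\<bar>Im s\<bar> = R" for s
    proof -
      have "1 \<le> norm (s - 1)" using abs_Im_le_cmod[of "s - 1"] R that by simp
      from M(2)[OF that(1,2) this] show ?thesis using that(3) by (metis power2_abs)
    qed
    have hor: "Im s = u \<and> 1/2 \<le> Re s \<and> Re s \<le> 2" if "s \<in> closed_segment (Complex p u) (Complex q u)"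
      "p \<in> {1/2..2}" "q \<in> {1/2..2}" for s p q u
    proof -
      have "closed_segment (Complex p u) (Complex q u) \<subseteq> cbox (Complex (1/2) u) (Complex 2 u)"
        using that by (intro closed_segment_subset convex_box) (auto simp: in_cbox_complex_iff)
      thus ?thesis using that(1) by (auto simp: in_cbox_complex_iff)
    qed
    have len: "norm (Complex p u - Complex q u) \<le> 2" if "p \<in> {1/2..2}" "q \<in> {1/2..2}" for p q u
    proof -
      have "Complex p u - Complex q u = of_real (p - q)" by (simp add: complex_eq_iff)
      thus ?thesis using that by (simp only: norm_of_real) auto
    qed
    have hb: "norm (contour_integral (linepath (Complex p u) (Complex q u)) f) \<le> B R"
      if "f contour_integrable_on linepath (Complex p u) (Complex q u)" "\<bar>u\<bar> = R"
        "p \<in> {1/2..2}" "q \<in> {1/2..2}" for p q u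
    proof -
      have "norm (contour_integral (linepath (Complex p u) (Complex q u)) f)
          \<le> M * exp (- ((\<tau> / sqrt 2)\<^sup>2 * R\<^sup>2 / 2)) * norm (Complex q u - Complex p u)"
      proof (rule contour_integral_bound_linepath[OF that(1)])
        fix s assume "s \<in> closed_segment (Complex p u) (Complex q u)"
        from hor[OF this that(3,4)] that(2) show "norm (f s) \<le> M * exp (- ((\<tau> / sqrt 2)\<^sup>2 * R\<^sup>2 / 2))"
          by (intro nf) auto
      qed (use M in simp)
      also have "\<dots> \<le> M * exp (- ((\<tau> / sqrt 2)\<^sup>2 * R\<^sup>2 / 2)) * 2"
        using M(1) that by (intro mult_left_mono len) auto
      finally show ?thesis by (simp add: B_def)
    qed
    have "norm (contour_integral (linepath a1 a2) f) \<le> B R" "norm (contour_integral (linepath a3 a4) f) \<le> B R"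
      using hb[of c "-R" 2] hb[of 2 R c] intg assms R unfolding a_defs by auto
    hence "norm (contour_integral (linepath a1 a2) f + contour_integral (linepath a3 a4) f) \<le> 2 * B R"
      by (intro norm_triangle_le) auto
    also have "norm (contour_integral (linepath a1 a2) f + contour_integral (linepath a3 a4) f)
        = norm (\<i> * (J R - 2 * pi * residue f 1))"
      unfolding eq norm_minus_cancel ..
    finally show ?thesis by (simp add: norm_mult)
  qed
  have "(\<lambda>n. 2 * B (real n)) \<longlonglongrightarrow> 0"
  proof -
    have "(\<lambda>n. 2 * B (real n)) \<longlonglongrightarrow> 2 * (2 * (M * 0))"
      unfolding B_def
    proof (intro tendsto_intros)
      have "(\<tau> / sqrt 2)\<^sup>2 / 2 > 0" using assms by simp
      hence "(\<lambda>n. exp (- ((\<tau> / sqrt 2)\<^sup>2 / 2 * (real n)\<^sup>2))) \<longlonglongrightarrow> 0"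
        by real_asymp
      thus "(\<lambda>n. exp (- ((\<tau> / sqrt 2)\<^sup>2 * (real n)\<^sup>2 / 2))) \<longlonglongrightarrow> 0" by simp
    qed
    thus ?thesis by simp
  qed
  moreover have "eventually (\<lambda>n. norm (J (real n) - 2 * pi * residue f 1) \<le> 2 * B (real n)) sequentially"
    using eventually_ge_at_top[of 1] by eventually_elim (rule key, simp)
  ultimately have "(\<lambda>n. J (real n) - 2 * pi * residue f 1) \<longlonglongrightarrow> 0"
    by (rule Lim_null_comparison[rotated])
  hence "(\<lambda>n. J (real n)) \<longlonglongrightarrow> 2 * pi * residue f 1" by (simp add: LIM_zero_iff)
  moreover have "(\<lambda>n. J (real n)) \<longlonglongrightarrow> (LINT t|lborel. f (Complex 2 t)) - (LINT t|lborel. f (Complex c t))"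
    unfolding J_def f_def
    by (intro tendsto_diff integral_symmetric_tendsto integrable_vertical_integrand) (use assms in auto)
  ultimately show ?thesis unfolding f_def by (metis LIMSEQ_unique)
qed

text \<open>The damping changes all coefficients of the expansion at the pole except those at the
  lowest orders, so the two residues are compared as integrals over a fixed circle, on which the
  damping factor tends to 1 uniformly.\<close>

lemma residue_smoothed_integrand_tendsto:
  assumes "x > 0" "\<And>j. \<tau> j > 0" "\<tau> \<longlonglongrightarrow> 0"
  shows "(\<lambda>j. residue (smoothed_integrand k (\<tau> j) x) 1)
     \<longlonglongrightarrow> residue (\<lambda>s. of_real x powr s * zeta s ^ k / s) 1"
proof -
  define g where "g s = of_real x powr s * zeta s ^ k / s" for s
  \<comment> \<open>Taking \<tau> = 0 gives the undamped integrand, so holomorphy and the residue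
    formula cover both functions at once.\<close>
  have g: "smoothed_integrand k 0 x = g" by (rule ext) (simp add: smoothed_integrand_def g_def)
  have sub: "cball 1 (1/2) \<subseteq> {s. Re s > 0}"
  proof
    fix s :: complex assume "s \<in> cball 1 (1/2)"
    hence "norm (1 - s) \<le> 1/2" by (simp add: dist_norm)
    thus "s \<in> {s. Re s > 0}" using complex_Re_le_cmod[of "1 - s"] by auto
  qed
  have int: "(smoothed_integrand k t x has_contour_integral 2 * pi * \<i> * residue (smoothed_integrand k t x) 1)
      (circlepath 1 (1/2))" for t
    using base_residue[OF open_halfspace_Re_gt _ _ holomorphic_smoothed_integrand[OF assms(1)] sub, where k1=k and \<tau>1=t] by simp
  have "sphere 1 (1/2) \<subseteq> punctured_halfplane 0" using sub by force
  hence "compact (g ` sphere 1 (1/2))"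
    using holomorphic_on_imp_continuous_on[OF holomorphic_smoothed_integrand[OF assms(1), of k 0]]
    unfolding g by (intro compact_continuous_image compact_sphere) (auto intro: continuous_on_subset)
  then obtain M where M: "M > 0" "\<And>s. s \<in> sphere 1 (1/2) \<Longrightarrow> norm (g s) \<le> M"
    using compact_imp_bounded[THEN bounded_pos[THEN iffD1]] by (metis image_eqI)
  \<comment> \<open>Here t is the damping parameter. On the circle \<open>norm s \<le> 3/2\<close>,
    so the exponent w has norm at most \<open>9/8 * t\<^sup>2\<close>, rounded up to
    \<open>3 * t\<^sup>2\<close>; then b bounds \<open>exp w - 1\<close> by Taylor's
    formula.\<close>
  define b where "b t = exp (3 * t\<^sup>2) * (3 * t\<^sup>2)" for t :: real
  have bound: "norm (residue (smoothed_integrand k t x) 1 - residue g 1) \<le> M * b t / 2" for t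
  proof -
    have "norm (2 * pi * \<i> * residue (smoothed_integrand k t x) 1 - 2 * pi * \<i> * residue g 1)
        \<le> M * b t * (2 * pi * (1/2))"
    proof (rule has_contour_integral_bound_circlepath)
      show "((\<lambda>s. smoothed_integrand k t x s - g s) has_contour_integral
          2 * pi * \<i> * residue (smoothed_integrand k t x) 1 - 2 * pi * \<i> * residue g 1) (circlepath 1 (1/2))"
        by (intro has_contour_integral_diff int) (use int[of 0] in \<open>simp only: g\<close>)
      show "0 \<le> M * b t" using M by (simp add: b_def)
      fix s :: complex assume s: "norm (s - 1) = 1/2"
      define w where "w = of_real (t\<^sup>2 / 2) * s\<^sup>2"
      have ns: "norm s \<le> 3/2" using norm_triangle_ineq[of "s - 1" 1] s by simp
      have nw: "norm w \<le> 3 * t\<^sup>2"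
      proof -
        have "norm w = t\<^sup>2 / 2 * (norm s)\<^sup>2" by (simp add: w_def norm_mult norm_power norm_divide)
        also have "\<dots> \<le> t\<^sup>2 / 2 * (3/2)\<^sup>2" using ns by (intro mult_left_mono power_mono) auto
        also have "\<dots> \<le> 3 * t\<^sup>2" by (simp add: power2_eq_square)
        finally show ?thesis .
      qed
      have "norm (exp w - (\<Sum>i\<le>0. w ^ i / fact i)) \<le> exp \<bar>Re w\<bar> * norm w ^ Suc 0 / fact 0"
        by (rule Taylor_exp)
      hence "norm (exp w - 1) \<le> exp \<bar>Re w\<bar> * norm w" by simp
      also have "\<dots> \<le> b t"
        unfolding b_def using nw abs_Re_le_cmod[of w] by (intro mult_mono) auto
      finally have "norm (g s) * norm (exp w - 1) \<le> M * b t"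
        using M(1) M(2)[of s] s by (intro mult_mono) (auto simp: dist_norm norm_minus_commute)
      also have "norm (g s) * norm (exp w - 1) = norm (smoothed_integrand k t x s - g s)"
        unfolding norm_mult[symmetric] smoothed_integrand_def g_def w_def by (simp add: algebra_simps)
      finally show "norm (smoothed_integrand k t x s - g s) \<le> M * b t" .
    qed simp
    also have "2 * pi * \<i> * residue (smoothed_integrand k t x) 1 - 2 * pi * \<i> * residue g 1
        = (2 * pi * \<i>) * (residue (smoothed_integrand k t x) 1 - residue g 1)"
      by (simp add: algebra_simps)
    finally have "2 * pi * norm (residue (smoothed_integrand k t x) 1 - residue g 1) \<le> 2 * pi * (M * b t / 2)"
      by (simp only: norm_mult) (simp add: algebra_simps)
    thus ?thesis by (rule mult_left_le_imp_le) simp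
  qed
  have "(\<lambda>j. M * b (\<tau> j) / 2) \<longlonglongrightarrow> M * (exp (3 * 0\<^sup>2) * (3 * 0\<^sup>2)) / 2"
    unfolding b_def by (intro tendsto_intros assms) simp
  hence "(\<lambda>j. M * b (\<tau> j) / 2) \<longlonglongrightarrow> 0" by simp
  hence "(\<lambda>j. residue (smoothed_integrand k (\<tau> j) x) 1 - residue g 1) \<longlonglongrightarrow> 0"
    by (rule Lim_null_comparison[rotated]) (intro always_eventually allI bound)
  thus ?thesis unfolding g_def by (simp add: LIM_zero_iff)
qed

section \<open>Recovering the error term\<close>

lemma exp_2_ln_diff:
  assumes "x > 0"
  shows "exp (2 * (ln x - ln (real (Suc n)))) = x\<^sup>2 * real (Suc n) powr (-2)"
proof -
  have "2 * (ln x - ln (real (Suc n))) = 2 * ln x + (-2) * ln (real (Suc n))" by simp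
  hence "exp (2 * (ln x - ln (real (Suc n)))) = exp (2 * ln x) * exp ((-2) * ln (real (Suc n)))"
    by (simp only: exp_add)
  moreover have "exp (2 * ln x) = x\<^sup>2" using assms by (simp add: exp_double)
  ultimately show ?thesis by (simp add: powr_def)
qed

text \<open>On \<open>Re s = 2\<close> the Dirichlet series converges absolutely and is integrated
  term by term. The n-th term contains \<open>(x / n) powr s\<close>, so it is the smoothed Perron
  integral at \<open>v = ln x - ln n\<close>.\<close>

lemma smoothed_dirichlet_sums:
  assumes "x > 0" "\<tau> > 0"
  shows "(\<lambda>n. complex_of_real (2 * pi * (real (divisor_fun k (Suc n)) * smooth_step \<tau> (ln x - ln (Suc n)))))
     sums (LINT t|lborel. smoothed_integrand k \<tau> x (Complex 2 t))"
proof -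
  define d where "d n = real (divisor_fun k (Suc n))" for n
  define v where "v n = ln x - ln (real (Suc n))" for n
  define f where "f n t = of_real (d n) *
      (exp (of_real (v n) * Complex 2 t + of_real (\<tau>\<^sup>2 / 2) * (Complex 2 t)\<^sup>2) / Complex 2 t)" for n t
  define A where "A = x\<^sup>2 * exp (2 * \<tau>\<^sup>2)"
  define e where "e t = exp (- (\<tau>\<^sup>2 * t\<^sup>2 / 2))" for t :: real
  define q where "q n = d n * real (Suc n) powr (-2)" for n
  have q: "summable q" using zeta_power_sums(2)[of 2 k] unfolding q_def d_def by simp
  have e: "integrable lborel e" unfolding e_def using assms by (intro integrable_gaussian) auto
  have bound: "norm (f n t) \<le> q n * (A * e t)" for n t
  proof -
    have ev: "exp (v n * 2) = x\<^sup>2 * real (Suc n) powr (-2)"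
      using exp_2_ln_diff[OF assms(1), of n] by (simp only: v_def mult.commute)
    have n1: "norm (Complex 2 t) \<ge> 1" using complex_Re_le_cmod[of "Complex 2 t"] by simp
    have "norm (f n t) = d n * (exp (v n * 2 + \<tau>\<^sup>2 * 2\<^sup>2 / 2) * e t) / norm (Complex 2 t)"
      unfolding f_def norm_mult norm_divide norm_exp_vertical e_def by (simp add: d_def)
    also have "\<dots> \<le> d n * (exp (v n * 2 + \<tau>\<^sup>2 * 2\<^sup>2 / 2) * e t) / 1"
      using n1 by (intro divide_left_mono mult_nonneg_nonneg) (auto simp: d_def e_def)
    also have "exp (v n * 2 + \<tau>\<^sup>2 * 2\<^sup>2 / 2) = x\<^sup>2 * real (Suc n) powr (-2) * exp (2 * \<tau>\<^sup>2)"
      unfolding exp_add ev by simp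
    finally show ?thesis by (simp add: A_def q_def mult_ac)
  qed
  have qe_sum: "summable (\<lambda>n. q n * (A * e t))" for t using q by (intro summable_mult2)
  have int: "integrable lborel (f n)" for n
  proof (rule Bochner_Integration.integrable_bound)
    show "integrable lborel (\<lambda>t. q n * (A * e t))" using e by (intro integrable_mult_right)
    show "f n \<in> borel_measurable lborel" unfolding f_def by measurable
    show "AE t in lborel. norm (f n t) \<le> norm (q n * (A * e t))"
      using bound by (auto intro!: AE_I2 order_trans[OF _ abs_ge_self])
  qed
  have "(\<lambda>n. integral\<^sup>L lborel (f n)) sums (LINT t|lborel. (\<Sum>n. f n t))"
  proof (rule sums_integral[OF int])
    show "AE t in lborel. summable (\<lambda>n. norm (f n t))"
      by (intro AE_I2 summable_comparison_test'[OF qe_sum]) (use bound in auto)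
    show "summable (\<lambda>n. LINT t|lborel. norm (f n t))"
    proof (rule summable_comparison_test')
      show "summable (\<lambda>n. q n * (A * integral\<^sup>L lborel e))" using q by (intro summable_mult2)
      show "norm (LINT t|lborel. norm (f n t)) \<le> q n * (A * integral\<^sup>L lborel e)" if "n \<ge> 0" for n
      proof -
        have "(LINT t|lborel. norm (f n t)) \<le> (LINT t|lborel. q n * (A * e t))"
          using e int bound by (intro integral_mono integrable_norm integrable_mult_right) auto
        thus ?thesis by simp
      qed
    qed
  qed
  moreover have "(\<Sum>n. f n t) = smoothed_integrand k \<tau> x (Complex 2 t)" for t
  proof -
    define s where "s = Complex 2 t"
    have "(\<lambda>n. of_nat (divisor_fun k (Suc n)) * (1 / of_nat (Suc n) powr s)
         * (of_real x powr s / s * exp (of_real (\<tau>\<^sup>2 / 2) * s\<^sup>2)))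
        sums (zeta s ^ k * (of_real x powr s / s * exp (of_real (\<tau>\<^sup>2 / 2) * s\<^sup>2)))"
      by (intro sums_mult2 zeta_power_sums) (simp add: s_def)
    moreover have "of_nat (divisor_fun k (Suc n)) * (1 / of_nat (Suc n) powr s)
         * (of_real x powr s / s * exp (of_real (\<tau>\<^sup>2 / 2) * s\<^sup>2)) = f n t" for n
    proof -
      have "exp (of_real (v n) * s) = of_real x powr s / of_nat (Suc n) powr s"
      proof -
        have "of_real (v n) * s = s * of_real (ln x) - s * of_real (ln (real (Suc n)))"
          by (simp add: v_def algebra_simps)
        moreover have "of_real x powr s = exp (s * of_real (ln x))"
          using assms by (simp add: powr_def Ln_of_real)
        moreover have "of_nat (Suc n) powr s = exp (s * of_real (ln (real (Suc n))))"
        proof -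
          have "complex_of_nat (Suc n) = of_real (real (Suc n))" by simp
          thus ?thesis by (simp only: powr_def) (simp add: Ln_of_real del: of_nat_Suc)
        qed
        ultimately show ?thesis by (simp only: exp_diff)
      qed
      thus ?thesis unfolding f_def s_def[symmetric] exp_add d_def by simp
    qed
    ultimately have "(\<lambda>n. f n t) sums (zeta s ^ k * (of_real x powr s / s * exp (of_real (\<tau>\<^sup>2 / 2) * s\<^sup>2)))"
      by simp
    thus ?thesis by (simp add: sums_iff smoothed_integrand_def s_def mult_ac)
  qed
  moreover have "integral\<^sup>L lborel (f n) = of_real (2 * pi * (d n * smooth_step \<tau> (v n)))" for n
  proof -
    have "integral\<^sup>L lborel (f n) = of_real (d n) * of_real (2 * pi * smooth_step \<tau> (v n))"
      unfolding f_def integral_mult_right_zero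
      by (subst perron_smooth_step) (use assms in auto)
    thus ?thesis by simp
  qed
  ultimately show ?thesis by (simp add: d_def v_def)
qed

text \<open>Tannery's theorem, with the majorant from \<open>smooth_step_le\<close>. Since x is not
  an integer, no \<open>ln x - ln n\<close> vanishes, so every smoothed step tends to 0 or 1 and the
  limit is the sharp cutoff at x.\<close>

lemma divisor_sum_smoothed_tendsto:
  assumes x: "x > 0" "\<And>n. x \<noteq> real n" and \<tau>: "\<And>j. \<tau> j > 0" "\<tau> \<longlonglongrightarrow> 0"
  shows "(\<lambda>j. \<Sum>n. real (divisor_fun k (Suc n)) * smooth_step (\<tau> j) (ln x - ln (Suc n)))
     \<longlonglongrightarrow> (\<Sum>n | 1 \<le> n \<and> real n \<le> x. real (divisor_fun k n))"
proof -
  define d where "d n = real (divisor_fun k (Suc n))" for n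
  define v where "v n = ln x - ln (real (Suc n))" for n
  define b where "b n = d n * (if v n > 0 then 1 else 0)" for n
  define q where "q n = d n * real (Suc n) powr (-2)" for n
  have q: "summable q" using zeta_power_sums(2)[of 2 k] unfolding q_def d_def by simp
  have v: "v n \<noteq> 0" "v n > 0 \<longleftrightarrow> real (Suc n) \<le> x" for n
    using x(1) x(2)[of "Suc n"] by (auto simp: v_def le_less simp del: of_nat_Suc)
  \<comment> \<open>For \<open>\<tau> j \<le> 1\<close> the factor
    \<open>exp (2 * (\<tau> j)\<^sup>2)\<close> in the bound of the smoothed step is at most
    \<open>exp 2\<close>, so the majorant is independent of j.\<close>
  have ev: "eventually (\<lambda>j. \<tau> j \<le> 1) sequentially"
    using order_tendstoD(2)[OF \<tau>(2), of 1] by (auto elim: eventually_mono)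
  have "(\<lambda>j. \<Sum>n. d n * smooth_step (\<tau> j) (v n)) \<longlonglongrightarrow> suminf b"
  proof (rule tannerys_theorem[THEN conjunct2, THEN conjunct2])
    show "(\<lambda>j. d n * smooth_step (\<tau> j) (v n)) \<longlonglongrightarrow> b n" for n
      unfolding b_def by (intro tendsto_mult tendsto_const smooth_step_tendsto \<tau> v)
    show "summable (\<lambda>n. q n * (x\<^sup>2 * exp 2))" using q by (intro summable_mult2)
    have "norm (d n * smooth_step (\<tau> j) (v n)) \<le> q n * (x\<^sup>2 * exp 2)" if "\<tau> j \<le> 1" for n j
    proof -
      have ev: "exp (2 * v n) = x\<^sup>2 * real (Suc n) powr (-2)"
        using exp_2_ln_diff[OF x(1), of n] by (simp only: v_def)
      have "smooth_step (\<tau> j) (v n) \<le> exp (2 * v n + 2 * (\<tau> j)\<^sup>2)"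
        using \<tau>(1) by (rule smooth_step_le)
      also have "\<dots> \<le> exp (2 * v n + 2)"
        using that \<tau>(1)[of j] by (simp add: power_le_one)
      also have "\<dots> = x\<^sup>2 * real (Suc n) powr (-2) * exp 2"
        unfolding exp_add ev ..
      finally have "d n * smooth_step (\<tau> j) (v n) \<le> d n * (x\<^sup>2 * real (Suc n) powr (-2) * exp 2)"
        by (intro mult_left_mono) (auto simp: d_def)
      moreover have "d n * smooth_step (\<tau> j) (v n) \<ge> 0"
        by (intro mult_nonneg_nonneg smooth_step_nonneg) (simp add: d_def)
      ultimately show ?thesis by (simp add: q_def mult_ac)
    qed
    thus "eventually (\<lambda>(n, j). norm (d n * smooth_step (\<tau> j) (v n)) \<le> q n * (x\<^sup>2 * exp 2))
        (at_top \<times>\<^sub>F sequentially)"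
      using eventually_prod2[of sequentially "\<lambda>j. \<tau> j \<le> 1" "at_top :: nat filter"] ev
      by (auto elim: eventually_mono)
  qed auto
  moreover have "suminf b = (\<Sum>n | 1 \<le> n \<and> real n \<le> x. real (divisor_fun k n))"
  proof -
    have fin: "finite {n. real (Suc n) \<le> x}"
    proof (rule finite_subset)
      show "{n. real (Suc n) \<le> x} \<subseteq> {..nat \<lfloor>x\<rfloor>}" by (auto simp: le_nat_floor)
    qed simp
    have "suminf b = (\<Sum>n | real (Suc n) \<le> x. b n)"
      by (rule suminf_finite[OF fin]) (auto simp: b_def v simp del: of_nat_Suc)
    also have "\<dots> = (\<Sum>n | real (Suc n) \<le> x. real (divisor_fun k (Suc n)))"
      by (intro sum.cong) (auto simp: b_def v d_def simp del: of_nat_Suc)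
    also have "\<dots> = (\<Sum>n | 1 \<le> n \<and> real n \<le> x. real (divisor_fun k n))"
      by (rule sum.reindex_bij_witness[of _ "\<lambda>n. n - 1" Suc]) (auto simp del: of_nat_Suc)
    finally show ?thesis .
  qed
  ultimately show ?thesis by (simp add: d_def v_def)
qed

text \<open>By the contour shift, the integral over \<open>Re s = c\<close> is the smoothed divisor
  sum minus the damped residue, up to the factor \<open>2 * pi\<close> and real parts; the two
  pieces converge to the two pieces of \<open>Delta\<close>.\<close>

lemma smoothed_Delta_tendsto:
  assumes x: "x > 0" "\<And>n. x \<noteq> real n" and \<tau>: "\<And>j. \<tau> j > 0" "\<tau> \<longlonglongrightarrow> 0"
    and c: "1/2 \<le> c" "c < 1"
  shows "(\<lambda>j. Re (LINT t|lborel. smoothed_integrand k (\<tau> j) x (Complex c t)) / (2 * pi)) \<longlonglongrightarrow> Delta k x"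
proof -
  have eq: "Re (LINT t|lborel. smoothed_integrand k (\<tau> j) x (Complex c t)) / (2 * pi)
      = (\<Sum>n. real (divisor_fun k (Suc n)) * smooth_step (\<tau> j) (ln x - ln (Suc n)))
        - Re (residue (smoothed_integrand k (\<tau> j) x) 1)" for j
  proof -
    define a where "a n = real (divisor_fun k (Suc n)) * smooth_step (\<tau> j) (ln x - ln (Suc n))" for n
    define I where "I b = (LINT t|lborel. smoothed_integrand k (\<tau> j) x (Complex b t))" for b
    have "(\<lambda>n. complex_of_real (2 * pi * a n)) sums I 2"
      unfolding a_def I_def by (rule smoothed_dirichlet_sums[OF x(1) \<tau>(1)])
    hence "(\<lambda>n. 2 * pi * a n) sums Re (I 2)" by (auto dest: sums_Re)
    hence "(\<lambda>n. 2 * pi * a n / (2 * pi)) sums (Re (I 2) / (2 * pi))" by (rule sums_divide)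
    hence "suminf a = Re (I 2) / (2 * pi)" by (simp add: sums_iff)
    moreover have "I 2 - I c = of_real (2 * pi) * residue (smoothed_integrand k (\<tau> j) x) 1"
      unfolding I_def using vertical_integral_shift[OF x(1) \<tau>(1) c] by simp
    hence "Re (I 2) - Re (I c) = 2 * pi * Re (residue (smoothed_integrand k (\<tau> j) x) 1)"
      by (metis Re_complex_of_real minus_complex.sel(1) scaleR_complex.sel(1) scaleR_conv_of_real)
    ultimately show ?thesis unfolding a_def[symmetric] I_def[symmetric] by (simp add: field_simps)
  qed
  show ?thesis unfolding eq Delta_def
    by (intro tendsto_diff divisor_sum_smoothed_tendsto tendsto_Re residue_smoothed_integrand_tendsto x \<tau>)
qed

section \<open>A mean value theorem for Mellin integrals\<close>

lemma norm_iexp [simp]: "norm (iexp x) = 1" for x :: real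
  by (simp add: norm_exp_i_times)

text \<open>
  Expanding the square, the integral over \<open>u\<close> produces the positive kernel \<open>exp (- (t - s)\<^sup>2 / 2)\<close>, so
  \<open>f t * cnj (f s)\<close> may be replaced by half the sum of the squared norms.
\<close>
lemma gaussian_mean_value:
  fixes f :: "real \<Rightarrow> complex"
  assumes f: "integrable lborel f" and f2: "integrable lborel (\<lambda>t. (norm (f t))\<^sup>2)"
  shows "(\<integral>\<^sup>+u. ennreal (std_normal_density u * (norm (LINT t|lborel. f t * iexp (u * t)))\<^sup>2) \<partial>lborel)
     \<le> ennreal (sqrt (2 * pi) * (LINT t|lborel. (norm (f t))\<^sup>2))"
proof -
  have [measurable]: "f \<in> borel_measurable lborel" using f by simp
  define F where "F u = (LINT t|lborel. f t * iexp (u * t))" for u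
  define E where "E t = exp (- (t\<^sup>2) / 2)" for t :: real
  define N where "N = (LINT t|lborel. (norm (f t))\<^sup>2)"
  have ft: "integrable lborel (\<lambda>t. f t * iexp (u * t))" for u
    by (rule Bochner_Integration.integrable_bound[OF f]) (auto simp: norm_mult)
  define g where "g p = f (fst p) * cnj (f (snd p))" for p :: "real \<times> real"
  have [measurable]: "cnj \<in> borel_measurable borel"
    by (intro borel_measurable_continuous_onI continuous_intros)
  have g_meas [measurable]: "g \<in> borel_measurable (lborel \<Otimes>\<^sub>M lborel)"
    unfolding g_def by measurable
  have nf: "integrable lborel (\<lambda>t. norm (f t))" using f by simp
  have gi: "integrable (lborel \<Otimes>\<^sub>M lborel) g"
    by (rule lborel_pair.integrable_product_bound[OF _ nf nf]) (auto simp: g_def norm_mult)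
  have FF: "(LINT p|(lborel \<Otimes>\<^sub>M lborel). g p * iexp (u * (fst p - snd p))) = of_real ((norm (F u))\<^sup>2)" for u
  proof -
    have int: "integrable (lborel \<Otimes>\<^sub>M lborel) (\<lambda>p. g p * iexp (u * (fst p - snd p)))"
      by (rule Bochner_Integration.integrable_bound[OF gi]) (auto simp: norm_mult)
    have "(LINT p|(lborel \<Otimes>\<^sub>M lborel). g p * iexp (u * (fst p - snd p)))
        = (LINT t|lborel. LINT s|lborel. g (t, s) * iexp (u * (t - s)))"
      using lborel_pair.integral_fst'[OF int] by simp
    also have "\<dots> = (LINT t|lborel. LINT s|lborel. (f t * iexp (u * t)) * cnj (f s * iexp (u * s)))"
      by (intro Bochner_Integration.integral_cong refl)
         (simp add: g_def exp_cnj algebra_simps exp_diff exp_minus divide_inverse)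
    also have "\<dots> = F u * cnj (F u)"
    proof -
      have "(LINT s|lborel. cnj (f s * iexp (u * s))) = cnj (F u)"
        unfolding F_def by (rule integral_bounded_linear[OF bounded_linear_cnj ft])
      thus ?thesis by (simp only: F_def integral_mult_right_zero integral_mult_left_zero)
    qed
    also have "\<dots> = of_real ((norm (F u))\<^sup>2)" by (rule complex_norm_square[symmetric])
    finally show ?thesis .
  qed
  \<comment> \<open>A triple integral is exchanged here, with the pair p = (t, s) treated as one
    variable against u.\<close>
  interpret P: pair_sigma_finite lborel "lborel \<Otimes>\<^sub>M lborel :: (real \<times> real) measure"
    by (intro pair_sigma_finite.intro) (auto intro: lborel.sigma_finite_measure_axioms lborel_pair.sigma_finite_measure_axioms sigma_finite_pair_measure)
  \<comment> \<open>The weighted square, expanded. Integrating over p first gives back the weighted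
    squared norm of \<open>F u\<close>; integrating over u first gives the Gaussian kernel in t -
    s.\<close>
  define H where "H u p = of_real (std_normal_density u) * (g p * iexp (u * (fst p - snd p)))"
    for u and p :: "real \<times> real"
  have snd_int: "integrable lborel std_normal_density" by simp
  have Hi: "integrable (lborel \<Otimes>\<^sub>M (lborel \<Otimes>\<^sub>M lborel)) (\<lambda>(u, p). H u p)"
  proof (rule P.integrable_product_bound[OF _ snd_int integrable_norm[OF gi]])
    show "(\<lambda>(u, p). H u p) \<in> borel_measurable (lborel \<Otimes>\<^sub>M (lborel \<Otimes>\<^sub>M lborel))"
      unfolding H_def by measurable
  qed (auto simp: H_def norm_mult)
  have H1: "(LINT p|(lborel \<Otimes>\<^sub>M lborel). H u p) = of_real (std_normal_density u * (norm (F u))\<^sup>2)" for u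
    unfolding H_def integral_mult_right_zero FF by simp
  have H2: "(LINT u|lborel. H u p) = g p * of_real (E (fst p - snd p))" for p
  proof -
    have "H u p = g p * (of_real (std_normal_density u) * iexp ((fst p - snd p) * u))" for u
      by (simp add: H_def mult_ac)
    thus ?thesis by (simp only: integral_mult_right_zero gaussian_fourier(2) E_def)
  qed
  have int1: "integrable lborel (\<lambda>u. std_normal_density u * (norm (F u))\<^sup>2)"
  proof -
    have "integrable lborel (\<lambda>u. LINT p|(lborel \<Otimes>\<^sub>M lborel). H u p)"
      using P.integrable_fst'[OF Hi] by simp
    thus ?thesis unfolding H1 complex_of_real_integrable_eq .
  qed
  have "complex_of_real (LINT u|lborel. std_normal_density u * (norm (F u))\<^sup>2)
      = (LINT u|lborel. LINT p|(lborel \<Otimes>\<^sub>M lborel). H u p)"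
    unfolding H1 by (simp only: integral_complex_of_real)
  also have "\<dots> = (LINT p|(lborel \<Otimes>\<^sub>M lborel). LINT u|lborel. H u p)"
    using P.Fubini_integral[OF Hi] by simp
  finally have eq: "complex_of_real (LINT u|lborel. std_normal_density u * (norm (F u))\<^sup>2)
      = (LINT p|(lborel \<Otimes>\<^sub>M lborel). g p * of_real (E (fst p - snd p)))" unfolding H2 .
  have E_int: "integrable lborel E"
    using integrable_gaussian[of 1] by (simp add: E_def[abs_def])
  have E_val: "(LINT s|lborel. E s) = sqrt (2 * pi)"
  proof -
    have "E = (\<lambda>s. sqrt (2 * pi) * std_normal_density s)"
      by (auto simp: E_def std_normal_density_def)
    thus ?thesis by simp
  qed
  have E_nn: "(\<integral>\<^sup>+s. E (t - s) \<partial>lborel) = ennreal (sqrt (2 * pi))" "(\<integral>\<^sup>+s. E (s - t) \<partial>lborel) = ennreal (sqrt (2 * pi))" for t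
  proof -
    have sym: "E (s - t) = E (t - s)" for s by (simp add: E_def power2_commute)
    have "(\<integral>\<^sup>+s. E (t - s) \<partial>lborel) = (\<integral>\<^sup>+s. E s \<partial>lborel)"
      using nn_integral_real_affine[of "\<lambda>s. ennreal (E s)" "-1" t] by (simp add: E_def)
    also have "\<dots> = ennreal (sqrt (2 * pi))"
      by (subst nn_integral_eq_integral[OF E_int]) (auto simp: E_val, auto simp: E_def)
    finally show "(\<integral>\<^sup>+s. E (t - s) \<partial>lborel) = ennreal (sqrt (2 * pi))" .
    thus "(\<integral>\<^sup>+s. E (s - t) \<partial>lborel) = ennreal (sqrt (2 * pi))" unfolding sym .
  qed
  have N_nn: "(\<integral>\<^sup>+t. ennreal ((norm (f t))\<^sup>2) \<partial>lborel) = ennreal N"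
    unfolding N_def by (rule nn_integral_eq_integral[OF f2]) auto
  have "(\<integral>\<^sup>+u. ennreal (std_normal_density u * (norm (F u))\<^sup>2) \<partial>lborel)
      = ennreal (LINT u|lborel. std_normal_density u * (norm (F u))\<^sup>2)"
    by (rule nn_integral_eq_integral[OF int1]) auto
  also have "\<dots> \<le> ennreal (norm (LINT p|(lborel \<Otimes>\<^sub>M lborel). g p * of_real (E (fst p - snd p))))"
    unfolding eq[symmetric] norm_of_real by (intro ennreal_leI) simp
  also have "\<dots> \<le> (\<integral>\<^sup>+p. ennreal (norm (g p * of_real (E (fst p - snd p)))) \<partial>(lborel \<Otimes>\<^sub>M lborel))"
    by (rule integral_norm_bound_ennreal)
       (rule Bochner_Integration.integrable_bound[OF gi], auto simp: E_def norm_mult intro!: mult_right_le_one_le)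
  also have "\<dots> \<le> (\<integral>\<^sup>+p. ennreal ((norm (f (fst p)))\<^sup>2 / 2 * E (fst p - snd p))
        + ennreal ((norm (f (snd p)))\<^sup>2 / 2 * E (fst p - snd p)) \<partial>(lborel \<Otimes>\<^sub>M lborel))"
  proof (intro nn_integral_mono)
    fix p :: "real \<times> real"
    have "0 \<le> (norm (f (fst p)) - norm (f (snd p)))\<^sup>2" by simp
    hence "norm (f (fst p)) * norm (f (snd p)) \<le> (norm (f (fst p)))\<^sup>2 / 2 + (norm (f (snd p)))\<^sup>2 / 2"
      unfolding power2_diff by (simp add: field_simps)
    hence "norm (g p * of_real (E (fst p - snd p)))
        \<le> ((norm (f (fst p)))\<^sup>2 / 2 + (norm (f (snd p)))\<^sup>2 / 2) * E (fst p - snd p)"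
      unfolding g_def norm_mult norm_of_real by (intro mult_mono) (auto simp: E_def)
    hence "ennreal (norm (g p * of_real (E (fst p - snd p))))
        \<le> ennreal ((norm (f (fst p)))\<^sup>2 / 2 * E (fst p - snd p) + (norm (f (snd p)))\<^sup>2 / 2 * E (fst p - snd p))"
      by (intro ennreal_leI) (simp only: distrib_right)
    also have "\<dots> = ennreal ((norm (f (fst p)))\<^sup>2 / 2 * E (fst p - snd p))
          + ennreal ((norm (f (snd p)))\<^sup>2 / 2 * E (fst p - snd p))"
      by (rule ennreal_plus) (auto simp: E_def)
    finally show "ennreal (norm (g p * of_real (E (fst p - snd p))))
        \<le> ennreal ((norm (f (fst p)))\<^sup>2 / 2 * E (fst p - snd p))
          + ennreal ((norm (f (snd p)))\<^sup>2 / 2 * E (fst p - snd p))" .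
  qed
  also have "\<dots> = (\<integral>\<^sup>+p. ennreal ((norm (f (fst p)))\<^sup>2 / 2 * E (fst p - snd p)) \<partial>(lborel \<Otimes>\<^sub>M lborel))
        + (\<integral>\<^sup>+p. ennreal ((norm (f (snd p)))\<^sup>2 / 2 * E (fst p - snd p)) \<partial>(lborel \<Otimes>\<^sub>M lborel))"
    unfolding E_def by (intro nn_integral_add) measurable
  also have "(\<integral>\<^sup>+p. ennreal ((norm (f (fst p)))\<^sup>2 / 2 * E (fst p - snd p)) \<partial>(lborel \<Otimes>\<^sub>M lborel))
      = (\<integral>\<^sup>+t. \<integral>\<^sup>+s. ennreal ((norm (f t))\<^sup>2 / 2 * E (t - s)) \<partial>lborel \<partial>lborel)"
    unfolding E_def by (subst lborel.nn_integral_fst[symmetric]) (auto, measurable)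
  also have "\<dots> = (\<integral>\<^sup>+t. ennreal ((norm (f t))\<^sup>2) * ennreal (sqrt (2 * pi) / 2) \<partial>lborel)"
  proof (intro nn_integral_cong)
    fix t
    have "(\<integral>\<^sup>+s. ennreal ((norm (f t))\<^sup>2 / 2 * E (t - s)) \<partial>lborel)
        = ennreal ((norm (f t))\<^sup>2 / 2) * (\<integral>\<^sup>+s. E (t - s) \<partial>lborel)"
      unfolding E_def by (subst nn_integral_cmult[symmetric]) (auto simp: ennreal_mult'[symmetric])
    thus "(\<integral>\<^sup>+s. ennreal ((norm (f t))\<^sup>2 / 2 * E (t - s)) \<partial>lborel)
        = ennreal ((norm (f t))\<^sup>2) * ennreal (sqrt (2 * pi) / 2)"
      by (simp add: E_nn ennreal_mult'[symmetric])
  qed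
  also have "\<dots> = ennreal N * ennreal (sqrt (2 * pi) / 2)"
    by (subst nn_integral_multc) (auto simp: N_nn)
  also have "(\<integral>\<^sup>+p. ennreal ((norm (f (snd p)))\<^sup>2 / 2 * E (fst p - snd p)) \<partial>(lborel \<Otimes>\<^sub>M lborel))
      = (\<integral>\<^sup>+s. \<integral>\<^sup>+t. ennreal ((norm (f s))\<^sup>2 / 2 * E (t - s)) \<partial>lborel \<partial>lborel)"
    unfolding E_def by (subst lborel_pair.nn_integral_snd[symmetric]) (auto, measurable)
  also have "\<dots> = (\<integral>\<^sup>+t. ennreal ((norm (f t))\<^sup>2) * ennreal (sqrt (2 * pi) / 2) \<partial>lborel)"
  proof (intro nn_integral_cong)
    fix s
    have "(\<integral>\<^sup>+t. ennreal ((norm (f s))\<^sup>2 / 2 * E (t - s)) \<partial>lborel)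
        = ennreal ((norm (f s))\<^sup>2 / 2) * (\<integral>\<^sup>+t. E (t - s) \<partial>lborel)"
      unfolding E_def by (subst nn_integral_cmult[symmetric]) (auto simp: ennreal_mult'[symmetric])
    thus "(\<integral>\<^sup>+t. ennreal ((norm (f s))\<^sup>2 / 2 * E (t - s)) \<partial>lborel)
        = ennreal ((norm (f s))\<^sup>2) * ennreal (sqrt (2 * pi) / 2)"
      by (simp add: E_nn ennreal_mult'[symmetric])
  qed
  also have "\<dots> = ennreal N * ennreal (sqrt (2 * pi) / 2)"
    by (subst nn_integral_multc) (auto simp: N_nn)
  also have "ennreal N * ennreal (sqrt (2 * pi) / 2) + ennreal N * ennreal (sqrt (2 * pi) / 2)
      = ennreal (sqrt (2 * pi) * N)"
  proof -
    have "N \<ge> 0" by (auto simp: N_def)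
    thus ?thesis by (simp add: ennreal_mult[symmetric] ennreal_plus[symmetric] del: ennreal_plus)
  qed
  finally show ?thesis by (simp add: F_def N_def)
qed

text \<open>The product of 3, from dy = y du with y \<le> 3 X; of \<open>sqrt (2 * pi)\<close>, from
  the Gaussian mean value theorem; and of \<open>sqrt (2 * pi) * exp ((ln 3)\<^sup>2 / 2)\<close>,
  the reciprocal of the least value of the standard normal density on
  \<open>{0..ln 3}\<close>.\<close>

definition mean_value_const :: real where
  "mean_value_const = 6 * pi * exp ((ln 3)\<^sup>2 / 2)"

text \<open>The complex power of a positive y, split into modulus and phase: the norm and the joint
  measurability in y and t can be read off, and the phase is a character in
  \<open>ln y\<close>.\<close>

definition real_cpow :: "real \<Rightarrow> real \<Rightarrow> real \<Rightarrow> complex" where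
  "real_cpow y c t = of_real (y powr c) * iexp (ln y * t)"

lemma real_cpow_eq_powr:
  assumes "y > 0"
  shows "real_cpow y c t = of_real y powr Complex c t"
  using assms
  by (simp add: real_cpow_def powr_def Ln_of_real exp_of_real[symmetric] exp_add[symmetric] Complex_eq algebra_simps)

lemma norm_real_cpow [simp]: "norm (real_cpow y c t) = y powr c"
  by (simp add: real_cpow_def norm_mult)

lemma borel_measurable_real_cpow [measurable (raw)]:
  assumes [measurable]: "f \<in> borel_measurable M" "g \<in> borel_measurable M"
  shows "(\<lambda>x. real_cpow (f x) c (g x)) \<in> borel_measurable M"
  unfolding real_cpow_def by measurable

text \<open>The substitution y = X exp u makes the Mellin integral a Fourier integral in u over
  \<open>{0..ln 3}\<close>, where the normal density is bounded below and may be inserted as a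
  weight. The range up to 3 X contains x + h for x \<le> 2 X and h \<le> X.\<close>

lemma mean_value_powr:
  fixes f :: "real \<Rightarrow> complex"
  assumes f: "integrable lborel f" and f2: "integrable lborel (\<lambda>t. (norm (f t))\<^sup>2)"
    and X: "X > 0" and B: "\<And>y. X \<le> y \<Longrightarrow> y \<le> 3 * X \<Longrightarrow> y powr c \<le> B"
  shows "(\<integral>\<^sup>+y. ennreal (indicator {X..3 * X} y * (norm (LINT t|lborel. f t * real_cpow y c t))\<^sup>2) \<partial>lborel)
     \<le> ennreal (mean_value_const * X * B\<^sup>2 * (LINT t|lborel. (norm (f t))\<^sup>2))"
proof -
  have [measurable]: "f \<in> borel_measurable lborel" using f by simp
  define N where "N = (LINT t|lborel. (norm (f t))\<^sup>2)"
  \<comment> \<open>The phase of X is moved into the function; it has modulus 1, so the squared norm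
    is unchanged and u can start at 0.\<close>
  define h where "h t = f t * iexp (ln X * t)" for t
  define G where "G u = (norm (LINT t|lborel. h t * iexp (u * t)))\<^sup>2" for u
  have nh: "norm (h t) = norm (f t)" for t by (simp add: h_def norm_mult)
  have [measurable]: "h \<in> borel_measurable lborel" unfolding h_def by measurable
  have h: "integrable lborel h"
    by (rule Bochner_Integration.integrable_bound[OF f]) (auto simp: nh)
  have G_meas [measurable]: "G \<in> borel_measurable borel" unfolding G_def by measurable
  have B0: "B \<ge> 0" using B[of X] X powr_ge_zero[of X c] by linarith
  have point: "indicator {X..3 * X} y * (norm (LINT t|lborel. f t * real_cpow y c t))\<^sup>2
      \<le> B\<^sup>2 * (G (ln y - ln X) * indicator {X..3 * X} y)" for y
  proof (cases "y \<in> {X..3 * X}")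
    case True
    hence y: "y > 0" using X by auto
    have "f t * real_cpow y c t = of_real (y powr c) * (h t * iexp ((ln y - ln X) * t))" for t
      unfolding real_cpow_def h_def by (simp add: algebra_simps exp_diff)
    hence "(norm (LINT t|lborel. f t * real_cpow y c t))\<^sup>2 = (y powr c)\<^sup>2 * G (ln y - ln X)"
      by (simp add: G_def norm_mult power_mult_distrib)
    also have "\<dots> \<le> B\<^sup>2 * G (ln y - ln X)"
      using B True by (intro mult_right_mono power_mono) (auto simp: G_def)
    finally show ?thesis using True by simp
  qed simp
  define D where "D = sqrt (2 * pi) * exp ((ln 3)\<^sup>2 / 2)"
  have dens: "1 \<le> D * std_normal_density u" if "u \<in> {0..ln 3}" for u
  proof -
    have "u\<^sup>2 \<le> (ln 3)\<^sup>2" using that by (intro power_mono) auto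
    hence "1 \<le> exp ((ln 3)\<^sup>2 / 2 + - u\<^sup>2 / 2)" by simp
    also have "\<dots> = D * std_normal_density u"
      unfolding exp_add by (simp add: D_def std_normal_density_def)
    finally show ?thesis .
  qed
  have "(\<integral>\<^sup>+y. ennreal (indicator {X..3 * X} y * (norm (LINT t|lborel. f t * real_cpow y c t))\<^sup>2) \<partial>lborel)
      \<le> (\<integral>\<^sup>+y. ennreal (B\<^sup>2) * ennreal (G (ln y - ln X) * indicator {X..3 * X} y) \<partial>lborel)"
    using point by (intro nn_integral_mono) (simp add: ennreal_mult'[symmetric] ennreal_leI)
  also have "\<dots> = ennreal (B\<^sup>2) * (\<integral>\<^sup>+y. ennreal (G (ln y - ln X) * indicator {X..3 * X} y) \<partial>lborel)"
    by (rule nn_integral_cmult) measurable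
  also have "(\<integral>\<^sup>+y. ennreal (G (ln y - ln X) * indicator {X..3 * X} y) \<partial>lborel)
      = (\<integral>\<^sup>+u. ennreal (G (ln (X * exp u) - ln X) * (X * exp u) * indicator {0..ln 3} u) \<partial>lborel)"
  proof -
    have ends: "X * exp 0 = X" "X * exp (ln 3) = 3 * X" by simp_all
    have "(\<integral>\<^sup>+y. ennreal (G (ln y - ln X) * indicator {X * exp 0..X * exp (ln 3)} y) \<partial>lborel)
        = (\<integral>\<^sup>+u. ennreal (G (ln (X * exp u) - ln X) * (X * exp u) * indicator {0..ln 3} u) \<partial>lborel)"
    proof (rule nn_integral_substitution)
      show "((\<lambda>u. X * exp u) has_real_derivative X * exp u) (at u)" for u
        by (auto intro!: derivative_eq_intros)
      show "set_borel_measurable borel {X * exp 0..X * exp (ln 3)} (\<lambda>y. G (ln y - ln X))"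
        unfolding set_borel_measurable_def by measurable
    qed (use X in \<open>auto intro!: continuous_intros\<close>)
    thus ?thesis unfolding ends .
  qed
  also have "\<dots> \<le> (\<integral>\<^sup>+u. ennreal (3 * X * D) * ennreal (std_normal_density u * G u) \<partial>lborel)"
  proof (intro nn_integral_mono)
    fix u
    have "G (ln (X * exp u) - ln X) * (X * exp u) * indicator {0..ln 3} u \<le> 3 * X * D * (std_normal_density u * G u)"
    proof (cases "u \<in> {0..ln 3}")
      case True
      have "exp u \<le> exp (ln 3)" using True by (subst exp_le_cancel_iff) auto
      hence "X * exp u \<le> 3 * X" using X by simp
      hence "G u * (X * exp u) * 1 \<le> G u * (3 * X) * (D * std_normal_density u)"
        using X by (intro mult_mono[OF mult_left_mono[OF \<open>X * exp u \<le> 3 * X\<close>] dens[OF True]]) (auto simp: G_def)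
      thus ?thesis using True X by (simp add: ln_mult mult_ac)
    next
      case False
      thus ?thesis using X by (auto simp: D_def G_def)
    qed
    thus "ennreal (G (ln (X * exp u) - ln X) * (X * exp u) * indicator {0..ln 3} u)
        \<le> ennreal (3 * X * D) * ennreal (std_normal_density u * G u)"
      using X by (subst ennreal_mult'[symmetric]) (auto simp: D_def intro!: ennreal_leI)
  qed
  also have "\<dots> = ennreal (3 * X * D) * (\<integral>\<^sup>+u. ennreal (std_normal_density u * G u) \<partial>lborel)"
    by (rule nn_integral_cmult) measurable
  also have "\<dots> \<le> ennreal (3 * X * D) * ennreal (sqrt (2 * pi) * N)"
    using gaussian_mean_value[OF h] f2 unfolding G_def N_def nh by (intro mult_left_mono) auto
  finally have "(\<integral>\<^sup>+y. ennreal (indicator {X..3 * X} y * (norm (LINT t|lborel. f t * real_cpow y c t))\<^sup>2) \<partial>lborel)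
      \<le> ennreal (B\<^sup>2) * (ennreal (3 * X * D) * ennreal (sqrt (2 * pi) * N))"
    by (simp add: mult_left_mono)
  also have "\<dots> = ennreal (B\<^sup>2 * (3 * X * D * (sqrt (2 * pi) * N)))"
    using X by (subst ennreal_mult'[symmetric], simp add: D_def)+ simp
  also have "B\<^sup>2 * (3 * X * D * (sqrt (2 * pi) * N)) = mean_value_const * X * B\<^sup>2 * N"
    by (simp add: D_def mean_value_const_def)
  finally show ?thesis by (simp add: N_def)
qed

section \<open>Differences over short intervals\<close>

text \<open>The factor \<open>Complex c t\<close> will cancel the \<open>1 / s\<close> of the Perron
  integrand, and the exponent c - 1 together with the length h of the interval gives the saving h /
  X at low frequencies.\<close>

lemma real_cpow_FTC:
  assumes "x > 0" "h \<ge> 0"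
  shows "(LINT y|lborel. indicator {x..x + h} y *\<^sub>R (Complex c t * real_cpow y (c - 1) t))
     = real_cpow (x + h) c t - real_cpow x c t"
proof (rule integral_FTC_Icc)
  fix y assume y: "x \<le> y" "y \<le> x + h"
  have pos: "y > 0" using y assms by simp
  have cx: "Complex c t - 1 = Complex (c - 1) t" by (simp add: complex_eq_iff)
  have "((\<lambda>z. z powr Complex c t) has_field_derivative Complex c t * of_real y powr (Complex c t - 1)) (at (of_real y))"
    using pos by (intro has_field_derivative_powr) (auto simp: complex_nonpos_Reals_iff)
  from has_vector_derivative_real_field[OF this]
  have "((\<lambda>y. of_real y powr Complex c t) has_vector_derivative Complex c t * real_cpow y (c - 1) t) (at y)"
    by (simp only: cx real_cpow_eq_powr[OF pos])
  hence "((\<lambda>y. real_cpow y c t) has_vector_derivative Complex c t * real_cpow y (c - 1) t) (at y)"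
    by (rule has_vector_derivative_transform_within_open[of _ _ _ "{0<..}"])
       (use pos in \<open>auto simp: real_cpow_eq_powr\<close>)
  thus "((\<lambda>y. real_cpow y c t) has_vector_derivative Complex c t * real_cpow y (c - 1) t)
      (at y within {x..x + h})"
    by (rule has_vector_derivative_at_within)
next
  show "continuous_on {x..x + h} (\<lambda>y. Complex c t * real_cpow y (c - 1) t)"
    unfolding real_cpow_def using assms by (intro continuous_intros) auto
qed (use assms in auto)

lemma norm_add3_squared_le:
  fixes a b c :: complex
  shows "(norm (a + b - c))\<^sup>2 \<le> 3 * (norm a)\<^sup>2 + 3 * (norm b)\<^sup>2 + 3 * (norm c)\<^sup>2"
proof -
  have "norm (a + b - c) \<le> norm a + norm b + norm c"
    using norm_triangle_ineq4[of "a + b" c] norm_triangle_ineq[of a b] by linarith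
  hence "(norm (a + b - c))\<^sup>2 \<le> (norm a + norm b + norm c)\<^sup>2" by (intro power_mono) auto
  also have "\<dots> \<le> 3 * (norm a)\<^sup>2 + 3 * (norm b)\<^sup>2 + 3 * (norm c)\<^sup>2"
    using sum_squares_bound[of "norm a" "norm b"] sum_squares_bound[of "norm a" "norm c"]
      sum_squares_bound[of "norm b" "norm c"]
    by (simp add: power2_eq_square algebra_simps)
  finally show ?thesis .
qed

lemma integral_le_of_nn_integral:
  assumes "integrable M f" "\<And>x. f x \<ge> 0" "(\<integral>\<^sup>+x. ennreal (f x) \<partial>M) \<le> ennreal A" "A \<ge> 0"
  shows "integral\<^sup>L M f \<le> A"
  using nn_integral_eq_integral[OF assms(1)] assms by (simp add: ennreal_le_iff)

text \<open>Cauchy-Schwarz on an interval of length h gives one factor h. After Tonelli, each y is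
  counted for x in \<open>{y - h..y}\<close> only, which gives the other.\<close>

lemma short_interval_mean_square:
  fixes a :: "real \<Rightarrow> complex"
  assumes X: "X > 0" and h: "0 < h" "h \<le> X" and a [measurable]: "a \<in> borel_measurable borel"
  shows "(\<integral>\<^sup>+x. ennreal (indicator {X..2 * X} x * (norm (LINT y|lborel. indicator {x..x + h} y *\<^sub>R a y))\<^sup>2) \<partial>lborel)
     \<le> ennreal (h\<^sup>2) * (\<integral>\<^sup>+y. ennreal (indicator {X..3 * X} y * (norm (a y))\<^sup>2) \<partial>lborel)"
proof -
  define \<alpha> where "\<alpha> y = ennreal ((norm (a y))\<^sup>2)" for y
  have [measurable]: "\<alpha> \<in> borel_measurable borel" unfolding \<alpha>_def by measurable
  have cs: "ennreal ((norm (LINT y|lborel. indicator {x..x + h} y *\<^sub>R a y))\<^sup>2)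
      \<le> ennreal h * (\<integral>\<^sup>+y. indicator {x..x + h} y * \<alpha> y \<partial>lborel)" for x
  proof -
    have le: "ennreal (norm (LINT y|lborel. indicator {x..x + h} y *\<^sub>R a y))
        \<le> (\<integral>\<^sup>+y. ennreal (norm (indicator {x..x + h} y *\<^sub>R a y)) \<partial>lborel)"
    \<comment> \<open>If the function is not integrable, its Bochner integral is 0 by convention and
      the inequality is trivial.\<close>
    proof (cases "integrable lborel (\<lambda>y. indicator {x..x + h} y *\<^sub>R a y)")
      case True
      thus ?thesis by (rule integral_norm_bound_ennreal)
    qed (simp add: not_integrable_integral_eq)
    have "ennreal ((norm (LINT y|lborel. indicator {x..x + h} y *\<^sub>R a y))\<^sup>2)
        \<le> (\<integral>\<^sup>+y. ennreal (norm (indicator {x..x + h} y *\<^sub>R a y)) \<partial>lborel)\<^sup>2"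
      unfolding ennreal_power[OF norm_ge_zero, symmetric] by (intro power_mono le) simp
    also have "(\<lambda>y. ennreal (norm (indicator {x..x + h} y *\<^sub>R a y)))
        = (\<lambda>y. indicator {x..x + h} y * (indicator {x..x + h} y * ennreal (norm (a y))))"
      by (auto split: split_indicator)
    also have "(\<integral>\<^sup>+y. indicator {x..x + h} y * (indicator {x..x + h} y * ennreal (norm (a y))) \<partial>lborel)\<^sup>2
        \<le> (\<integral>\<^sup>+y. (indicator {x..x + h} y)\<^sup>2 \<partial>lborel)
          * (\<integral>\<^sup>+y. (indicator {x..x + h} y * ennreal (norm (a y)))\<^sup>2 \<partial>lborel)"
      by (rule Cauchy_Schwarz_nn_integral) measurable
    also have "(\<lambda>y. (indicator {x..x + h} y)\<^sup>2) = (\<lambda>y. indicator {x..x + h} y :: ennreal)"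
      by (auto split: split_indicator)
    also have "(\<lambda>y. (indicator {x..x + h} y * ennreal (norm (a y)))\<^sup>2) = (\<lambda>y. indicator {x..x + h} y * \<alpha> y)"
      by (auto simp: \<alpha>_def ennreal_power split: split_indicator)
    also have "(\<integral>\<^sup>+y. indicator {x..x + h} y \<partial>lborel) = ennreal h"
      using h by simp
    finally show ?thesis .
  qed
  have "(\<integral>\<^sup>+x. ennreal (indicator {X..2 * X} x * (norm (LINT y|lborel. indicator {x..x + h} y *\<^sub>R a y))\<^sup>2) \<partial>lborel)
      \<le> (\<integral>\<^sup>+x. indicator {X..2 * X} x * (ennreal h * (\<integral>\<^sup>+y. indicator {x..x + h} y * \<alpha> y \<partial>lborel)) \<partial>lborel)"
    using cs by (intro nn_integral_mono) (auto split: split_indicator)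
  also have "\<dots> = (\<integral>\<^sup>+x. \<integral>\<^sup>+y. ennreal h * (indicator {X..2 * X} x * indicator {x..x + h} y * \<alpha> y) \<partial>lborel \<partial>lborel)"
  proof (intro nn_integral_cong)
    fix x
    show "indicator {X..2 * X} x * (ennreal h * (\<integral>\<^sup>+y. indicator {x..x + h} y * \<alpha> y \<partial>lborel))
        = (\<integral>\<^sup>+y. ennreal h * (indicator {X..2 * X} x * indicator {x..x + h} y * \<alpha> y) \<partial>lborel)"
      by (auto simp: nn_integral_cmult split: split_indicator)
  qed
  also have "\<dots> \<le> (\<integral>\<^sup>+x. \<integral>\<^sup>+y. ennreal h * (indicator {X..3 * X} y * \<alpha> y) * indicator {y - h..y} x \<partial>lborel \<partial>lborel)"
    using h by (intro nn_integral_mono) (auto split: split_indicator)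
  also have "\<dots> = (\<integral>\<^sup>+y. \<integral>\<^sup>+x. ennreal h * (indicator {X..3 * X} y * \<alpha> y) * indicator {y - h..y} x \<partial>lborel \<partial>lborel)"
  proof (rule lborel_pair.Fubini'[symmetric])
    \<comment> \<open>The moving interval is written as membership of (x, y) in a fixed subset of
      the plane, from which joint measurability follows.\<close>
    have "(\<lambda>(x, y). ennreal h * (indicator {X..3 * X} y * \<alpha> y) * indicator {p. snd p - h \<le> fst p \<and> fst p \<le> snd p} (x, y))
        \<in> borel_measurable (lborel \<Otimes>\<^sub>M lborel)" by measurable
    also have "?this \<longleftrightarrow> (\<lambda>(x, y). ennreal h * (indicator {X..3 * X} y * \<alpha> y) * indicator {y - h..y} x)
        \<in> borel_measurable (lborel \<Otimes>\<^sub>M lborel)"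
      by (intro measurable_cong) (auto split: split_indicator)
    finally show "(\<lambda>(x, y). ennreal h * (indicator {X..3 * X} y * \<alpha> y) * indicator {y - h..y} x)
        \<in> borel_measurable (lborel \<Otimes>\<^sub>M lborel)" .
  qed
  also have "\<dots> = (\<integral>\<^sup>+y. ennreal (h\<^sup>2) * (indicator {X..3 * X} y * \<alpha> y) \<partial>lborel)"
  proof (intro nn_integral_cong)
    fix y
    have "(\<integral>\<^sup>+x. ennreal h * (indicator {X..3 * X} y * \<alpha> y) * indicator {y - h..y} x \<partial>lborel)
        = ennreal h * (indicator {X..3 * X} y * \<alpha> y) * ennreal h"
      using h by (subst nn_integral_cmult) auto
    also have "\<dots> = ennreal (h\<^sup>2) * (indicator {X..3 * X} y * \<alpha> y)"
      using h by (simp add: power2_eq_square ennreal_mult mult_ac)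
    finally show "(\<integral>\<^sup>+x. ennreal h * (indicator {X..3 * X} y * \<alpha> y) * indicator {y - h..y} x \<partial>lborel)
        = ennreal (h\<^sup>2) * (indicator {X..3 * X} y * \<alpha> y)" .
  qed
  also have "\<dots> = ennreal (h\<^sup>2) * (\<integral>\<^sup>+y. indicator {X..3 * X} y * \<alpha> y \<partial>lborel)"
    by (rule nn_integral_cmult) measurable
  also have "(\<lambda>y. indicator {X..3 * X} y * \<alpha> y) = (\<lambda>y. ennreal (indicator {X..3 * X} y * (norm (a y))\<^sup>2))"
    by (auto simp: \<alpha>_def split: split_indicator)
  finally show ?thesis .
qed

text \<open>The frequencies \<bar>t\<bar> \<le> T enter through the derivative, which explains the
  weight \<open>Complex c t\<close> in A and the factor \<open>h\<^sup>2\<close>; the others enter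
  at x + h and at x separately, hence 2 B. As 0 < c < 1, the power with exponent c - 1 is largest at
  X and the one with exponent c at 3 X.\<close>

lemma difference_mean_square:
  fixes f :: "real \<Rightarrow> complex"
  assumes f: "integrable lborel f" and f2: "integrable lborel (\<lambda>t. (norm (f t))\<^sup>2)"
    and c: "0 < c" "c < 1" and X: "X > 0" and h: "0 < h" "h \<le> X" and T: "T > 0"
    and A: "A \<ge> 0" "(\<integral>\<^sup>+t. ennreal (indicator {-T..T} t * (norm (f t * Complex c t))\<^sup>2) \<partial>lborel) \<le> ennreal A"
    and B: "B \<ge> 0" "(\<integral>\<^sup>+t. ennreal (indicator (- {-T..T}) t * (norm (f t))\<^sup>2) \<partial>lborel) \<le> ennreal B"
  defines "S \<equiv> (\<lambda>x. LINT t|lborel. f t * real_cpow x c t)"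
  shows "(\<integral>\<^sup>+x. ennreal (indicator {X..2 * X} x * (norm (S (x + h) - S x))\<^sup>2) \<partial>lborel)
     \<le> ennreal (3 * mean_value_const * X * (h\<^sup>2 * (X powr (c - 1))\<^sup>2 * A + 2 * ((3 * X) powr c)\<^sup>2 * B))"
proof -
  have [measurable]: "f \<in> borel_measurable lborel" using f by simp
  define f1 where "f1 t = indicator {-T..T} t *\<^sub>R f t" for t
  define f2 where "f2 t = indicator (- {-T..T}) t *\<^sub>R f t" for t
  define g where "g t = f1 t * Complex c t" for t
  define a where "a y = (LINT t|lborel. g t * real_cpow y (c - 1) t)" for y
  define b where "b x = (LINT t|lborel. f2 t * real_cpow x c t)" for x
  have [measurable]: "f1 \<in> borel_measurable lborel" "f2 \<in> borel_measurable lborel" "g \<in> borel_measurable lborel"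
    unfolding f1_def f2_def g_def by measurable
  have [measurable]: "a \<in> borel_measurable borel" "b \<in> borel_measurable borel"
    unfolding a_def b_def by measurable
  have f1_int: "integrable lborel f1" and f2_int: "integrable lborel f2"
    unfolding f1_def f2_def using f by (auto intro!: integrable_mult_indicator)
  \<comment> \<open>Truncation to \<bar>t\<bar> \<le> T makes multiplication by
    \<open>Complex c t\<close> bounded, so integrability passes from f to g. This bound is used only
    qualitatively; the estimate itself comes from A.\<close>
  have g_le: "norm (g t) \<le> (c + T) * norm (f t)" for t
  proof (cases "t \<in> {-T..T}")
    case True
    have "norm (Complex c t) \<le> c + T" using cmod_le[of "Complex c t"] True c by auto
    thus ?thesis using True by (simp add: g_def f1_def norm_mult mult_right_mono mult.commute[of "norm (f t)"])
  next
    case False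
    thus ?thesis using c T by (auto simp: g_def f1_def)
  qed
  have g_int: "integrable lborel g"
    by (rule Bochner_Integration.integrable_bound[OF integrable_mult_right[OF f, of "of_real (c + T)"]])
       (use g_le c T in \<open>auto simp: norm_mult abs_of_pos simp flip: of_real_add\<close>)
  have g2_int: "integrable lborel (\<lambda>t. (norm (g t))\<^sup>2)"
  proof (rule Bochner_Integration.integrable_bound[OF integrable_mult_right[OF assms(2), of "(c + T)\<^sup>2"]])
    show "AE t in lborel. norm ((norm (g t))\<^sup>2) \<le> norm ((c + T)\<^sup>2 * (norm (f t))\<^sup>2)"
    proof (intro AE_I2)
      fix t
      have "(norm (g t))\<^sup>2 \<le> ((c + T) * norm (f t))\<^sup>2" using g_le by (intro power_mono) auto
      thus "norm ((norm (g t))\<^sup>2) \<le> norm ((c + T)\<^sup>2 * (norm (f t))\<^sup>2)" by (simp add: power_mult_distrib)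
    qed
  qed measurable
  have f22_int: "integrable lborel (\<lambda>t. (norm (f2 t))\<^sup>2)"
    by (rule Bochner_Integration.integrable_bound[OF assms(2)]) (auto simp: f2_def split: split_indicator)
  have A': "(LINT t|lborel. (norm (g t))\<^sup>2) \<le> A"
  proof (rule integral_le_of_nn_integral[OF g2_int _ _ A(1)])
    have "(\<lambda>t. ennreal ((norm (g t))\<^sup>2)) = (\<lambda>t. ennreal (indicator {-T..T} t * (norm (f t * Complex c t))\<^sup>2))"
      by (auto simp: g_def f1_def split: split_indicator)
    thus "(\<integral>\<^sup>+t. ennreal ((norm (g t))\<^sup>2) \<partial>lborel) \<le> ennreal A" using A(2) by simp
  qed simp
  have B': "(LINT t|lborel. (norm (f2 t))\<^sup>2) \<le> B"
  proof (rule integral_le_of_nn_integral[OF f22_int _ _ B(1)])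
    have "(\<lambda>t. ennreal ((norm (f2 t))\<^sup>2)) = (\<lambda>t. ennreal (indicator (- {-T..T}) t * (norm (f t))\<^sup>2))"
      by (auto simp: f2_def split: split_indicator)
    thus "(\<integral>\<^sup>+t. ennreal ((norm (f2 t))\<^sup>2) \<partial>lborel) \<le> ennreal B" using B(2) by simp
  qed simp
  have rc_int: "integrable lborel (\<lambda>t. u t * real_cpow x e t)"
    if "integrable lborel u" for u :: "real \<Rightarrow> complex" and x e
  proof (rule Bochner_Integration.integrable_bound)
    show "integrable lborel (\<lambda>t. of_real (x powr e) * u t)" using that by (rule integrable_mult_right)
    show "(\<lambda>t. u t * real_cpow x e t) \<in> borel_measurable lborel"
      using borel_measurable_integrable[OF that] by measurable
  qed (auto simp: norm_mult mult.commute)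
  have split: "S (x + h) - S x = (LINT y|lborel. indicator {x..x + h} y *\<^sub>R a y) + b (x + h) - b x"
    if x: "x > 0" for x
  proof -
    have "S x = (LINT t|lborel. f1 t * real_cpow x c t) + b x" for x
    proof -
      have "f t * real_cpow x c t = f1 t * real_cpow x c t + f2 t * real_cpow x c t" for t
        by (auto simp: f1_def f2_def split: split_indicator)
      thus ?thesis unfolding S_def b_def using f1_int f2_int
        by (subst Bochner_Integration.integral_add[symmetric]) (auto intro!: rc_int)
    qed
    moreover have "(LINT t|lborel. f1 t * real_cpow (x + h) c t) - (LINT t|lborel. f1 t * real_cpow x c t)
        = (LINT y|lborel. indicator {x..x + h} y *\<^sub>R a y)"
    proof -
      define q where "q t y = indicator {x..x + h} y *\<^sub>R (g t * real_cpow y (c - 1) t)" for t y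
      have ng: "integrable lborel (\<lambda>t. norm (g t))" using g_int by simp
      have np: "integrable lborel (\<lambda>y. indicator {x..x + h} y *\<^sub>R y powr (c - 1))"
        by (rule borel_integrable_compact) (use x in \<open>auto intro!: continuous_intros\<close>)
      have q_int: "integrable (lborel \<Otimes>\<^sub>M lborel) (\<lambda>(t, y). q t y)"
        by (rule lborel_pair.integrable_product_bound[OF _ ng np])
           (auto simp: q_def norm_mult split: split_indicator)
      have q1: "(LINT y|lborel. q t y) = f1 t * (real_cpow (x + h) c t - real_cpow x c t)" for t
      proof -
        have "q t y = f1 t * (indicator {x..x + h} y *\<^sub>R (Complex c t * real_cpow y (c - 1) t))" for y
          by (simp add: q_def g_def)
        thus ?thesis using x h by (simp only: integral_mult_right_zero real_cpow_FTC less_imp_le)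
      qed
      have q2: "(LINT t|lborel. q t y) = indicator {x..x + h} y *\<^sub>R a y" for y
        by (simp add: q_def a_def)
      have "(LINT t|lborel. LINT y|lborel. q t y) = (LINT y|lborel. LINT t|lborel. q t y)"
        using lborel_pair.Fubini_integral[OF q_int] by simp
      hence "(LINT y|lborel. indicator {x..x + h} y *\<^sub>R a y)
          = (LINT t|lborel. f1 t * real_cpow (x + h) c t - f1 t * real_cpow x c t)"
        unfolding q1 q2 right_diff_distrib ..
      also have "\<dots> = (LINT t|lborel. f1 t * real_cpow (x + h) c t) - (LINT t|lborel. f1 t * real_cpow x c t)"
        by (intro Bochner_Integration.integral_diff rc_int f1_int)
      finally show ?thesis ..
    qed
    ultimately show ?thesis by simp
  qed
  define I1 where "I1 x = ennreal (indicator {X..2 * X} x * (norm (LINT y|lborel. indicator {x..x + h} y *\<^sub>R a y))\<^sup>2)" for x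
  \<comment> \<open>One function on \<open>{X..3 * X}\<close> dominates both boundary terms, at x
    and at x + h, and translation invariance gives them the same integral.\<close>
  define J where "J y = ennreal (indicator {X..3 * X} y * (norm (b y))\<^sup>2)" for y
  have [measurable]: "I1 \<in> borel_measurable borel"
  proof -
    have "(\<lambda>x. LINT y|lborel. indicator {p. fst p \<le> snd p \<and> snd p \<le> fst p + h} (x, y) *\<^sub>R a y) \<in> borel_measurable borel"
      by measurable
    also have "(\<lambda>x. LINT y|lborel. indicator {p. fst p \<le> snd p \<and> snd p \<le> fst p + h} (x, y) *\<^sub>R a y)
        = (\<lambda>x. LINT y|lborel. indicator {x..x + h} y *\<^sub>R a y)"
      by (intro ext Bochner_Integration.integral_cong) (auto split: split_indicator)
    finally have [measurable]: "(\<lambda>x. LINT y|lborel. indicator {x..x + h} y *\<^sub>R a y) \<in> borel_measurable borel" .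
    show ?thesis unfolding I1_def by measurable
  qed
  have [measurable]: "J \<in> borel_measurable borel" unfolding J_def by measurable
  have J_le: "(\<integral>\<^sup>+y. J y \<partial>lborel) \<le> ennreal (mean_value_const * X * ((3 * X) powr c)\<^sup>2 * B)"
  proof -
    have "(\<integral>\<^sup>+y. J y \<partial>lborel) \<le> ennreal (mean_value_const * X * ((3 * X) powr c)\<^sup>2 * (LINT t|lborel. (norm (f2 t))\<^sup>2))"
      unfolding J_def b_def using X c
      by (intro mean_value_powr f2_int f22_int powr_mono2) auto
    also have "\<dots> \<le> ennreal (mean_value_const * X * ((3 * X) powr c)\<^sup>2 * B)"
      using B' X by (intro ennreal_leI mult_left_mono) (auto simp: mean_value_const_def)
    finally show ?thesis .
  qed
  have I_le: "(\<integral>\<^sup>+x. I1 x \<partial>lborel) \<le> ennreal (h\<^sup>2 * (mean_value_const * X * (X powr (c - 1))\<^sup>2 * A))"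
  proof -
    have "(\<integral>\<^sup>+x. I1 x \<partial>lborel) \<le> ennreal (h\<^sup>2) * (\<integral>\<^sup>+y. ennreal (indicator {X..3 * X} y * (norm (a y))\<^sup>2) \<partial>lborel)"
      unfolding I1_def by (rule short_interval_mean_square) (use X h in auto)
    also have "\<dots> \<le> ennreal (h\<^sup>2) * ennreal (mean_value_const * X * (X powr (c - 1))\<^sup>2 * (LINT t|lborel. (norm (g t))\<^sup>2))"
      unfolding a_def using X c
      by (intro mult_left_mono mean_value_powr g_int g2_int powr_mono2') auto
    also have "\<dots> \<le> ennreal (h\<^sup>2) * ennreal (mean_value_const * X * (X powr (c - 1))\<^sup>2 * A)"
      using A' X by (intro mult_left_mono ennreal_leI) (auto simp: mean_value_const_def)
    also have "\<dots> = ennreal (h\<^sup>2 * (mean_value_const * X * (X powr (c - 1))\<^sup>2 * A))"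
      using A(1) X by (subst ennreal_mult') (auto simp: mean_value_const_def)
    finally show ?thesis .
  qed
  have "(\<integral>\<^sup>+x. ennreal (indicator {X..2 * X} x * (norm (S (x + h) - S x))\<^sup>2) \<partial>lborel)
      \<le> (\<integral>\<^sup>+x. 3 * I1 x + 3 * J (x + h) + 3 * J x \<partial>lborel)"
  proof (intro nn_integral_mono)
    fix x
    show "ennreal (indicator {X..2 * X} x * (norm (S (x + h) - S x))\<^sup>2) \<le> 3 * I1 x + 3 * J (x + h) + 3 * J x"
    proof (cases "x \<in> {X..2 * X}")
      case True
      have "ennreal ((norm (S (x + h) - S x))\<^sup>2)
          \<le> ennreal (3 * (norm (LINT y|lborel. indicator {x..x + h} y *\<^sub>R a y))\<^sup>2 + 3 * (norm (b (x + h)))\<^sup>2 + 3 * (norm (b x))\<^sup>2)"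
        using True X by (subst split) (simp, intro ennreal_leI norm_add3_squared_le)
      also have "\<dots> = 3 * I1 x + 3 * J (x + h) + 3 * J x"
        using True h X by (simp add: I1_def J_def ennreal_mult)
      finally show ?thesis using True by simp
    qed simp
  qed
  also have "\<dots> = 3 * (\<integral>\<^sup>+x. I1 x \<partial>lborel) + 3 * (\<integral>\<^sup>+x. J (x + h) \<partial>lborel) + 3 * (\<integral>\<^sup>+x. J x \<partial>lborel)"
    by (simp add: nn_integral_add nn_integral_cmult)
  also have "(\<integral>\<^sup>+x. J (x + h) \<partial>lborel) = (\<integral>\<^sup>+x. J x \<partial>lborel)"
    using nn_integral_real_affine[of J 1 h] by (simp add: add.commute)
  also have "3 * (\<integral>\<^sup>+x. I1 x \<partial>lborel) + 3 * (\<integral>\<^sup>+x. J x \<partial>lborel) + 3 * (\<integral>\<^sup>+x. J x \<partial>lborel)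
      \<le> 3 * ennreal (h\<^sup>2 * (mean_value_const * X * (X powr (c - 1))\<^sup>2 * A))
        + 3 * ennreal (mean_value_const * X * ((3 * X) powr c)\<^sup>2 * B)
        + 3 * ennreal (mean_value_const * X * ((3 * X) powr c)\<^sup>2 * B)"
    by (intro add_mono mult_left_mono I_le J_le) auto
  also have "\<dots> = ennreal (3 * mean_value_const * X * (h\<^sup>2 * (X powr (c - 1))\<^sup>2 * A + 2 * ((3 * X) powr c)\<^sup>2 * B))"
  proof -
    have e3: "(3::ennreal) * ennreal u = ennreal (3 * u)" for u :: real
      by (simp add: ennreal_mult'[of 3])
    have "mean_value_const \<ge> 0" by (simp add: mean_value_const_def)
    thus ?thesis unfolding e3 using A(1) B(1) X
      by (subst ennreal_plus[symmetric], simp, simp)+ (simp add: algebra_simps)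
  qed
  finally show ?thesis .
qed

section \<open>Passing to the limit and the tail of the moment integral\<close>

text \<open>At x = 1 the power of x disappears, leaving the function of t whose Mellin integral
  against \<open>real_cpow x c t\<close> is the damped Perron integral.\<close>

definition line_weight :: "nat \<Rightarrow> real \<Rightarrow> real \<Rightarrow> real \<Rightarrow> complex" where
  "line_weight k \<tau> c t = smoothed_integrand k \<tau> 1 (Complex c t)"

lemma smoothed_integrand_eq_line_weight:
  assumes "x > 0"
  shows "smoothed_integrand k \<tau> x (Complex c t) = line_weight k \<tau> c t * real_cpow x c t"
  using assms by (simp add: line_weight_def smoothed_integrand_def real_cpow_eq_powr)

lemma
  assumes "\<tau> > 0" "1/2 \<le> c" "c < 1"
  shows integrable_line_weight: "integrable lborel (line_weight k \<tau> c)"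
    and integrable_line_weight_squared: "integrable lborel (\<lambda>t. (norm (line_weight k \<tau> c t))\<^sup>2)"
proof -
  show int: "integrable lborel (line_weight k \<tau> c)"
    unfolding line_weight_def by (rule integrable_vertical_integrand) (use assms in auto)
  obtain M where M: "M \<ge> 0" "\<And>s. 1/2 \<le> Re s \<Longrightarrow> Re s \<le> 2 \<Longrightarrow> 1 - c \<le> norm (s - 1) \<Longrightarrow>
      norm (smoothed_integrand k \<tau> 1 s) \<le> M * exp (- ((\<tau> / sqrt 2)\<^sup>2 * (Im s)\<^sup>2 / 2))"
    using norm_smoothed_integrand_le[of 1 \<tau> "1 - c" k] assms by auto
  have bound: "norm (line_weight k \<tau> c t) \<le> M" for t
  proof -
    have "norm (line_weight k \<tau> c t) \<le> M * exp (- ((\<tau> / sqrt 2)\<^sup>2 * t\<^sup>2 / 2))"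
      using M(2)[of "Complex c t"] abs_Re_le_cmod[of "Complex c t - 1"] assms
      by (simp add: line_weight_def)
    also have "\<dots> \<le> M * 1" using M(1) by (intro mult_left_mono) auto
    finally show ?thesis by simp
  qed
  have [measurable]: "line_weight k \<tau> c \<in> borel_measurable lborel" using int by simp
  show "integrable lborel (\<lambda>t. (norm (line_weight k \<tau> c t))\<^sup>2)"
  proof (rule Bochner_Integration.integrable_bound[OF integrable_mult_right[OF integrable_norm[OF int], of M]])
    show "AE t in lborel. norm ((norm (line_weight k \<tau> c t))\<^sup>2) \<le> norm (M * norm (line_weight k \<tau> c t))"
      using bound M(1) by (intro AE_I2) (auto simp: power2_eq_square intro!: mult_right_mono)
  qed measurable
qed

text \<open>The place where bounds become uniform in \<tau>: for \<tau> \<le> 1 and c < 1 the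
  damping factor has norm at most \<open>exp (1/2)\<close>. The first bound cancels
  \<open>1 / s\<close>, the second replaces \<open>norm s\<close> by the smaller
  \<bar>t\<bar>.\<close>

lemma norm_line_weight_le:
  assumes "0 < \<tau>" "\<tau> \<le> 1" "1/2 \<le> c" "c < 1"
  shows "(norm (line_weight k \<tau> c t * Complex c t))\<^sup>2 \<le> exp 1 * norm (zeta (Complex c t)) ^ (2 * k)"
    and "t \<noteq> 0 \<Longrightarrow> (norm (line_weight k \<tau> c t))\<^sup>2 \<le> exp 1 * (norm (zeta (Complex c t)) ^ (2 * k) / t\<^sup>2)"
proof -
  define s where "s = Complex c t"
  have ns: "norm s > 0" using assms by (auto simp: s_def complex_eq_iff)
  have "norm (exp (of_real (\<tau>\<^sup>2 / 2) * s\<^sup>2)) = exp (\<tau>\<^sup>2 * c\<^sup>2 / 2) * exp (- (\<tau>\<^sup>2 * t\<^sup>2 / 2))"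
    using norm_exp_vertical[of 0 c t \<tau>] by (simp add: s_def del: of_real_divide of_real_power)
  also have "\<dots> \<le> exp (1/2) * 1"
  proof (intro mult_mono)
    have "\<tau>\<^sup>2 * c\<^sup>2 \<le> 1 * 1" using assms by (intro mult_mono power_le_one) auto
    thus "exp (\<tau>\<^sup>2 * c\<^sup>2 / 2) \<le> exp (1/2)" by simp
  qed auto
  finally have e: "norm (exp (of_real (\<tau>\<^sup>2 / 2) * s\<^sup>2)) \<le> exp (1/2)" by simp
  have "norm (line_weight k \<tau> c t * s) = norm (zeta s) ^ k * norm (exp (of_real (\<tau>\<^sup>2 / 2) * s\<^sup>2))"
    using ns unfolding line_weight_def smoothed_integrand_def s_def[symmetric]
    by (simp add: norm_mult norm_divide norm_power del: of_real_divide of_real_power)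
  also have "\<dots> \<le> norm (zeta s) ^ k * exp (1/2)" using e by (intro mult_left_mono) auto
  finally have "(norm (line_weight k \<tau> c t * s))\<^sup>2 \<le> (norm (zeta s) ^ k * exp (1/2))\<^sup>2"
    by (intro power_mono) auto
  also have "\<dots> = exp 1 * norm (zeta s) ^ (2 * k)"
    by (simp add: power_mult_distrib exp_double[symmetric] power_mult[symmetric] mult.commute)
  finally show 1: "(norm (line_weight k \<tau> c t * Complex c t))\<^sup>2 \<le> exp 1 * norm (zeta (Complex c t)) ^ (2 * k)"
    by (simp only: s_def)
  assume t: "t \<noteq> 0"
  have "t\<^sup>2 \<le> (norm s)\<^sup>2"
    by (simp add: s_def cmod_power2)
  hence "(norm (line_weight k \<tau> c t))\<^sup>2 * t\<^sup>2 \<le> (norm (line_weight k \<tau> c t))\<^sup>2 * (norm s)\<^sup>2"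
    by (intro mult_left_mono) auto
  also have "\<dots> = (norm (line_weight k \<tau> c t * s))\<^sup>2" by (simp add: norm_mult power_mult_distrib)
  also have "\<dots> \<le> exp 1 * norm (zeta s) ^ (2 * k)" using 1 by (simp only: s_def)
  finally show "(norm (line_weight k \<tau> c t))\<^sup>2 \<le> exp 1 * (norm (zeta (Complex c t)) ^ (2 * k) / t\<^sup>2)"
    using t by (simp add: s_def pos_le_divide_eq)
qed

text \<open>Convergence of the damped integrals is available whenever neither x nor x + h is an
  integer. The exceptional x form a countable set, so a bound uniform in \<tau> survives the
  limit.\<close>

lemma Delta_mean_square_le:
  assumes X: "X > 0" and h: "h > 0" and c: "1/2 \<le> c" "c < 1"
    and R: "R \<ge> 0" "\<And>\<tau>. 0 < \<tau> \<Longrightarrow> \<tau> \<le> 1 \<Longrightarrow>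
      (\<integral>\<^sup>+x. ennreal (indicator {X..2 * X} x *
        (norm ((LINT t|lborel. line_weight k \<tau> c t * real_cpow (x + h) c t)
          - (LINT t|lborel. line_weight k \<tau> c t * real_cpow x c t)))\<^sup>2) \<partial>lborel) \<le> ennreal R"
  shows "integral {X..2 * X} (\<lambda>x. (Delta k (x + h) - Delta k x)\<^sup>2) \<le> R"
proof (cases "(\<lambda>x. (Delta k (x + h) - Delta k x)\<^sup>2) integrable_on {X..2 * X}")
  \<comment> \<open>Without integrability the value of \<open>integral\<close> is 0 by convention,
    and R \<ge> 0 suffices.\<close>
  case False
  thus ?thesis using R(1) by (simp add: not_integrable_integral)
next
  case True
  define \<tau> where "\<tau> j = 1 / real (Suc j)" for j
  have \<tau>: "\<tau> j > 0" "\<tau> j \<le> 1" for j by (auto simp: \<tau>_def)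
  have \<tau>_lim: "\<tau> \<longlonglongrightarrow> 0" unfolding \<tau>_def by (rule LIMSEQ_Suc[OF lim_1_over_n])
  define S where "S j x = (LINT t|lborel. line_weight k (\<tau> j) c t * real_cpow x c t)" for j x
  have [measurable]: "line_weight k (\<tau> j) c \<in> borel_measurable lborel" for j
    using integrable_line_weight[OF \<tau>(1) c] by simp
  have [measurable]: "S j \<in> borel_measurable borel" for j unfolding S_def by measurable
  define u where "u j x = ennreal (indicator {X..2 * X} x * (Re (S j (x + h)) / (2 * pi) - Re (S j x) / (2 * pi))\<^sup>2)" for j x
  have u_meas: "u j \<in> borel_measurable lborel" for j unfolding u_def by measurable
  have u_le: "(\<integral>\<^sup>+x. u j x \<partial>lborel) \<le> ennreal R" for j
  proof -
    have "(\<integral>\<^sup>+x. u j x \<partial>lborel) \<le> (\<integral>\<^sup>+x. ennreal (indicator {X..2 * X} x * (norm (S j (x + h) - S j x))\<^sup>2) \<partial>lborel)"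
    proof (intro nn_integral_mono)
      fix x
      define a where "a = norm (S j (x + h) - S j x)"
      have "\<bar>Re (S j (x + h)) / (2 * pi) - Re (S j x) / (2 * pi)\<bar> = \<bar>Re (S j (x + h) - S j x)\<bar> / (2 * pi)"
        by (simp add: diff_divide_distrib[symmetric])
      also have "\<dots> \<le> a / (2 * pi)"
        unfolding a_def by (intro divide_right_mono abs_Re_le_cmod) auto
      \<comment> \<open>The gain of \<open>1 / (2 * pi)\<close> from Perron's formula is simply
        discarded.\<close>
      also have "\<dots> \<le> a / 1"
        using pi_ge_two by (intro divide_left_mono) (auto simp: a_def)
      finally have "(Re (S j (x + h)) / (2 * pi) - Re (S j x) / (2 * pi))\<^sup>2 \<le> a\<^sup>2"
        by (intro abs_le_square_iff[THEN iffD1]) (auto simp: a_def)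
      thus "u j x \<le> ennreal (indicator {X..2 * X} x * (norm (S j (x + h) - S j x))\<^sup>2)"
        unfolding u_def a_def by (intro ennreal_leI mult_left_mono) auto
    qed
    also have "\<dots> \<le> ennreal R" unfolding S_def by (rule R(2)[OF \<tau>])
    finally show ?thesis .
  qed
  define N where "N = range real \<union> (\<lambda>n. real n - h) ` UNIV"
  have "countable N" unfolding N_def by (intro countable_Un countable_image) auto
  hence "AE x in lborel. x \<notin> N"
    by (intro AE_not_in countable_imp_null_set_lborel)
  moreover have lim: "ennreal ((Delta k (x + h) - Delta k x)\<^sup>2) * indicator {X..2 * X} x = liminf (\<lambda>j. u j x)"
    if "x \<notin> N" for x
  proof (cases "x \<in> {X..2 * X}")
    case True
    hence pos: "x > 0" "x + h > 0" using X h by auto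
    have ne: "x \<noteq> real n" "x + h \<noteq> real n" for n
    proof -
      have "x \<noteq> real n - h" using that by (auto simp: N_def)
      thus "x + h \<noteq> real n" by linarith
    qed (use that in \<open>auto simp: N_def\<close>)
    have lims: "(\<lambda>j. Re (S j y) / (2 * pi)) \<longlonglongrightarrow> Delta k y" if "y > 0" "\<And>n. y \<noteq> real n" for y
      using smoothed_Delta_tendsto[OF that \<tau>(1) \<tau>_lim c, of k]
      unfolding S_def smoothed_integrand_eq_line_weight[OF that(1)] .
    have "(\<lambda>j. ennreal ((Re (S j (x + h)) / (2 * pi) - Re (S j x) / (2 * pi))\<^sup>2))
        \<longlonglongrightarrow> ennreal ((Delta k (x + h) - Delta k x)\<^sup>2)"
      by (intro tendsto_ennrealI tendsto_power tendsto_diff lims pos ne)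
    hence "(\<lambda>j. u j x) \<longlonglongrightarrow> ennreal ((Delta k (x + h) - Delta k x)\<^sup>2)"
      unfolding u_def using True by simp
    thus ?thesis using True by (simp add: lim_imp_Liminf)
  next
    case False
    thus ?thesis by (simp add: u_def Liminf_const)
  qed
  ultimately have "AE x in lborel. ennreal ((Delta k (x + h) - Delta k x)\<^sup>2) * indicator {X..2 * X} x = liminf (\<lambda>j. u j x)"
    by (auto elim: eventually_mono)
  hence "(\<integral>\<^sup>+x. ennreal ((Delta k (x + h) - Delta k x)\<^sup>2) * indicator {X..2 * X} x \<partial>lborel)
      = (\<integral>\<^sup>+x. liminf (\<lambda>j. u j x) \<partial>lborel)"
    by (rule nn_integral_cong_AE)
  also have "\<dots> \<le> liminf (\<lambda>j. \<integral>\<^sup>+x. u j x \<partial>lborel)"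
    by (rule nn_integral_liminf[OF u_meas])
  also have "\<dots> \<le> liminf (\<lambda>j. ennreal R)"
    by (intro Liminf_mono always_eventually allI u_le)
  also have "\<dots> = ennreal R" by (simp add: Liminf_const)
  finally have "ennreal (integral {X..2 * X} (\<lambda>x. (Delta k (x + h) - Delta k x)\<^sup>2)) \<le> ennreal R"
    using nn_integral_has_integral_lebesgue'[OF _ integrable_integral[OF True]] by simp
  thus ?thesis using R(1) by (simp add: ennreal_le_iff)
qed

section \<open>Moment integrals: reduction to t >= 0 and the weighted tail\<close>

lemma nn_integral_even_le:
  fixes u :: "real \<Rightarrow> ennreal"
  assumes [measurable]: "u \<in> borel_measurable borel" and even: "\<And>t. u (- t) = u t"
  shows "(\<integral>\<^sup>+t. u t \<partial>lborel) \<le> 2 * (\<integral>\<^sup>+t. indicator {0..} t * u t \<partial>lborel)"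
proof -
  have "(\<integral>\<^sup>+t. u t \<partial>lborel) \<le> (\<integral>\<^sup>+t. indicator {0..} t * u t + indicator {0..} (- t) * u (- t) \<partial>lborel)"
    by (intro nn_integral_mono) (auto simp: even split: split_indicator)
  also have "\<dots> = (\<integral>\<^sup>+t. indicator {0..} t * u t \<partial>lborel) + (\<integral>\<^sup>+t. indicator {0..} (- t) * u (- t) \<partial>lborel)"
    by (rule nn_integral_add) measurable
  also have "(\<integral>\<^sup>+t. indicator {0..} (- t) * u (- t) \<partial>lborel) = (\<integral>\<^sup>+t. indicator {0..} t * u t \<partial>lborel)"
    using nn_integral_real_affine[of "\<lambda>t. indicator {0..} t * u t" "-1" 0] by simp
  finally show ?thesis by (simp add: mult_2)
qed

lemma nn_integral_powr_atLeast:
  fixes a T :: real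
  assumes "a > 0" "T > 0"
  shows "(\<integral>\<^sup>+y. ennreal (y powr (- a - 1)) * indicator {T..} y \<partial>lborel) = ennreal (T powr (- a) / a)"
proof -
  have "(\<integral>\<^sup>+y. ennreal (y powr (- a - 1)) * indicator {T..} y \<partial>lborel) = ennreal (0 - (- (T powr (- a) / a)))"
  proof (rule nn_integral_FTC_atLeast)
    show "((\<lambda>y. - (y powr (- a) / a)) has_real_derivative y powr (- a - 1)) (at y)" if "T \<le> y" for y
      using assms that by (auto intro!: derivative_eq_intros)
    have "((\<lambda>y. y powr (- a)) \<longlongrightarrow> 0) at_top"
      using assms by (intro tendsto_neg_powr filterlim_ident) auto
    from tendsto_minus[OF tendsto_divide[OF this tendsto_const[of a]]]
    show "((\<lambda>y. - (y powr (- a) / a)) \<longlongrightarrow> 0) at_top" using assms by simp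
  qed auto
  thus ?thesis by simp
qed

lemma nn_integral_atLeastAtMost_continuous:
  fixes \<phi> :: "real \<Rightarrow> real"
  assumes "continuous_on UNIV \<phi>" "\<And>t. \<phi> t \<ge> 0"
  shows "(\<integral>\<^sup>+t. indicator {a..b} t * ennreal (\<phi> t) \<partial>lborel) = ennreal (integral {a..b} \<phi>)"
proof -
  have "\<phi> integrable_on {a..b}"
    using assms(1) by (intro integrable_continuous_interval) (auto intro: continuous_on_subset)
  from nn_integral_has_integral_lebesgue'[OF _ integrable_integral[OF this]] assms(2)
  show ?thesis by (simp add: mult.commute)
qed

text \<open>Partial summation in the form of Tonelli's theorem, writing \<open>1 / t\<^sup>2\<close> as the integral of \<open>2 / y ^ 3\<close> over \<open>y \<ge> t\<close>.\<close>
lemma nn_integral_tail_le: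
  fixes \<phi> :: "real \<Rightarrow> real"
  assumes cont: "continuous_on UNIV \<phi>" and nonneg: "\<And>t. \<phi> t \<ge> 0" and T: "T > 0"
    and C: "C \<ge> 0" and \<eta>: "\<eta> < 1"
    and growth: "\<And>y. y \<ge> T \<Longrightarrow> integral {0..y} \<phi> \<le> C * y powr (1 + \<eta>)"
  shows "(\<integral>\<^sup>+t. indicator {T..} t * ennreal (\<phi> t / t\<^sup>2) \<partial>lborel) \<le> ennreal (2 * C / (1 - \<eta>) * T powr (\<eta> - 1))"
proof -
  have [measurable]: "\<phi> \<in> borel_measurable borel" using cont by (rule borel_measurable_continuous_onI)
  have inv: "ennreal (1 / t\<^sup>2) = (\<integral>\<^sup>+y. ennreal 2 * (ennreal (y powr (-3)) * indicator {t..} y) \<partial>lborel)"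
    if "t > 0" for t :: real
  proof -
    have "(\<integral>\<^sup>+y. ennreal 2 * (ennreal (y powr (-3)) * indicator {t..} y) \<partial>lborel)
        = ennreal 2 * (\<integral>\<^sup>+y. ennreal (y powr (-3)) * indicator {t..} y \<partial>lborel)"
      by (rule nn_integral_cmult) measurable
    also have "(\<integral>\<^sup>+y. ennreal (y powr (-3)) * indicator {t..} y \<partial>lborel) = ennreal (t powr (-2) / 2)"
      using nn_integral_powr_atLeast[of 2 t] that by simp
    also have "ennreal 2 * ennreal (t powr (-2) / 2) = ennreal (t powr (-2))"
      by (subst ennreal_mult'[symmetric]) auto
    also have "t powr (-2) = 1 / t\<^sup>2" using that by (simp add: powr_minus_divide)
    finally show ?thesis ..
  qed
  have "(\<integral>\<^sup>+t. indicator {T..} t * ennreal (\<phi> t / t\<^sup>2) \<partial>lborel)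
      = (\<integral>\<^sup>+t. \<integral>\<^sup>+y. indicator {T..} t * ennreal (\<phi> t) * (ennreal 2 * (ennreal (y powr (-3)) * indicator {t..} y)) \<partial>lborel \<partial>lborel)"
  proof (intro nn_integral_cong)
    fix t
    have "(\<integral>\<^sup>+y. indicator {T..} t * ennreal (\<phi> t) * (ennreal 2 * (ennreal (y powr (-3)) * indicator {t..} y)) \<partial>lborel)
        = indicator {T..} t * ennreal (\<phi> t) * (\<integral>\<^sup>+y. ennreal 2 * (ennreal (y powr (-3)) * indicator {t..} y) \<partial>lborel)"
      by (rule nn_integral_cmult) measurable
    also have "\<dots> = indicator {T..} t * ennreal (\<phi> t / t\<^sup>2)"
    proof (cases "T \<le> t")
      case True
      hence "ennreal (\<phi> t) * ennreal (1 / t\<^sup>2) = ennreal (\<phi> t / t\<^sup>2)"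
        using nonneg by (subst ennreal_mult'[symmetric]) auto
      thus ?thesis using True T by (subst inv[symmetric]) auto
    qed simp
    finally show "indicator {T..} t * ennreal (\<phi> t / t\<^sup>2)
        = (\<integral>\<^sup>+y. indicator {T..} t * ennreal (\<phi> t) * (ennreal 2 * (ennreal (y powr (-3)) * indicator {t..} y)) \<partial>lborel)" ..
  qed
  \<comment> \<open>The region T \<le> t \<le> y is enlarged to 0 \<le> t \<le> y with y \<ge> T.
    The inner integral over t becomes the full moment up to y, to which the growth hypothesis
    applies.\<close>
  also have "\<dots> \<le> (\<integral>\<^sup>+t. \<integral>\<^sup>+y. ennreal 2 * ennreal (y powr (-3)) * indicator {T..} y * (indicator {p. 0 \<le> snd p \<and> snd p \<le> fst p} (y, t) * ennreal (\<phi> t)) \<partial>lborel \<partial>lborel)"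
    using T by (intro nn_integral_mono) (auto simp: mult_ac split: split_indicator)
  also have "\<dots> = (\<integral>\<^sup>+y. \<integral>\<^sup>+t. ennreal 2 * ennreal (y powr (-3)) * indicator {T..} y * (indicator {p. 0 \<le> snd p \<and> snd p \<le> fst p} (y, t) * ennreal (\<phi> t)) \<partial>lborel \<partial>lborel)"
    by (rule lborel_pair.Fubini') measurable
  also have "\<dots> \<le> (\<integral>\<^sup>+y. ennreal (2 * C) * (ennreal (y powr (- (1 - \<eta>) - 1)) * indicator {T..} y) \<partial>lborel)"
  proof (intro nn_integral_mono)
    fix y
    have "(\<integral>\<^sup>+t. ennreal 2 * ennreal (y powr (-3)) * indicator {T..} y * (indicator {p. 0 \<le> snd p \<and> snd p \<le> fst p} (y, t) * ennreal (\<phi> t)) \<partial>lborel)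
        = (\<integral>\<^sup>+t. ennreal 2 * ennreal (y powr (-3)) * indicator {T..} y * (indicator {0..y} t * ennreal (\<phi> t)) \<partial>lborel)"
      by (intro nn_integral_cong) (auto split: split_indicator)
    also have "\<dots> = ennreal 2 * ennreal (y powr (-3)) * indicator {T..} y * (\<integral>\<^sup>+t. indicator {0..y} t * ennreal (\<phi> t) \<partial>lborel)"
      by (rule nn_integral_cmult) measurable
    also have "(\<integral>\<^sup>+t. indicator {0..y} t * ennreal (\<phi> t) \<partial>lborel) = ennreal (integral {0..y} \<phi>)"
      by (rule nn_integral_atLeastAtMost_continuous[OF cont nonneg])
    also have "ennreal 2 * ennreal (y powr (-3)) * indicator {T..} y * ennreal (integral {0..y} \<phi>)
        \<le> ennreal (2 * C) * (ennreal (y powr (- (1 - \<eta>) - 1)) * indicator {T..} y)"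
    proof (cases "T \<le> y")
      case True
      have "ennreal 2 * ennreal (y powr (-3)) * ennreal (integral {0..y} \<phi>)
          \<le> ennreal 2 * ennreal (y powr (-3)) * ennreal (C * y powr (1 + \<eta>))"
        by (intro mult_left_mono ennreal_leI growth True) auto
      also have "\<dots> = ennreal (2 * y powr (-3)) * ennreal (C * y powr (1 + \<eta>))"
        by (subst ennreal_mult) auto
      also have "\<dots> = ennreal (2 * y powr (-3) * (C * y powr (1 + \<eta>)))"
        using C by (subst ennreal_mult) auto
      \<comment> \<open>The exponents add up to \<eta> - 2, written as -(1 - \<eta>) - 1 to match
        \<open>nn_integral_powr_atLeast\<close>; convergence at infinity is the condition \<eta> <
        1.\<close>
      also have "2 * y powr (-3) * (C * y powr (1 + \<eta>)) = 2 * C * (y powr (-3) * y powr (1 + \<eta>))"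
        by (simp only: mult_ac)
      also have "y powr (-3) * y powr (1 + \<eta>) = y powr (- (1 - \<eta>) - 1)"
        by (simp add: powr_add[symmetric])
      also have "ennreal (2 * C * y powr (- (1 - \<eta>) - 1)) = ennreal (2 * C) * ennreal (y powr (- (1 - \<eta>) - 1))"
        using C by (intro ennreal_mult) auto
      finally show ?thesis using True by simp
    qed simp
    finally show "(\<integral>\<^sup>+t. ennreal 2 * ennreal (y powr (-3)) * indicator {T..} y * (indicator {p. 0 \<le> snd p \<and> snd p \<le> fst p} (y, t) * ennreal (\<phi> t)) \<partial>lborel)
        \<le> ennreal (2 * C) * (ennreal (y powr (- (1 - \<eta>) - 1)) * indicator {T..} y)" .
  qed
  also have "\<dots> = ennreal (2 * C) * (\<integral>\<^sup>+y. ennreal (y powr (- (1 - \<eta>) - 1)) * indicator {T..} y \<partial>lborel)"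
    by (rule nn_integral_cmult) measurable
  also have "\<dots> = ennreal (2 * C) * ennreal (T powr (- (1 - \<eta>)) / (1 - \<eta>))"
    using \<eta> T by (subst nn_integral_powr_atLeast) auto
  also have "\<dots> = ennreal (2 * C / (1 - \<eta>) * T powr (\<eta> - 1))"
    using C \<eta> by (subst ennreal_mult'[symmetric]) auto
  finally show ?thesis .
qed

section \<open>The mean square of differences of the error term\<close>

text \<open>Turns the moment hypothesis into the two inputs A and B of
  \<open>difference_mean_square\<close>. Evenness in t doubles the half-line integrals, and the
  squared damping factor contributes \<open>exp 1\<close>.\<close>

lemma weight_energy_bounds:
  assumes \<tau>: "0 < \<tau>" "\<tau> \<le> 1" and c: "1/2 \<le> c" "c < 1" and T: "T > 0" and C: "C \<ge> 0" and \<eta>: "\<eta> < 1"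
    and growth: "\<And>y. y \<ge> T \<Longrightarrow>
      integral {0..y} (\<lambda>t. norm (zeta (Complex c t)) ^ (2 * k)) \<le> C * y powr (1 + \<eta>)"
  shows "(\<integral>\<^sup>+t. ennreal (indicator {-T..T} t * (norm (line_weight k \<tau> c t * Complex c t))\<^sup>2) \<partial>lborel)
      \<le> ennreal (2 * exp 1 * C * T powr (1 + \<eta>))"
    and "(\<integral>\<^sup>+t. ennreal (indicator (- {-T..T}) t * (norm (line_weight k \<tau> c t))\<^sup>2) \<partial>lborel)
      \<le> ennreal (4 * exp 1 * C / (1 - \<eta>) * T powr (\<eta> - 1))"
proof -
  define \<phi> where "\<phi> t = norm (zeta (Complex c t)) ^ (2 * k)" for t
  have nonneg: "\<phi> t \<ge> 0" for t by (simp add: \<phi>_def)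
  have ne: "Complex c t \<in> punctured_halfplane 0" for t using c by (auto simp: complex_eq_iff)
  have cont: "continuous_on UNIV \<phi>"
    unfolding \<phi>_def
    by (intro continuous_intros continuous_on_compose2[OF holomorphic_on_imp_continuous_on[OF
          holomorphic_zeta] continuous_on_Complex]) (use ne in auto)
  have [measurable]: "\<phi> \<in> borel_measurable borel" using cont by (rule borel_measurable_continuous_onI)
  have even: "\<phi> (- t) = \<phi> t" for t
  proof -
    have "Complex c (- t) = cnj (Complex c t)" by (simp add: complex_eq_iff)
    thus ?thesis using zeta_cnj[of "Complex c t"] ne[of t] by (simp add: \<phi>_def)
  qed
  have "(\<integral>\<^sup>+t. ennreal (indicator {-T..T} t * (norm (line_weight k \<tau> c t * Complex c t))\<^sup>2) \<partial>lborel)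
      \<le> (\<integral>\<^sup>+t. ennreal (exp 1) * (indicator {-T..T} t * ennreal (\<phi> t)) \<partial>lborel)"
    using norm_line_weight_le(1)[OF \<tau> c]
    by (intro nn_integral_mono) (auto simp: \<phi>_def ennreal_mult'[symmetric] intro!: ennreal_leI split: split_indicator)
  also have "\<dots> = ennreal (exp 1) * (\<integral>\<^sup>+t. indicator {-T..T} t * ennreal (\<phi> t) \<partial>lborel)"
    by (rule nn_integral_cmult) measurable
  also have "\<dots> \<le> ennreal (exp 1) * (2 * (\<integral>\<^sup>+t. indicator {0..} t * (indicator {-T..T} t * ennreal (\<phi> t)) \<partial>lborel))"
    by (intro mult_left_mono nn_integral_even_le) (auto simp: even split: split_indicator)
  also have "(\<integral>\<^sup>+t. indicator {0..} t * (indicator {-T..T} t * ennreal (\<phi> t)) \<partial>lborel)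
      = (\<integral>\<^sup>+t. indicator {0..T} t * ennreal (\<phi> t) \<partial>lborel)"
    using T by (intro nn_integral_cong) (auto split: split_indicator)
  also have "\<dots> = ennreal (integral {0..T} \<phi>)"
    by (rule nn_integral_atLeastAtMost_continuous[OF cont nonneg])
  also have "ennreal (exp 1) * (2 * ennreal (integral {0..T} \<phi>)) \<le> ennreal (exp 1) * (ennreal 2 * ennreal (C * T powr (1 + \<eta>)))"
    using growth[of T] unfolding \<phi>_def[symmetric] by (intro mult_left_mono mult_mono ennreal_leI) auto
  also have "\<dots> = ennreal (exp 1 * (2 * (C * T powr (1 + \<eta>))))"
    using C by (subst ennreal_mult, simp, simp)+ (rule refl)
  also have "exp 1 * (2 * (C * T powr (1 + \<eta>))) = 2 * exp 1 * C * T powr (1 + \<eta>)" by simp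
  finally show "(\<integral>\<^sup>+t. ennreal (indicator {-T..T} t * (norm (line_weight k \<tau> c t * Complex c t))\<^sup>2) \<partial>lborel)
      \<le> ennreal (2 * exp 1 * C * T powr (1 + \<eta>))" .
  \<comment> \<open>The endpoints are added on the right-hand side so that the part with t \<ge> 0
    is exactly \<open>{T..}\<close>, the range of \<open>nn_integral_tail_le\<close>.\<close>
  have "(\<integral>\<^sup>+t. ennreal (indicator (- {-T..T}) t * (norm (line_weight k \<tau> c t))\<^sup>2) \<partial>lborel)
      \<le> (\<integral>\<^sup>+t. ennreal (exp 1) * (indicator (- {-T<..<T}) t * ennreal (\<phi> t / t\<^sup>2)) \<partial>lborel)"
  proof (intro nn_integral_mono)
    fix t
    show "ennreal (indicator (- {-T..T}) t * (norm (line_weight k \<tau> c t))\<^sup>2)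
        \<le> ennreal (exp 1) * (indicator (- {-T<..<T}) t * ennreal (\<phi> t / t\<^sup>2))"
    proof (cases "t \<in> {-T..T}")
      case False
      hence t: "t \<noteq> 0" "t \<notin> {-T<..<T}" using T by auto
      have "ennreal ((norm (line_weight k \<tau> c t))\<^sup>2) \<le> ennreal (exp 1 * (\<phi> t / t\<^sup>2))"
        unfolding \<phi>_def by (intro ennreal_leI norm_line_weight_le(2)[OF \<tau> c t(1)])
      also have "\<dots> = ennreal (exp 1) * ennreal (\<phi> t / t\<^sup>2)"
        by (rule ennreal_mult) (auto simp: nonneg)
      finally show ?thesis using False t by simp
    qed simp
  qed
  also have "\<dots> = ennreal (exp 1) * (\<integral>\<^sup>+t. indicator (- {-T<..<T}) t * ennreal (\<phi> t / t\<^sup>2) \<partial>lborel)"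
    by (rule nn_integral_cmult) measurable
  also have "\<dots> \<le> ennreal (exp 1) * (2 * (\<integral>\<^sup>+t. indicator {0..} t * (indicator (- {-T<..<T}) t * ennreal (\<phi> t / t\<^sup>2)) \<partial>lborel))"
    by (intro mult_left_mono nn_integral_even_le) (auto simp: even split: split_indicator)
  also have "(\<integral>\<^sup>+t. indicator {0..} t * (indicator (- {-T<..<T}) t * ennreal (\<phi> t / t\<^sup>2)) \<partial>lborel)
      = (\<integral>\<^sup>+t. indicator {T..} t * ennreal (\<phi> t / t\<^sup>2) \<partial>lborel)"
    using T by (intro nn_integral_cong) (auto split: split_indicator)
  also have "ennreal (exp 1) * (2 * (\<integral>\<^sup>+t. indicator {T..} t * ennreal (\<phi> t / t\<^sup>2) \<partial>lborel))
      \<le> ennreal (exp 1) * (ennreal 2 * ennreal (2 * C / (1 - \<eta>) * T powr (\<eta> - 1)))"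
    using nn_integral_tail_le[OF cont nonneg T C \<eta>] growth unfolding \<phi>_def[symmetric]
    by (intro mult_left_mono mult_mono) auto
  also have "\<dots> = ennreal (exp 1 * (2 * (2 * C / (1 - \<eta>) * T powr (\<eta> - 1))))"
    using C \<eta> by (subst ennreal_mult, simp, simp)+ (rule refl)
  also have "exp 1 * (2 * (2 * C / (1 - \<eta>) * T powr (\<eta> - 1))) = 4 * exp 1 * C / (1 - \<eta>) * T powr (\<eta> - 1)" by simp
  finally show "(\<integral>\<^sup>+t. ennreal (indicator (- {-T..T}) t * (norm (line_weight k \<tau> c t))\<^sup>2) \<partial>lborel)
      \<le> ennreal (4 * exp 1 * C / (1 - \<eta>) * T powr (\<eta> - 1))" .
qed

text \<open>With T = X / h, both
  \<open>X * h\<^sup>2 * X powr (2 * c - 2) * T powr (1 + \<eta>)\<close> and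
  \<open>X * X powr (2 * c) * T powr (\<eta> - 1)\<close> equal
  \<open>h * X powr (2 * c) * T powr \<eta>\<close>. Since h \<ge> 1, T is at most X.\<close>

lemma Delta_difference_mean_square:
  assumes c: "1/2 \<le> c" "c < 1" and C: "C \<ge> 0" and \<eta>: "0 < \<eta>" "\<eta> < 1"
    and X: "X > 0" and h: "1 \<le> h" "h \<le> X"
    and growth: "\<And>y. y \<ge> X / h \<Longrightarrow>
      integral {0..y} (\<lambda>t. norm (zeta (Complex c t)) ^ (2 * k)) \<le> C * y powr (1 + \<eta>)"
  shows "integral {X..2 * X} (\<lambda>x. (Delta k (x + h) - Delta k x)\<^sup>2)
     \<le> 3 * mean_value_const * (2 * exp 1 * C + 72 * exp 1 * C / (1 - \<eta>)) * (h * X powr (2 * c + \<eta>))"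
proof -
  define T where "T = X / h"
  have T: "T > 0" using X h by (simp add: T_def)
  have hX: "h = X / T" using X h by (simp add: T_def)
  define A where "A = 2 * exp 1 * C * T powr (1 + \<eta>)"
  define B where "B = 4 * exp 1 * C / (1 - \<eta>) * T powr (\<eta> - 1)"
  define R where "R = 3 * mean_value_const * X * (h\<^sup>2 * (X powr (c - 1))\<^sup>2 * A + 2 * ((3 * X) powr c)\<^sup>2 * B)"
  have AB: "A \<ge> 0" "B \<ge> 0" using C \<eta> by (auto simp: A_def B_def)
  have mv: "mean_value_const \<ge> 0" by (simp add: mean_value_const_def)
  have R: "R \<ge> 0" unfolding R_def using AB mv X by (intro mult_nonneg_nonneg add_nonneg_nonneg) auto
  have "integral {X..2 * X} (\<lambda>x. (Delta k (x + h) - Delta k x)\<^sup>2) \<le> R"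
  proof (rule Delta_mean_square_le[OF X _ c R])
    fix \<tau> :: real assume \<tau>: "0 < \<tau>" "\<tau> \<le> 1"
    have "integral {0..y} (\<lambda>t. norm (zeta (Complex c t)) ^ (2 * k)) \<le> C * y powr (1 + \<eta>)"
      if "y \<ge> T" for y using growth that by (simp add: T_def)
    note energy = weight_energy_bounds[OF \<tau> c T C \<eta>(2) this, folded A_def B_def]
    show "(\<integral>\<^sup>+x. ennreal (indicator {X..2 * X} x *
        (norm ((LINT t|lborel. line_weight k \<tau> c t * real_cpow (x + h) c t)
          - (LINT t|lborel. line_weight k \<tau> c t * real_cpow x c t)))\<^sup>2) \<partial>lborel) \<le> ennreal R"
      unfolding R_def
      by (rule difference_mean_square[OF integrable_line_weight[OF \<tau>(1) c]
            integrable_line_weight_squared[OF \<tau>(1) c] _ _ X _ _ T AB(1) energy(1) AB(2) energy(2)])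
         (use c h in auto)
  qed (use h in auto)
  also have "R = 3 * mean_value_const * (2 * exp 1 * C * (X * h\<^sup>2 * (X powr (c - 1))\<^sup>2 * T powr (1 + \<eta>))
      + 8 * exp 1 * C / (1 - \<eta>) * (X * ((3 * X) powr c)\<^sup>2 * T powr (\<eta> - 1)))"
    by (simp add: R_def A_def B_def algebra_simps)
  \<comment> \<open>The 9 bounds the square of \<open>3 powr c\<close>, as c < 1; together with the
    8 it gives the 72 in the statement.\<close>
  also have "\<dots> \<le> 3 * mean_value_const * (2 * exp 1 * C * (h * X powr (2 * c + \<eta>))
      + 8 * exp 1 * C / (1 - \<eta>) * (9 * (h * X powr (2 * c + \<eta>))))"
  proof (intro mult_left_mono add_mono)
    have "T \<le> X" using X h by (simp add: T_def divide_le_eq)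
    hence T\<eta>: "T powr \<eta> \<le> X powr \<eta>" using T \<eta> by (intro powr_mono2) auto
    have eq1: "X * h\<^sup>2 * (X powr (c - 1))\<^sup>2 * T powr (1 + \<eta>) = h * X powr (2 * c) * T powr \<eta>"
    proof -
      have "(X powr (c - 1))\<^sup>2 = X powr (2 * c) / X\<^sup>2"
        using X by (simp add: powr_power[symmetric] powr_diff power2_eq_square powr_add[symmetric])
      moreover have "T powr (1 + \<eta>) = X / h * T powr \<eta>"
        using T X h by (simp add: powr_add T_def)
      ultimately show ?thesis using X h by (simp add: power2_eq_square)
    qed
    have eq2: "X * (X powr c)\<^sup>2 * T powr (\<eta> - 1) = h * X powr (2 * c) * T powr \<eta>"
    proof -
      have "(X powr c)\<^sup>2 = X powr (2 * c)"
        by (simp add: power2_eq_square powr_add[symmetric])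
      moreover have "T powr (\<eta> - 1) = T powr \<eta> * (h / X)"
        using T X h by (simp add: powr_diff T_def)
      ultimately show ?thesis using X by simp
    qed
    have le: "h * X powr (2 * c) * T powr \<eta> \<le> h * X powr (2 * c + \<eta>)"
      using T\<eta> h by (simp add: powr_add mult_left_mono mult.assoc)
    show "X * h\<^sup>2 * (X powr (c - 1))\<^sup>2 * T powr (1 + \<eta>) \<le> h * X powr (2 * c + \<eta>)"
      unfolding eq1 by (rule le)
    have "3 powr c \<le> 3 powr (1::real)" using c by (intro powr_mono) auto
    hence "(3 powr c)\<^sup>2 \<le> 3\<^sup>2" by (intro power_mono) auto
    hence "(3 powr c)\<^sup>2 * (X * (X powr c)\<^sup>2 * T powr (\<eta> - 1)) \<le> 9 * (X * (X powr c)\<^sup>2 * T powr (\<eta> - 1))"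
      using X by (intro mult_right_mono) auto
    moreover have "X * ((3 * X) powr c)\<^sup>2 * T powr (\<eta> - 1) = (3 powr c)\<^sup>2 * (X * (X powr c)\<^sup>2 * T powr (\<eta> - 1))"
      using X by (simp add: powr_mult power_mult_distrib)
    ultimately show "X * ((3 * X) powr c)\<^sup>2 * T powr (\<eta> - 1) \<le> 9 * (h * X powr (2 * c + \<eta>))"
      using le unfolding eq2 by linarith
  qed (use C \<eta> mv in auto)
  also have "\<dots> = 3 * mean_value_const * (2 * exp 1 * C + 72 * exp 1 * C / (1 - \<eta>)) * (h * X powr (2 * c + \<eta>))"
    by (simp add: algebra_simps)
  finally show ?thesis .
qed

text \<open>The order of quantifiers matters: K comes from the moment bound alone, while \<epsilon>
  only decides how large X must be for \<open>X / h \<ge> X powr \<epsilon>\<close> to pass the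
  threshold of that bound. This is what keeps C in (ii) independent of \<epsilon>.\<close>

lemma Delta_difference_mean_square_eventually:
  assumes c: "1/2 \<le> c" "c < 1" and \<eta>: "0 < \<eta>" "\<eta> < 1"
    and moment: "(\<lambda>T. integral {0..T} (\<lambda>t. norm (zeta (Complex c t)) ^ (2 * k)))
        \<in> O[at_top](\<lambda>T. T powr (1 + \<eta>))"
  shows "\<exists>K\<ge>0. \<forall>\<epsilon>>0. \<forall>\<^sub>F X::real in at_top. \<forall>h::real. 1 \<le> h \<and> h \<le> X powr (1 - \<epsilon>) \<longrightarrow>
     integral {X..2 * X} (\<lambda>x. (Delta k (x + h) - Delta k x)\<^sup>2) \<le> K * (h * X powr (2 * c + \<eta>))"
proof -
  from landau_o.bigE[OF moment] obtain C where C: "C > 0"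
    "\<forall>\<^sub>F T in at_top. norm (integral {0..T} (\<lambda>t. norm (zeta (Complex c t)) ^ (2 * k))) \<le> C * norm (T powr (1 + \<eta>))"
    by blast
  then obtain T0 where T0': "\<forall>T\<ge>T0. norm (integral {0..T} (\<lambda>t. norm (zeta (Complex c t)) ^ (2 * k)))
      \<le> C * norm (T powr (1 + \<eta>))"
    unfolding eventually_at_top_linorder by blast
  have T0: "integral {0..T} (\<lambda>t. norm (zeta (Complex c t)) ^ (2 * k)) \<le> C * T powr (1 + \<eta>)"
    if "T \<ge> T0" for T
    using T0'[rule_format, OF that] by simp
  define K where "K = 3 * mean_value_const * (2 * exp 1 * C + 72 * exp 1 * C / (1 - \<eta>))"
  have "\<forall>\<^sub>F X::real in at_top. \<forall>h::real. 1 \<le> h \<and> h \<le> X powr (1 - \<epsilon>) \<longrightarrow>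
     integral {X..2 * X} (\<lambda>x. (Delta k (x + h) - Delta k x)\<^sup>2) \<le> K * (h * X powr (2 * c + \<eta>))"
    if \<epsilon>: "\<epsilon> > 0" for \<epsilon> :: real
  proof -
    have "filterlim (\<lambda>X::real. X powr \<epsilon>) at_top at_top" using \<epsilon> by real_asymp
    hence "\<forall>\<^sub>F X::real in at_top. T0 \<le> X powr \<epsilon>" by (auto simp: filterlim_at_top)
    with eventually_ge_at_top[of 1] show ?thesis
    proof eventually_elim
      case (elim X)
      show ?case
      proof safe
        fix h assume h: "1 \<le> h" "h \<le> X powr (1 - \<epsilon>)"
        have "X powr (1 - \<epsilon>) \<le> X powr 1" using elim \<epsilon> by (intro powr_mono) auto
        hence hX: "h \<le> X" using h elim by simp
        have "X powr \<epsilon> * h \<le> X powr \<epsilon> * X powr (1 - \<epsilon>)" using h by (intro mult_left_mono) auto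
        also have "\<dots> = X" using elim by (simp add: powr_add[symmetric])
        finally have "X powr \<epsilon> \<le> X / h" using h by (simp add: pos_le_divide_eq)
        with elim have "T0 \<le> X / h" by linarith
        thus "integral {X..2 * X} (\<lambda>x. (Delta k (x + h) - Delta k x)\<^sup>2) \<le> K * (h * X powr (2 * c + \<eta>))"
          unfolding K_def using C elim by (intro Delta_difference_mean_square c \<eta> h hX T0) auto
      qed
    qed
  qed
  moreover have "K \<ge> 0" using C \<eta> by (simp add: K_def mean_value_const_def)
  ultimately show ?thesis by blast
qed

theorem theorem1:
  fixes k :: nat and \<sigma> :: real
  assumes "3 \<le> k"
    and "1/2 \<le> \<sigma>" and "\<sigma> < 1"
    and "\<And>\<epsilon>::real. \<epsilon> > 0 \<Longrightarrow>
      (\<lambda>T. integral {0..T} (\<lambda>t. norm (zeta (Complex \<sigma> t)) ^ (2 * k)))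
        \<in> O[at_top](\<lambda>T. T powr (1 + \<epsilon>))"
  shows "(\<sigma> = 1/2 \<longrightarrow>
      (\<forall>\<epsilon>::real. \<epsilon> > 0 \<longrightarrow>
        (\<exists>C. \<forall>\<^sub>F X::real in at_top. \<forall>h::real.
          X powr \<epsilon> \<le> h \<and> h \<le> X powr (1 - \<epsilon>) \<longrightarrow>
          integral {X..2 * X} (\<lambda>x. (Delta k (x + h) - Delta k x)\<^sup>2)
            \<le> C * X powr (1 + \<epsilon>) * h powr (4/3))))
    \<and>
    (1/2 < \<sigma> \<longrightarrow>
      (\<forall>\<theta>::real. 2 * \<sigma> - 1 < \<theta> \<and> \<theta> < 1 \<longrightarrow>
        (\<exists>\<epsilon>\<^sub>1 > 0. \<exists>C. \<forall>\<epsilon>::real. \<epsilon> > 0 \<longrightarrow>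
          (\<forall>\<^sub>F X::real in at_top. \<forall>h::real.
            X powr \<theta> \<le> h \<and> h \<le> X powr (1 - \<epsilon>) \<longrightarrow>
            integral {X..2 * X} (\<lambda>x. (Delta k (x + h) - Delta k x)\<^sup>2)
              \<le> C * X powr (1 - \<epsilon>\<^sub>1) * h\<^sup>2))))"
proof (intro conjI impI allI; (elim conjE)?)
  fix \<epsilon> :: real assume \<sigma>: "\<sigma> = 1/2" and \<epsilon>: "\<epsilon> > 0"
  \<comment> \<open>Capped at 1/2 because the tail of the moment needs \<eta> < 1, while \<epsilon>
    may be large.\<close>
  define \<eta> where "\<eta> = min \<epsilon> (1/2)"
  have \<eta>: "0 < \<eta>" "\<eta> < 1" "\<eta> \<le> \<epsilon>" using \<epsilon> by (auto simp: \<eta>_def)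
  obtain K where K: "K \<ge> 0" "\<And>\<epsilon>. \<epsilon> > 0 \<Longrightarrow> \<forall>\<^sub>F X::real in at_top. \<forall>h::real. 1 \<le> h \<and> h \<le> X powr (1 - \<epsilon>) \<longrightarrow>
     integral {X..2 * X} (\<lambda>x. (Delta k (x + h) - Delta k x)\<^sup>2) \<le> K * (h * X powr (2 * \<sigma> + \<eta>))"
    using Delta_difference_mean_square_eventually[OF assms(2,3) \<eta>(1,2) assms(4)[OF \<eta>(1)]] by blast
  have "\<forall>\<^sub>F X::real in at_top. \<forall>h::real. X powr \<epsilon> \<le> h \<and> h \<le> X powr (1 - \<epsilon>) \<longrightarrow>
      integral {X..2 * X} (\<lambda>x. (Delta k (x + h) - Delta k x)\<^sup>2) \<le> K * X powr (1 + \<epsilon>) * h powr (4/3)"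
    using K(2)[OF \<epsilon>] eventually_ge_at_top[of 1]
  proof eventually_elim
    case (elim X)
    show ?case
    proof safe
      fix h assume h: "X powr \<epsilon> \<le> h" "h \<le> X powr (1 - \<epsilon>)"
      have "X powr \<epsilon> \<ge> 1" using elim \<epsilon> by (intro ge_one_powr_ge_zero) auto
      hence h1: "h \<ge> 1" using h by linarith
      have "h powr 1 \<le> h powr (4/3)" using h1 by (intro powr_mono) auto
      moreover have "X powr (2 * \<sigma> + \<eta>) \<le> X powr (1 + \<epsilon>)" using elim \<eta> \<sigma> by (intro powr_mono) auto
      ultimately have "h * X powr (2 * \<sigma> + \<eta>) \<le> h powr (4/3) * X powr (1 + \<epsilon>)"
        using h1 by (intro mult_mono) auto
      hence "K * (h * X powr (2 * \<sigma> + \<eta>)) \<le> K * X powr (1 + \<epsilon>) * h powr (4/3)"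
        using K(1) by (simp add: mult.assoc mult.commute[of "h powr (4/3)"] mult_left_mono)
      thus "integral {X..2 * X} (\<lambda>x. (Delta k (x + h) - Delta k x)\<^sup>2) \<le> K * X powr (1 + \<epsilon>) * h powr (4/3)"
        using elim(1) h h1 by fastforce
    qed
  qed
  thus "\<exists>C. \<forall>\<^sub>F X::real in at_top. \<forall>h::real. X powr \<epsilon> \<le> h \<and> h \<le> X powr (1 - \<epsilon>) \<longrightarrow>
      integral {X..2 * X} (\<lambda>x. (Delta k (x + h) - Delta k x)\<^sup>2) \<le> C * X powr (1 + \<epsilon>) * h powr (4/3)"
    by blast
next
  fix \<theta> :: real assume \<sigma>: "1/2 < \<sigma>" and \<theta>: "2 * \<sigma> - 1 < \<theta>" "\<theta> < 1"
  \<comment> \<open>Half of the slack in \<open>2 * \<sigma> - 1 < \<theta>\<close>: one half is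
    spent on the loss in the moment bound, the other is the saving, so that
    \<open>2 * \<sigma> + \<eta> = (1 - \<eta>) + \<theta>\<close> and \<eta> serves as
    \<open>\<epsilon>\<^sub>1\<close>.\<close>
  define \<eta> where "\<eta> = (\<theta> - 2 * \<sigma> + 1) / 2"
  have \<eta>: "0 < \<eta>" "\<eta> < 1" using \<theta> \<sigma> by (auto simp: \<eta>_def)
  obtain K where K: "K \<ge> 0" "\<And>\<epsilon>. \<epsilon> > 0 \<Longrightarrow> \<forall>\<^sub>F X::real in at_top. \<forall>h::real. 1 \<le> h \<and> h \<le> X powr (1 - \<epsilon>) \<longrightarrow>
     integral {X..2 * X} (\<lambda>x. (Delta k (x + h) - Delta k x)\<^sup>2) \<le> K * (h * X powr (2 * \<sigma> + \<eta>))"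
    using Delta_difference_mean_square_eventually[OF assms(2,3) \<eta> assms(4)[OF \<eta>(1)]] by blast
  have "\<forall>\<^sub>F X::real in at_top. \<forall>h::real. X powr \<theta> \<le> h \<and> h \<le> X powr (1 - \<epsilon>) \<longrightarrow>
      integral {X..2 * X} (\<lambda>x. (Delta k (x + h) - Delta k x)\<^sup>2) \<le> K * X powr (1 - \<eta>) * h\<^sup>2"
    if \<epsilon>: "\<epsilon> > 0" for \<epsilon> :: real
    using K(2)[OF \<epsilon>] eventually_ge_at_top[of 1]
  proof eventually_elim
    case (elim X)
    show ?case
    proof safe
      fix h assume h: "X powr \<theta> \<le> h" "h \<le> X powr (1 - \<epsilon>)"
      have "X powr \<theta> \<ge> 1" using elim \<theta> \<sigma> by (intro ge_one_powr_ge_zero) auto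
      hence h1: "h \<ge> 1" using h by linarith
      have "2 * \<sigma> + \<eta> = (1 - \<eta>) + \<theta>" by (simp add: \<eta>_def field_simps)
      hence "X powr (2 * \<sigma> + \<eta>) = X powr (1 - \<eta>) * X powr \<theta>" by (simp only: powr_add)
      also have "\<dots> \<le> X powr (1 - \<eta>) * h" using h by (intro mult_left_mono) auto
      finally have "h * X powr (2 * \<sigma> + \<eta>) \<le> h * (X powr (1 - \<eta>) * h)"
        using h1 by (intro mult_left_mono) auto
      hence "K * (h * X powr (2 * \<sigma> + \<eta>)) \<le> K * (h * (X powr (1 - \<eta>) * h))"
        using K(1) by (rule mult_left_mono)
      also have "\<dots> = K * X powr (1 - \<eta>) * h\<^sup>2" by (simp add: power2_eq_square)
      finally show "integral {X..2 * X} (\<lambda>x. (Delta k (x + h) - Delta k x)\<^sup>2) \<le> K * X powr (1 - \<eta>) * h\<^sup>2"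
        using elim(1) h h1 by fastforce
    qed
  qed
  thus "\<exists>\<epsilon>\<^sub>1 > 0. \<exists>C. \<forall>\<epsilon>::real. \<epsilon> > 0 \<longrightarrow> (\<forall>\<^sub>F X::real in at_top. \<forall>h::real.
      X powr \<theta> \<le> h \<and> h \<le> X powr (1 - \<epsilon>) \<longrightarrow>
      integral {X..2 * X} (\<lambda>x. (Delta k (x + h) - Delta k x)\<^sup>2) \<le> C * X powr (1 - \<epsilon>\<^sub>1) * h\<^sup>2)"
    using \<eta>(1) by blast
qed

end
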